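(* Let $I$ be an open interval of $\mathbb R$, $\gamma,\alpha:I\to\mathbb R$ locally bounded with $\alpha\ge0$, $\sigma\in\mathbb C$, and $\tilde f\in\tilde{\mathscr G}_\sigma(I,\gamma,\alpha)$. Then the compositional inverse $\tilde h:=\tilde f^{\circ(-1)}$ belongs to $\tilde{\mathscr G}_{-\sigma}(I,\gamma^*,\alpha)$ with $\gamma^*:=\gamma+|\sigma|+2\sqrt\alpha$, and $$\mathcal S^I\tilde f\bigl(\mathcal D(I,\gamma_1)\bigr)\subset\mathcal D(I,\gamma^* ),\qquad(\mathcal S^I\tilde h)\circ\mathcal S^I\tilde f=\mathrm{id}\ \text{ on }\mathcal D(I,\gamma_1),$$ $$\mathcal S^I\tilde h\bigl(\mathcal D(I,\gamma_2)\bigr)\subset\mathcal D(I,\gamma),\qquad(\mathcal S^I\tilde f)\circ\mathcal S^I\tilde h=\mathrm{id}\ \text{ on }\mathcal D(I,\gamma_2),$$ with $\gamma_1:=\gamma+2|\sigma|+(1+\sqrt2)\sqrt\alpha$ and $\gamma_2:=\gamma+|\sigma|+(1+\sqrt2)\sqrt\alpha$. Moreover, $\mathcal S^I\tilde f$ is injective on $\mathcal D\bigl(I,\gamma+(1+\sqrt2)\sqrt\alpha\bigr)$.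
   Context: $\tilde{\mathscr G}=\mathrm{id}+\mathbb C[[z^{-1}]]$ is a group for the composition $(\mathrm{id}+\tilde\varphi)\circ(\mathrm{id}+\tilde\chi)=\mathrm{id}+\tilde\chi+\sum_{p\ge0}\frac1{p!}\tilde\chi^p\partial^p\tilde\varphi$, $\partial=d/dz$. The formal Borel transform is $\mathcal B(a+\sum_{n\ge0}a_nz^{-n-1})=a\delta+\sum a_n\frac{\zeta^n}{n!}$, $\delta$ a symbol. A function on $I$ is locally bounded if bounded on compact subintervals. $\mathcal N(I,\gamma,\alpha)$ is the set of $\hat\varphi\in\mathbb C\{\zeta\}$ extending analytically to $\{\xi e^{\mathrm i\theta}\mid\xi>0,\theta\in I\}$ with $|\hat\varphi(\xi e^{\mathrm i\theta})|\le\alpha(\theta)e^{\gamma(\theta)\xi}$. $\tilde{\mathscr G}_\sigma(I,\gamma,\alpha)$ is the set of $\tilde f=\mathrm{id}+\sigma+\tilde\varphi$ with $\tilde\varphi\in z^{-1}\mathbb C[[z^{-1}]]$ and $\mathcal B\tilde\varphi\in\mathcal N(I,\gamma,\alpha)$. Let $\Pi^\theta_c=\{\mathrm{Re}(ze^{\mathrm i\theta})>c\}$, $\mathcal D(I,\gamma)=\bigcup_{\theta\in I}\Pi^\theta_{\gamma(\theta)}$. For such $\tilde f$, with $\hat\varphi=\mathcal B\tilde\varphi$, $\mathcal S^I\tilde f(z)=z+\sigma+\int_0^{+\infty}e^{-z\xi e^{\mathrm i\theta}}\hat\varphi(\xi e^{\mathrm i\theta})e^{\mathrm i\theta}d\xi$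 for any $\theta\in I$ with $z\in\Pi^\theta_{\gamma(\theta)}$, a well-defined holomorphic function on $\mathcal D(I,\gamma)$. When $|I|>\pi$ one takes $\gamma>0$ and the half-planes are regarded as subsets of the Riemann surface of the logarithm, $\Pi^\theta_{\gamma(\theta)}$ being replaced by its lift $\{z=re^{\mathrm i t}\mid r>\gamma(\theta),\ |t+\theta|<\arccos(\gamma(\theta)/r)\}$ ($t=\arg z$ not modulo $2\pi$), and additions $z+\cdots$ are performed inside the lifted half-plane of the same direction $\theta$. *)

theory Defs
  imports "HOL-Complex_Analysis.Complex_Analysis" "HOL-Algebra.Group"
begin

text \<open>A formal series in \<open>\<complex>[[z\<^sup>-\<^sup>1]]\<close> is a \<open>complex fps\<close> in the variable \<open>T = z\<^sup>-\<^sup>1\<close>, and an element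
  \<open>id + \<phi>\<close> of the group \<open>id + \<complex>[[z\<^sup>-\<^sup>1]]\<close> is represented by the series \<open>\<phi>\<close> alone (so \<open>id\<close> is \<open>0\<close>).\<close>

text \<open>\<open>d/dz = - T\<^sup>2 d/dT\<close>.\<close>

definition ddz :: "complex fps \<Rightarrow> complex fps"
  where "ddz \<phi> = - (fps_X ^ 2 * fps_deriv \<phi>)"

text \<open>\<open>(id + \<phi>) \<circ> (id + \<eta>)\<close>; the series converges in the \<open>T\<close>-adic topology of \<open>fps\<close>.\<close>

definition comp_summand :: "complex fps \<Rightarrow> complex fps \<Rightarrow> nat \<Rightarrow> complex fps"
  where "comp_summand \<phi> \<eta> p = fps_const (1 / fact p) * \<eta> ^ p * (ddz ^^ p) \<phi>"

definition id_plus_comp :: "complex fps \<Rightarrow> complex fps \<Rightarrow> complex fps"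
  where "id_plus_comp \<phi> \<eta> = \<eta> + (\<Sum>p. comp_summand \<phi> \<eta> p)"

definition id_plus_group :: "complex fps monoid"
  where "id_plus_group = \<lparr>carrier = UNIV, mult = id_plus_comp, one = 0\<rparr>"

lemma fps_nth_ddz_power: "n < p \<Longrightarrow> fps_nth ((ddz ^^ p) \<phi>) n = 0"
proof (induction p arbitrary: n)
  case (Suc p)
  have "fps_nth (fps_X ^ 2 * fps_deriv ((ddz ^^ p) \<phi>)) n = 0"
  proof (cases "n < 2")
    case False
    then have "n - 2 + 1 < p"
      using Suc.prems by linarith
    then show ?thesis
      using Suc.IH[of "n - 2 + 1"] by (simp add: fps_X_power_mult_nth)
  qed (simp add: fps_X_power_mult_nth)
  moreover have "(ddz ^^ Suc p) \<phi> = - (fps_X ^ 2 * fps_deriv ((ddz ^^ p) \<phi>))"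
    by (simp add: ddz_def[of "(ddz ^^ p) \<phi>"])
  ultimately show ?case
    by simp
qed simp

lemma fps_nth_comp_summand: "n < p \<Longrightarrow> fps_nth (comp_summand \<phi> \<eta> p) n = 0"
  by (simp add: comp_summand_def fps_mult_nth[of _ "(ddz ^^ p) \<phi>"] fps_nth_ddz_power)

lemma summable_comp_summand: "summable (comp_summand \<phi> \<eta>)"
proof -
  let ?S = "Abs_fps (\<lambda>n. \<Sum>p\<le>n. fps_nth (comp_summand \<phi> \<eta> p) n)"
  have "(\<lambda>N. \<Sum>p<N. comp_summand \<phi> \<eta> p) \<longlonglongrightarrow> ?S"
  proof (rule tendsto_fpsI)
    fix n
    have "fps_nth (\<Sum>p<N. comp_summand \<phi> \<eta> p) n = fps_nth ?S n" if "N > n" for N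
    proof -
      have "(\<Sum>p<N. fps_nth (comp_summand \<phi> \<eta> p) n) = (\<Sum>p\<le>n. fps_nth (comp_summand \<phi> \<eta> p) n)"
        using that by (intro sum.mono_neutral_right) (auto intro!: fps_nth_comp_summand)
      then show ?thesis
        by (simp add: fps_sum_nth)
    qed
    then show "\<forall>\<^sub>F N in sequentially. fps_nth (\<Sum>p<N. comp_summand \<phi> \<eta> p) n = fps_nth ?S n"
      by (rule eventually_mono[OF eventually_gt_at_top[of n]])
  qed
  then show ?thesis
    by (auto simp: summable_def sums_def)
qed

text \<open>The pair \<open>(a, \<psi>)\<close> stands for \<open>a\<delta> + \<psi>(\<zeta>)\<close>.\<close>

definition formal_borel :: "complex fps \<Rightarrow> complex \<times> complex fps"
  where "formal_borel \<phi> = (fps_nth \<phi> 0, Abs_fps (\<lambda>n. fps_nth \<phi> (Suc n) / fact n))"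

definition locally_bounded_on :: "real set \<Rightarrow> (real \<Rightarrow> real) \<Rightarrow> bool"
  where "locally_bounded_on I g \<longleftrightarrow> (\<forall>a b. {a..b} \<subseteq> I \<longrightarrow> bounded (g ` {a..b}))"

definition sector :: "real set \<Rightarrow> complex set"
  where "sector I = {of_real \<xi> * cis \<theta> | \<xi> \<theta>. \<xi> > 0 \<and> \<theta> \<in> I}"

text \<open>The union of the sector and a disc about \<open>0\<close> is star-shaped, so for \<open>I\<close> a nonempty open interval
  the extension is unique on the sector, and it is single-valued in \<open>\<zeta>\<close> even if \<open>I\<close> is longer
  than \<open>2\<pi>\<close>.\<close>

definition extends_to_sector :: "real set \<Rightarrow> complex fps \<Rightarrow> (complex \<Rightarrow> complex) \<Rightarrow> bool"
  where "extends_to_sector I \<psi> F \<longleftrightarrow> fps_conv_radius \<psi> > 0 \<and> F holomorphic_on sector I \<and>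
    (\<forall>\<^sub>F \<zeta> in at 0 within sector I. F \<zeta> = eval_fps \<psi> \<zeta>)"

definition sector_extension :: "real set \<Rightarrow> complex fps \<Rightarrow> complex \<Rightarrow> complex"
  where "sector_extension I \<psi> = (SOME F. extends_to_sector I \<psi> F)"

definition N_space :: "real set \<Rightarrow> (real \<Rightarrow> real) \<Rightarrow> (real \<Rightarrow> real) \<Rightarrow> complex fps set"
  where "N_space I \<gamma> \<alpha> = {\<psi>. \<exists>F. extends_to_sector I \<psi> F \<and>
    (\<forall>\<theta>\<in>I. \<forall>\<xi>>0. cmod (F (of_real \<xi> * cis \<theta>)) \<le> \<alpha> \<theta> * exp (\<gamma> \<theta> * \<xi>))}"

definition G_space :: "complex \<Rightarrow> real set \<Rightarrow> (real \<Rightarrow> real) \<Rightarrow> (real \<Rightarrow> real) \<Rightarrow> complex fps set"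
  where "G_space \<sigma> I \<gamma> \<alpha> = {fps_const \<sigma> + \<phi> | \<phi>.
    fps_nth \<phi> 0 = 0 \<and> snd (formal_borel \<phi>) \<in> N_space I \<gamma> \<alpha>}"

text \<open>The value \<open>z + \<sigma> + \<integral> \<dots>\<close> computed along the ray of direction \<open>\<theta>\<close>; for \<open>f = id + \<sigma> + \<phi>\<close>, the
  components of \<open>formal_borel\<close> are \<open>\<sigma>\<close> and the Borel transform of \<open>\<phi>\<close>.\<close>

definition dir_sum :: "real set \<Rightarrow> complex fps \<Rightarrow> real \<Rightarrow> complex \<Rightarrow> complex"
  where "dir_sum I f \<theta> z = z + fst (formal_borel f) +
    (LBINT \<xi>:{0<..}. exp (- (z * of_real \<xi> * cis \<theta>)) *
       sector_extension I (snd (formal_borel f)) (of_real \<xi> * cis \<theta>) * cis \<theta>)"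


subsection \<open>Intervals of length at most \<open>\<pi>\<close>: domains in the plane\<close>

definition half_plane :: "real \<Rightarrow> real \<Rightarrow> complex set"
  where "half_plane \<theta> c = {z. Re (z * cis \<theta>) > c}"

definition plane_domain :: "real set \<Rightarrow> (real \<Rightarrow> real) \<Rightarrow> complex set"
  where "plane_domain I \<gamma> = (\<Union>\<theta>\<in>I. half_plane \<theta> (\<gamma> \<theta>))"

definition plane_sum :: "real set \<Rightarrow> (real \<Rightarrow> real) \<Rightarrow> complex fps \<Rightarrow> complex \<Rightarrow> complex"
  where "plane_sum I \<gamma> f z = (THE w. \<exists>\<theta>\<in>I. z \<in> half_plane \<theta> (\<gamma> \<theta>) \<and> w = dir_sum I f \<theta> z)"


subsection \<open>Intervals of length greater than \<open>\<pi>\<close>: domains in the Riemann surface of the logarithm\<close>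

definition long_interval :: "real set \<Rightarrow> bool"
  where "long_interval I \<longleftrightarrow> (\<exists>a\<in>I. \<exists>b\<in>I. b - a > pi)"

text \<open>A point of the Riemann surface of the logarithm is a pair \<open>(r, t)\<close> with \<open>r > 0\<close> and \<open>t\<close> its
  argument, not modulo \<open>2\<pi>\<close>. For \<open>c \<ge> 0\<close> the projection maps \<open>log_half_plane \<theta> c\<close> bijectively onto
  \<open>half_plane \<theta> c\<close>.\<close>

definition log_proj :: "real \<times> real \<Rightarrow> complex"
  where "log_proj p = rcis (fst p) (snd p)"

definition log_half_plane :: "real \<Rightarrow> real \<Rightarrow> (real \<times> real) set"
  where "log_half_plane \<theta> c = {(r, t). r > c \<and> \<bar>t + \<theta>\<bar> < arccos (c / r)}"

definition log_domain :: "real set \<Rightarrow> (real \<Rightarrow> real) \<Rightarrow> (real \<times> real) set"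
  where "log_domain I \<gamma> = (\<Union>\<theta>\<in>I. log_half_plane \<theta> (\<gamma> \<theta>))"

text \<open>The value at a point \<open>p\<close> of the lifted half-plane of direction \<open>\<theta>\<close> is the point \<open>q\<close> above the
  complex number \<open>z + \<sigma> + \<dots>\<close> in the lift of \<open>Re (z e\<^sup>i\<^sup>\<theta>) > 0\<close> of the same direction. There is no such
  \<open>q\<close> if adding \<open>\<sigma> + \<dots>\<close> leaves this half-plane. If \<open>q\<close> exists, it does not depend on \<open>\<theta>\<close>.\<close>

definition is_log_value ::
    "real set \<Rightarrow> (real \<Rightarrow> real) \<Rightarrow> complex fps \<Rightarrow> real \<times> real \<Rightarrow> real \<times> real \<Rightarrow> bool"
  where "is_log_value I \<gamma> f p q \<longleftrightarrow> (\<exists>\<theta>\<in>I. p \<in> log_half_plane \<theta> (\<gamma> \<theta>) \<and>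
    q \<in> log_half_plane \<theta> 0 \<and> log_proj q = dir_sum I f \<theta> (log_proj p))"

definition log_sum ::
    "real set \<Rightarrow> (real \<Rightarrow> real) \<Rightarrow> complex fps \<Rightarrow> real \<times> real \<Rightarrow> real \<times> real"
  where "log_sum I \<gamma> f p = (THE q. is_log_value I \<gamma> f p q)"

text \<open>Injectivity on \<open>log_domain I \<gamma>\<close> of the lifted sum, also at points where \<open>log_sum\<close> has no value
  because \<open>z + \<sigma> + \<dots>\<close> leaves the lifted half-plane. Values computed in directions \<open>\<theta>\<^sub>1\<close>, \<open>\<theta>\<^sub>2\<close> lie on
  a common sheet only if the two lifted half-planes meet, i.e. \<open>\<bar>\<theta>\<^sub>1 - \<theta>\<^sub>2\<bar> < \<pi>\<close>; injectivity says
  that two such values differ as complex numbers when the points differ. A common value \<open>q\<close> in the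
  sense of \<open>is_log_value\<close> always comes from two such directions, see \<open>log_injective_onD\<close>.\<close>

definition log_injective_on :: "real set \<Rightarrow> (real \<Rightarrow> real) \<Rightarrow> complex fps \<Rightarrow> bool"
  where "log_injective_on I \<gamma> f \<longleftrightarrow>
    (\<forall>\<theta>\<^sub>1\<in>I. \<forall>\<theta>\<^sub>2\<in>I. \<forall>p\<^sub>1\<in>log_half_plane \<theta>\<^sub>1 (\<gamma> \<theta>\<^sub>1). \<forall>p\<^sub>2\<in>log_half_plane \<theta>\<^sub>2 (\<gamma> \<theta>\<^sub>2).
       \<bar>\<theta>\<^sub>1 - \<theta>\<^sub>2\<bar> < pi \<and> dir_sum I f \<theta>\<^sub>1 (log_proj p\<^sub>1) = dir_sum I f \<theta>\<^sub>2 (log_proj p\<^sub>2) \<longrightarrow> p\<^sub>1 = p\<^sub>2)"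

lemma log_injective_onD:
  assumes "log_injective_on I \<gamma> f" "is_log_value I \<gamma> f p\<^sub>1 q" "is_log_value I \<gamma> f p\<^sub>2 q"
  shows "p\<^sub>1 = p\<^sub>2"
proof -
  obtain \<theta>\<^sub>1 where 1: "\<theta>\<^sub>1 \<in> I" "p\<^sub>1 \<in> log_half_plane \<theta>\<^sub>1 (\<gamma> \<theta>\<^sub>1)" "q \<in> log_half_plane \<theta>\<^sub>1 0"
      "log_proj q = dir_sum I f \<theta>\<^sub>1 (log_proj p\<^sub>1)"
    using assms(2) unfolding is_log_value_def by blast
  obtain \<theta>\<^sub>2 where 2: "\<theta>\<^sub>2 \<in> I" "p\<^sub>2 \<in> log_half_plane \<theta>\<^sub>2 (\<gamma> \<theta>\<^sub>2)" "q \<in> log_half_plane \<theta>\<^sub>2 0"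
      "log_proj q = dir_sum I f \<theta>\<^sub>2 (log_proj p\<^sub>2)"
    using assms(3) unfolding is_log_value_def by blast
  have "\<bar>\<theta>\<^sub>1 - \<theta>\<^sub>2\<bar> < pi"
  proof -
    have "\<bar>snd q + \<theta>\<^sub>1\<bar> < pi / 2" "\<bar>snd q + \<theta>\<^sub>2\<bar> < pi / 2"
      using 1(3) 2(3) by (auto simp: log_half_plane_def)
    then show ?thesis
      by linarith
  qed
  then show ?thesis
    using assms(1) 1 2 unfolding log_injective_on_def by metis
qed

end

theory Submission
  imports Defs "HOL-Probability.Sinc_Integral" "HOL-Real_Asymp.Real_Asymp"
begin

text \<open>
  Write \<open>f = (id + \<sigma>) \<circ> (id + \<phi>)\<close>. Lagrange inversion gives
  \<open>(id + \<phi>)\<^sup>-\<^sup>1 = id + \<Sum>k\<ge>1. (-1)\<^sup>k / k! \<cdot> \<partial>\<^bsup>k-1\<^esup> (\<phi>\<^sup>k)\<close>, and \<open>h\<close> is this series composed with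
  \<open>id - \<sigma>\<close>. Under the Borel transform \<open>\<partial>\<close> becomes multiplication by \<open>- \<zeta>\<close>, products become
  convolutions and the translation becomes multiplication by \<open>exp (\<sigma> \<zeta>)\<close>, so that the Borel transform
  of the non-constant part of \<open>h\<close> is \<open>- exp (\<sigma> \<zeta>) \<Sum>k\<ge>0. \<zeta>\<^sup>k / (k + 1)! \<cdot> G\<^bsup>*(k+1)\<^esup>\<close>, where \<open>G\<close> is that of
  \<open>\<phi>\<close>. On the ray of direction \<open>\<theta>\<close>, \<open>\<bar>G\<^bsup>*(k+1)\<^esup>\<bar> \<le> \<alpha>\<^bsup>k+1\<^esup> \<xi>\<^sup>k / k! \<cdot> exp (\<gamma> \<xi>)\<close>, and
  \<open>\<Sum>k. (\<alpha> \<xi>\<^sup>2)\<^sup>k / (k!)\<^sup>2 \<le> exp (2 \<surd>\<alpha> \<xi>)\<close> yields the exponential type \<open>\<gamma> + \<bar>\<sigma>\<bar> + 2 \<surd>\<alpha>\<close>.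

  The Laplace transform in a fixed direction turns the series back into Lagrange's, so the sum of
  \<open>h\<close> is a left inverse of the sum of \<open>f\<close>. It is a right inverse far to the right, where the sum of
  \<open>f\<close> is onto by Brouwer's theorem, and then on the whole half-plane by analytic continuation.
  Rotating the ray of integration shows that different directions give the same sums.
\<close>

section \<open>Formal composition and Lagrange inversion\<close>

text \<open>Only one inverse relation comes out of the Lagrange series: at a point z + \<Phi>(z),
  with \<Phi> the Laplace transform of the Borel transform of \<phi>, its terms can be regrouped,
  but a given u is not known in advance to have this form. Hence the topological argument for the
  other relation. The analysis is done in one direction, in the rotated variable Z = z cis \<theta>,
  with functions on the half-line. Let s = sqrt \<alpha> and x = Re Z - \<gamma>. Then |\<Phi>| is
  at most s^2 / x, and the image lies where the transform of the inverse converges if x - s^2 / x >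
  2 s, that is, if x > (1 + sqrt 2) s. The shift enters \<open>\<gamma>\<^sub>1\<close> twice, once
  because it moves the point and once because it belongs to \<open>\<gamma>\<^sub>s\<close>; it is
  absent from \<open>\<gamma>\<^sub>3\<close> because adding a constant does not affect injectivity.
  Directions are compared only when they differ by less than \<pi>. This covers any two directions
  of a short open interval and, on the surface of the logarithm, any two whose lifted half-planes
  meet. Convolutions integrate from 0, a point outside the sector, so a disc of convergence is first
  glued to it.\<close>

lemma ddz_add: "ddz (a + b) = ddz a + ddz b"
  by (simp add: ddz_def algebra_simps)

lemma ddz_const_mult: "ddz (fps_const c * a) = fps_const c * ddz a"
  by (simp add: ddz_def algebra_simps)

lemma ddz_mult: "ddz (a * b) = ddz a * b + a * ddz b"
  by (simp add: ddz_def algebra_simps)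

lemma ddz_0 [simp]: "ddz 0 = 0"
  by (simp add: ddz_def)

lemma ddz_const [simp]: "ddz (fps_const c) = 0"
  by (simp add: ddz_def)

lemma ddz_sum: "ddz (\<Sum>i\<in>A. g i) = (\<Sum>i\<in>A. ddz (g i))"
  by (induction A rule: infinite_finite_induct) (auto simp: ddz_add)

lemma ddz_funpow_const_mult: "(ddz ^^ p) (fps_const c * a) = fps_const c * (ddz ^^ p) a"
  by (induction p) (auto simp: ddz_const_mult)

lemma ddz_funpow_0 [simp]: "(ddz ^^ p) 0 = 0"
  by (induction p) auto

lemma ddz_funpow_sum: "(ddz ^^ p) (\<Sum>i\<in>A. g i) = (\<Sum>i\<in>A. (ddz ^^ p) (g i))"
  by (induction p) (auto simp: ddz_sum)

lemma fps_nth_ddz: "fps_nth (ddz a) n = - (of_nat (n - 1) * fps_nth a (n - 1))"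
proof (cases "n < 2")
  case True
  then show ?thesis by (cases n) (auto simp: ddz_def fps_X_power_mult_nth)
next
  case False
  then obtain m where "n = Suc (Suc m)" by (metis add_2_eq_Suc le_Suc_ex not_less)
  then show ?thesis by (simp add: ddz_def fps_X_power_mult_nth)
qed

text \<open>Coefficient m of \<open>ddz a\<close> involves only coefficient m - 1 of
  \<open>a\<close>. A series may therefore be truncated after degree n before differentiating when
  only coefficients up to n are read off.\<close>

lemma fps_nth_ddz_funpow_cong:
  assumes "\<And>i. i \<le> n \<Longrightarrow> fps_nth a i = fps_nth b i" "m \<le> n"
  shows "fps_nth ((ddz ^^ p) a) m = fps_nth ((ddz ^^ p) b) m"
  using assms(2) by (induction p arbitrary: m) (auto simp: fps_nth_ddz assms(1))

text \<open>Summand p has order at least p in T, so the partial sums of the T-adic series are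
  stationary in degree n once p has passed n.\<close>

lemma fps_nth_suminf_comp_summand:
  assumes "n \<le> M"
  shows "fps_nth (\<Sum>p. comp_summand \<phi> \<eta> p) n = (\<Sum>p\<le>M. fps_nth (comp_summand \<phi> \<eta> p) n)"
proof -
  let ?s = "\<lambda>N. \<Sum>p<N. comp_summand \<phi> \<eta> p"
  have "?s \<longlonglongrightarrow> (\<Sum>p. comp_summand \<phi> \<eta> p)"
    using summable_LIMSEQ[OF summable_comp_summand] .
  then have "(\<lambda>N. fps_nth (?s N) n) \<longlonglongrightarrow> fps_nth (\<Sum>p. comp_summand \<phi> \<eta> p) n"
    unfolding tendsto_fps_iff by (intro tendsto_eventually) blast
  moreover have "fps_nth (?s N) n = (\<Sum>p\<le>M. fps_nth (comp_summand \<phi> \<eta> p) n)" if "N > M" for N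
    unfolding fps_sum_nth using that assms
    by (intro sum.mono_neutral_right) (auto intro!: fps_nth_comp_summand)
  then have "(\<lambda>N. fps_nth (?s N) n) \<longlonglongrightarrow> (\<Sum>p\<le>M. fps_nth (comp_summand \<phi> \<eta> p) n)"
    by (intro tendsto_eventually eventually_mono[OF eventually_gt_at_top[of M]]) auto
  ultimately show ?thesis
    by (rule LIMSEQ_unique)
qed

section \<open>Composition as a substitution in the variable T\<close>

lemma ddz_funpow_fps_X_power:
  "(ddz ^^ p) (fps_X ^ m) = fps_const ((-1) ^ p * pochhammer (of_nat m) p) * fps_X ^ (m + p)"
proof (induction p)
  case (Suc p)
  have "ddz (fps_X ^ k) = - (fps_const (of_nat k) * fps_X ^ (Suc k))" for k
    by (intro fps_ext) (auto simp: fps_nth_ddz)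
  then have "(ddz ^^ Suc p) (fps_X ^ m) =
      fps_const ((-1) ^ p * pochhammer (of_nat m) p) * - (fps_const (of_nat (m + p)) * fps_X ^ Suc (m + p))"
    using Suc by (simp add: ddz_const_mult)
  also have "\<dots> = fps_const ((-1) ^ Suc p * pochhammer (of_nat m) (Suc p)) * fps_X ^ (m + Suc p)"
    by (simp add: pochhammer_Suc flip: fps_const_mult fps_const_neg)
  finally show ?case .
qed simp

text \<open>This is 1 / (z + \<eta>) written in T = 1 / z, so substituting it for T in \<phi> gives
  \<phi>(z + \<eta>).\<close>

definition inv_change :: "complex fps \<Rightarrow> complex fps"
  where "inv_change \<eta> = fps_X * inverse (1 + fps_X * \<eta>)"

lemma inv_change_nth_0 [simp]: "fps_nth (inv_change \<eta>) 0 = 0"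
  by (simp add: inv_change_def)

text \<open>(z + \<eta>)^(-m) = z^(-m) (1 + \<eta> / z)^(-m), expanded by the binomial series with
  exponent -m.\<close>

lemma inv_change_power:
  "inv_change \<eta> ^ m = fps_X ^ m * (fps_binomial (- of_nat m) oo (fps_X * \<eta>))"
proof -
  have "fps_binomial (- of_nat m) = inverse ((1 + fps_X :: complex fps) ^ m)"
    by (simp add: fps_binomial_minus_of_nat fps_inverse_power)
  then have "(fps_binomial (- of_nat m) oo (fps_X * \<eta>)) = inverse ((1 + fps_X * \<eta>) ^ m)"
    by (simp add: fps_inverse_compose fps_compose_power[symmetric] fps_compose_add_distrib)
  then show ?thesis
    by (simp add: inv_change_def power_mult_distrib fps_inverse_power)
qed

text \<open>Taylor's formula for \<phi>(z + \<eta>). Both sides are linear in \<phi> and in degree n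
  only finitely many coefficients of \<phi> matter, so it suffices to treat powers of T, where the
  formula is the binomial series. It makes the composition accessible to the algebra of
  \<open>fps_compose\<close>.\<close>

lemma suminf_comp_summand:
  "(\<Sum>p. comp_summand \<phi> \<eta> p) = \<phi> oo inv_change \<eta>"
proof (rule fps_ext)
  fix n
  have mono: "(\<Sum>p\<le>n. fps_nth (comp_summand (fps_X ^ m) \<eta> p) n) = fps_nth (inv_change \<eta> ^ m) n" for m
  proof -
    have s: "comp_summand (fps_X ^ m) \<eta> p
        = fps_X ^ m * (fps_const ((- of_nat m) gchoose p) * (fps_X * \<eta>) ^ p)" for p
      by (simp add: comp_summand_def ddz_funpow_fps_X_power gbinomial_pochhammer power_mult_distrib
          power_add algebra_simps flip: fps_const_mult)
    have "fps_nth (inv_change \<eta> ^ m) n =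
        (\<Sum>i\<le>n. fps_nth (fps_X ^ m) i * fps_nth (fps_binomial (- of_nat m) oo (fps_X * \<eta>)) (n - i))"
      by (simp add: inv_change_power fps_mult_nth atLeast0AtMost)
    also have "\<dots> = (\<Sum>i\<le>n. fps_nth (fps_X ^ m) i * (\<Sum>p\<le>n. fps_nth (fps_const ((- of_nat m) gchoose p) * (fps_X * \<eta>) ^ p) (n - i)))"
    proof (intro sum.cong refl arg_cong2[where f = "(*)"])
      fix i
      \<comment> \<open>The bound n - i is raised to n, since \<open>(fps_X * \<eta>) ^ p\<close>
        has order at least p; with a range independent of i the two sums can be exchanged.\<close>
      have "(\<Sum>p=0..n - i. ((- of_nat m) gchoose p) * fps_nth ((fps_X * \<eta>) ^ p) (n - i))
          = (\<Sum>p\<le>n. ((- of_nat m) gchoose p) * fps_nth ((fps_X * \<eta>) ^ p) (n - i))"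
        by (intro sum.mono_neutral_left) (auto simp: startsby_zero_power_prefix)
      then show "fps_nth (fps_binomial (- of_nat m) oo (fps_X * \<eta>)) (n - i) =
          (\<Sum>p\<le>n. fps_nth (fps_const ((- of_nat m) gchoose p) * (fps_X * \<eta>) ^ p) (n - i))"
        by (simp add: fps_compose_nth)
    qed
    also have "\<dots> = (\<Sum>p\<le>n. \<Sum>i\<le>n. fps_nth (fps_X ^ m) i * fps_nth (fps_const ((- of_nat m) gchoose p) * (fps_X * \<eta>) ^ p) (n - i))"
      unfolding sum_distrib_left by (rule sum.swap)
    also have "\<dots> = (\<Sum>p\<le>n. fps_nth (comp_summand (fps_X ^ m) \<eta> p) n)"
      unfolding s by (simp add: fps_mult_nth[of "fps_X ^ m"] atLeast0AtMost)
    finally show ?thesis by simp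
  qed
  define \<phi>' where "\<phi>' = (\<Sum>m\<le>n. fps_const (fps_nth \<phi> m) * fps_X ^ m)"
  have \<phi>': "fps_nth \<phi> i = fps_nth \<phi>' i" if "i \<le> n" for i
    using that by (simp add: \<phi>'_def fps_sum_nth if_distrib sum.delta' cong: if_cong)
  have "fps_nth (comp_summand \<phi> \<eta> p) n = fps_nth (comp_summand \<phi>' \<eta> p) n" for p
    unfolding comp_summand_def
    by (subst (1 2) fps_mult_nth, intro sum.cong refl arg_cong2[where f = "(*)"]
        fps_nth_ddz_funpow_cong[of n] \<phi>') auto
  moreover have "comp_summand \<phi>' \<eta> p = (\<Sum>m\<le>n. fps_const (fps_nth \<phi> m) * comp_summand (fps_X ^ m) \<eta> p)" for p
    by (simp add: comp_summand_def \<phi>'_def ddz_funpow_sum ddz_funpow_const_mult sum_distrib_left mult.left_commute)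
  ultimately have "fps_nth (\<Sum>p. comp_summand \<phi> \<eta> p) n =
      (\<Sum>p\<le>n. \<Sum>m\<le>n. fps_nth \<phi> m * fps_nth (comp_summand (fps_X ^ m) \<eta> p) n)"
    by (simp add: fps_nth_suminf_comp_summand[of n n] fps_sum_nth)
  also have "\<dots> = (\<Sum>m\<le>n. fps_nth \<phi> m * (\<Sum>p\<le>n. fps_nth (comp_summand (fps_X ^ m) \<eta> p) n))"
    unfolding sum_distrib_left by (rule sum.swap)
  also have "\<dots> = fps_nth (\<phi> oo inv_change \<eta>) n"
    by (simp add: mono fps_compose_nth atLeast0AtMost)
  finally show "fps_nth (\<Sum>p. comp_summand \<phi> \<eta> p) n = fps_nth (\<phi> oo inv_change \<eta>) n" .
qed

lemma id_plus_comp_eq: "id_plus_comp \<phi> \<eta> = \<eta> + (\<phi> oo inv_change \<eta>)"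
  by (simp add: id_plus_comp_def suminf_comp_summand)

text \<open>Both sides are 1 / w for w = z + \<psi> + \<eta>(z + \<psi>). Multiplying the left side
  by 1 + T times the composite, which is w / z, leaves T.\<close>

lemma inv_change_compose:
  "(inv_change \<eta> oo inv_change \<psi>) = inv_change (id_plus_comp \<eta> \<psi>)"
proof -
  let ?u = "1 + fps_X * \<psi>" and ?A = "inv_change \<psi>"
  have u: "?A * ?u = fps_X"
    using inverse_mult_eq_1[of ?u] by (simp add: inv_change_def mult.assoc)
  have "(inv_change \<eta> oo ?A) * (1 + ?A * (\<eta> oo ?A)) = ?A"
  proof -
    have "inv_change \<eta> * (1 + fps_X * \<eta>) = fps_X"
      using inverse_mult_eq_1[of "1 + fps_X * \<eta>"] by (simp add: inv_change_def mult.assoc)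
    then have "((inv_change \<eta> * (1 + fps_X * \<eta>)) oo ?A) = (fps_X oo ?A)" by simp
    then show ?thesis
      by (simp add: fps_compose_mult_distrib fps_compose_add_distrib)
  qed
  then have "(inv_change \<eta> oo ?A) * ((1 + ?A * (\<eta> oo ?A)) * ?u) = fps_X"
    using u by (metis mult.assoc)
  also have "(1 + ?A * (\<eta> oo ?A)) * ?u = 1 + fps_X * id_plus_comp \<eta> \<psi>"
  proof -
    have "(1 + ?A * (\<eta> oo ?A)) * ?u = ?u + (?A * ?u) * (\<eta> oo ?A)"
      by (simp add: algebra_simps)
    then show ?thesis
      unfolding u by (simp add: id_plus_comp_eq algebra_simps)
  qed
  finally have *: "(inv_change \<eta> oo ?A) * (1 + fps_X * id_plus_comp \<eta> \<psi>) = fps_X"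
    .
  have "inv_change (id_plus_comp \<eta> \<psi>) = (inv_change \<eta> oo ?A) * (1 + fps_X * id_plus_comp \<eta> \<psi>) *
     inverse (1 + fps_X * id_plus_comp \<eta> \<psi>)"
    unfolding * by (simp add: inv_change_def)
  then show ?thesis
    using inverse_mult_eq_1'[of "1 + fps_X * id_plus_comp \<eta> \<psi>"] by (simp add: mult.assoc)
qed

lemma id_plus_comp_assoc:
  "id_plus_comp (id_plus_comp \<phi> \<eta>) \<psi> = id_plus_comp \<phi> (id_plus_comp \<eta> \<psi>)"
proof -
  have "id_plus_comp (id_plus_comp \<phi> \<eta>) \<psi> = \<psi> + (\<eta> oo inv_change \<psi>) + ((\<phi> oo inv_change \<eta>) oo inv_change \<psi>)"
    by (simp add: id_plus_comp_eq fps_compose_add_distrib algebra_simps)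
  also have "((\<phi> oo inv_change \<eta>) oo inv_change \<psi>) = (\<phi> oo inv_change (id_plus_comp \<eta> \<psi>))"
    by (simp add: fps_compose_assoc flip: inv_change_compose)
  finally show ?thesis by (simp add: id_plus_comp_eq)
qed

lemma id_plus_comp_0_left [simp]: "id_plus_comp 0 \<eta> = \<eta>"
  by (simp add: id_plus_comp_eq)

lemma id_plus_comp_const_left [simp]: "id_plus_comp (fps_const c) \<eta> = fps_const c + \<eta>"
  by (simp add: id_plus_comp_eq)

section \<open>Lagrange inversion in the formal group\<close>

text \<open>For \<open>j < N\<close> the following sum is the \<open>N\<close>-fold commutator of \<open>ddz\<^sup>j\<close>, a differential operator
  of order \<open>j\<close>, with the multiplication by \<open>\<phi>\<close>.\<close>

lemma commutator_sum_eq_0: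
  assumes "j < N"
  shows "(\<Sum>k\<le>N. of_nat (N choose k) * (- \<phi>) ^ (N - k) * (ddz ^^ j) (\<phi> ^ k)) = 0"
  using assms
proof (induction j arbitrary: N)
  case 0
  have "(\<Sum>k\<le>N. of_nat (N choose k) * (- \<phi>) ^ (N - k) * \<phi> ^ k) = (\<phi> + - \<phi>) ^ N"
    unfolding binomial_ring by (intro sum.cong) (auto simp: mult_ac)
  then show ?case using 0 by simp
next
  case (Suc j)
  define S where "S M i = (\<Sum>k\<le>M. of_nat (M choose k) * (- \<phi>) ^ (M - k) * (ddz ^^ i) (\<phi> ^ k))" for M i
  obtain M where N: "N = Suc M" using Suc.prems by (cases N) auto
  have dpow: "ddz ((- \<phi>) ^ m) = - (of_nat m * (- \<phi>) ^ (m - 1) * ddz \<phi>)" for m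
  proof (induction m)
    case (Suc m)
    show ?case
      by (cases m) (use Suc in \<open>simp_all add: ddz_mult ddz_def algebra_simps\<close>)
  qed (simp add: ddz_def)
  \<comment> \<open>Leibniz's rule. The subtracted part comes from differentiating the power of -
    \<phi>; absorbing N - k into the binomial coefficient turns it into \<open>ddz \<phi>\<close>
    times N times the sum for N - 1. The two sums with j derivatives vanish by induction.\<close>
  have "ddz (S N j) = (\<Sum>k\<le>N. of_nat (N choose k) * (- \<phi>) ^ (N - k) * (ddz ^^ Suc j) (\<phi> ^ k)
      - ddz \<phi> * (of_nat ((N - k) * (N choose k)) * (- \<phi>) ^ (N - k - 1) * (ddz ^^ j) (\<phi> ^ k)))"
    unfolding S_def ddz_sum
  proof (rule sum.cong[OF refl])
    fix k
    have "ddz (of_nat (N choose k)) = (0 :: complex fps)"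
      by (metis ddz_const fps_of_nat)
    then show "ddz (of_nat (N choose k) * (- \<phi>) ^ (N - k) * (ddz ^^ j) (\<phi> ^ k)) =
        of_nat (N choose k) * (- \<phi>) ^ (N - k) * (ddz ^^ Suc j) (\<phi> ^ k)
      - ddz \<phi> * (of_nat ((N - k) * (N choose k)) * (- \<phi>) ^ (N - k - 1) * (ddz ^^ j) (\<phi> ^ k))"
      by (simp add: ddz_mult dpow mult_ac right_diff_distrib)
  qed
  also have "\<dots> = S N (Suc j) - ddz \<phi> *
      (\<Sum>k\<le>N. of_nat ((N - k) * (N choose k)) * (- \<phi>) ^ (N - k - 1) * (ddz ^^ j) (\<phi> ^ k))"
    by (simp add: S_def sum_subtractf sum_distrib_left)
  also have "(\<Sum>k\<le>N. of_nat ((N - k) * (N choose k)) * (- \<phi>) ^ (N - k - 1) * (ddz ^^ j) (\<phi> ^ k))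
      = (\<Sum>k\<le>M. of_nat ((N - k) * (N choose k)) * (- \<phi>) ^ (N - k - 1) * (ddz ^^ j) (\<phi> ^ k))"
    by (simp add: N)
  also have "\<dots> = of_nat N * S M j"
    unfolding S_def sum_distrib_left
  proof (rule sum.cong[OF refl])
    fix k assume "k \<in> {..M}"
    then have "(N - k) * (N choose k) = N * (M choose k)"
      using binomial_absorb_comp[of N k] N by simp
    moreover have "N - k - 1 = M - k" using N by simp
    ultimately show "of_nat ((N - k) * (N choose k)) * (- \<phi>) ^ (N - k - 1) * (ddz ^^ j) (\<phi> ^ k)
       = of_nat N * (of_nat (M choose k) * (- \<phi>) ^ (M - k) * (ddz ^^ j) (\<phi> ^ k))"
      by (simp add: mult.assoc)
  qed
  finally have "S N (Suc j) = ddz (S N j) + ddz \<phi> * (of_nat N * S M j)"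
    by (simp add: algebra_simps)
  moreover have "S N j = 0" "S M j = 0"
    using Suc.IH[of N] Suc.IH[of M] Suc.prems by (simp_all add: S_def N)
  ultimately show ?case by (simp add: S_def)
qed

definition lagrange_term :: "complex fps \<Rightarrow> nat \<Rightarrow> complex fps"
  where "lagrange_term \<phi> k = fps_const ((-1) ^ k / fact k) * (ddz ^^ (k - 1)) (\<phi> ^ k)"

text \<open>The k - 1 derivatives give the k-th term order at least k - 1 in T, so terms with k > n
  + 1 do not reach degree n and this finite sum is the coefficient of the full Lagrange
  series.\<close>

definition lagrange_inverse :: "complex fps \<Rightarrow> complex fps"
  where "lagrange_inverse \<phi> = Abs_fps (\<lambda>n. \<Sum>k=1..Suc n. fps_nth (lagrange_term \<phi> k) n)"

lemma fps_nth_lagrange_inverse: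
  assumes "n < M"
  shows "fps_nth (lagrange_inverse \<phi>) n = (\<Sum>k=1..M. fps_nth (lagrange_term \<phi> k) n)"
  unfolding lagrange_inverse_def fps_nth_Abs_fps using assms
  by (intro sum.mono_neutral_left) (auto simp: lagrange_term_def fps_nth_ddz_power)

text \<open>Taylor's formula applied to each Lagrange term gives a double sum over p and k. On the
  diagonal N = p + k it is, up to a constant, the commutator sum with N - 1 derivatives without its
  term k = 0. The full sum vanishes, and so does the missing term for N > 1, being a derivative of a
  constant; N = 1 leaves - \<phi>.\<close>

lemma id_plus_comp_lagrange_inverse: "id_plus_comp (lagrange_inverse \<phi>) \<phi> = 0"
proof (rule fps_ext)
  fix n
  define t where "t p k = fps_const (1 / fact p) * \<phi> ^ p * (ddz ^^ p) (lagrange_term \<phi> k)" for p k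
  have t_eq: "t p k = fps_const ((-1) ^ (p + k) / (fact p * fact k)) * ((- \<phi>) ^ p * (ddz ^^ (p + (k - 1))) (\<phi> ^ k))" for p k
  proof -
    have pw: "(- \<phi>) ^ p = fps_const ((-1) ^ p) * \<phi> ^ p"
      by (metis fps_const_1_eq_1 fps_const_neg fps_const_power power_minus)
    have "(-1) ^ (p + k) / (fact p * fact k) * (-1) ^ p = 1 / fact p * ((-1) ^ k / fact k :: complex)"
      by (simp add: power_add)
    then have cc: "fps_const ((-1) ^ (p + k) / (fact p * fact k)) * fps_const ((-1) ^ p)
        = (fps_const (1 / fact p) * fps_const ((-1) ^ k / fact k) :: complex fps)"
      by (simp only: fps_const_mult)
    have "t p k = (fps_const (1 / fact p) * fps_const ((-1) ^ k / fact k)) *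
        (\<phi> ^ p * (ddz ^^ (p + (k - 1))) (\<phi> ^ k))"
      unfolding t_def lagrange_term_def ddz_funpow_const_mult funpow_add o_def
      by (simp only: mult_ac)
    then show ?thesis
      unfolding cc[symmetric] pw by (simp only: mult_ac)
  qed
  have t_0: "fps_nth (t p k) n = 0" if "k \<ge> 1" "n < p + (k - 1)" for p k
    using that by (simp add: t_eq fps_mult_nth[of _ "(ddz ^^ _) _"] fps_nth_ddz_power)
  have "fps_nth (comp_summand (lagrange_inverse \<phi>) \<phi> p) n = (\<Sum>k=1..Suc n. fps_nth (t p k) n)" for p
  proof -
    have "fps_nth (comp_summand (lagrange_inverse \<phi>) \<phi> p) n =
        fps_nth (comp_summand (\<Sum>k=1..Suc n. lagrange_term \<phi> k) \<phi> p) n"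
      unfolding comp_summand_def
      by (subst (1 2) fps_mult_nth, intro sum.cong refl arg_cong2[where f = "(*)"]
          fps_nth_ddz_funpow_cong[of n]) (auto simp only: fps_sum_nth fps_nth_lagrange_inverse[of _ "Suc n"] less_Suc_eq_le)
    also have "comp_summand (\<Sum>k=1..Suc n. lagrange_term \<phi> k) \<phi> p = (\<Sum>k=1..Suc n. t p k)"
      by (simp only: comp_summand_def t_def ddz_funpow_sum sum_distrib_left)
    finally show ?thesis by (simp add: fps_sum_nth)
  qed
  then have "fps_nth (\<Sum>p. comp_summand (lagrange_inverse \<phi>) \<phi> p) n
      = (\<Sum>p\<le>n. \<Sum>k=1..Suc n. fps_nth (t p k) n)"
    by (simp add: fps_nth_suminf_comp_summand[of n n])
  also have "\<dots> = (\<Sum>(p,k)\<in>{..n} \<times> {1..Suc n}. fps_nth (t p k) n)"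
    by (rule sum.cartesian_product)
  \<comment> \<open>Pairs with p + k > n + 1 do not reach degree n; the remaining ones are listed by
    N = p + k.\<close>
  also have "\<dots> = (\<Sum>(p,k)\<in>(\<Union>N\<in>{1..Suc n}. (\<lambda>k. (N - k, k)) ` {1..N}). fps_nth (t p k) n)"
  proof (rule sum.mono_neutral_right)
    show "(\<Union>N\<in>{1..Suc n}. (\<lambda>k. (N - k, k)) ` {1..N}) \<subseteq> {..n} \<times> {1..Suc n}"
      by auto
    show "\<forall>i\<in>{..n} \<times> {1..Suc n} - (\<Union>N\<in>{1..Suc n}. (\<lambda>k. (N - k, k)) ` {1..N}).
        (case i of (p, k) \<Rightarrow> fps_nth (t p k) n) = 0"
    proof
      fix x assume x: "x \<in> {..n} \<times> {1..Suc n} - (\<Union>N\<in>{1..Suc n}. (\<lambda>k. (N - k, k)) ` {1..N})"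
      obtain p k where [simp]: "x = (p, k)" by (cases x)
      from x have *: "(p, k) \<notin> (\<Union>N\<in>{1..Suc n}. (\<lambda>k. (N - k, k)) ` {1..N})"
        and pk: "p \<in> {..n}" "k \<in> {1..Suc n}" by auto
      have "n < p + (k - 1)"
      proof (rule ccontr)
        assume "\<not> n < p + (k - 1)"
        then have "p + k \<in> {1..Suc n}" using pk by auto
        moreover have "(p, k) \<in> (\<lambda>k'. (p + k - k', k')) ` {1..p + k}"
          using pk by (intro image_eqI[of _ _ k]) auto
        ultimately show False using * by blast
      qed
      then show "(case x of (p, k) \<Rightarrow> fps_nth (t p k) n) = 0"
        using pk by (auto intro: t_0)
    qed
  qed auto
  also have "\<dots> = (\<Sum>N\<in>{1..Suc n}. \<Sum>(p,k)\<in>(\<lambda>k. (N - k, k)) ` {1..N}. fps_nth (t p k) n)"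
  proof (rule sum.UNION_disjoint)
    show "\<forall>i\<in>{1..Suc n}. \<forall>j\<in>{1..Suc n}. i \<noteq> j \<longrightarrow>
        (\<lambda>k. (i - k, k)) ` {1..i} \<inter> (\<lambda>k. (j - k, k)) ` {1..j} = {}"
      by (auto simp: image_iff)
  qed auto
  also have "\<dots> = (\<Sum>N\<in>{1..Suc n}. fps_nth (\<Sum>k=1..N. t (N - k) k) n)"
    by (intro sum.cong refl) (subst sum.reindex, auto simp: inj_on_def fps_sum_nth)
  also have "\<dots> = (\<Sum>N\<in>{1..Suc n}. if N = 1 then - fps_nth \<phi> n else 0)"
  proof (rule sum.cong[OF refl])
    fix N assume N: "N \<in> {1..Suc n}"
    have "(\<Sum>k=1..N. t (N - k) k) = fps_const ((-1) ^ N / fact N) *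
       (\<Sum>k=1..N. of_nat (N choose k) * (- \<phi>) ^ (N - k) * (ddz ^^ (N - 1)) (\<phi> ^ k))"
      unfolding sum_distrib_left
    proof (rule sum.cong[OF refl])
      fix k assume k: "k \<in> {1..N}"
      have "(N - k) + (k - 1) = N - 1" "N - k + k = N" using k by auto
      moreover have "fps_const ((-1) ^ N / (fact (N - k) * fact k)) =
         (fps_const ((-1) ^ N / fact N) * of_nat (N choose k) :: complex fps)"
        using k by (simp add: binomial_fact fps_of_nat[symmetric])
      ultimately show "t (N - k) k = fps_const ((-1) ^ N / fact N) *
          (of_nat (N choose k) * (- \<phi>) ^ (N - k) * (ddz ^^ (N - 1)) (\<phi> ^ k))"
        by (simp add: t_eq mult.assoc)
    qed
    also have "fps_nth \<dots> n = (if N = 1 then - fps_nth \<phi> n else 0)"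
    proof (cases "N = 1")
      case False
      then have "0 < N - 1" "N - 1 < N" using N by auto
      have "(ddz ^^ (N - 1)) 1 = 0"
        by (cases "N - 1") (use \<open>0 < N - 1\<close> in \<open>auto simp: funpow_Suc_right ddz_def simp del: funpow.simps\<close>)
      then have "(\<Sum>k=1..N. of_nat (N choose k) * (- \<phi>) ^ (N - k) * (ddz ^^ (N - 1)) (\<phi> ^ k))
         = (\<Sum>k\<le>N. of_nat (N choose k) * (- \<phi>) ^ (N - k) * (ddz ^^ (N - 1)) (\<phi> ^ k))"
        by (intro sum.mono_neutral_left) (auto simp: not_le)
      then show ?thesis using commutator_sum_eq_0[OF \<open>N - 1 < N\<close>] False by simp
    qed simp
    finally show "fps_nth (\<Sum>k=1..N. t (N - k) k) n = (if N = 1 then - fps_nth \<phi> n else 0)" .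
  qed
  also have "\<dots> = - fps_nth \<phi> n" by simp
  finally show "fps_nth (id_plus_comp (lagrange_inverse \<phi>) \<phi>) n = fps_nth 0 n"
    by (simp add: id_plus_comp_def)
qed

text \<open>\<open>groupI\<close> asks for left inverses only, and Lagrange inversion provides
  them.\<close>

lemma group_id_plus_group: "group id_plus_group"
proof (rule groupI)
  show "\<exists>y\<in>carrier id_plus_group. y \<otimes>\<^bsub>id_plus_group\<^esub> x = \<one>\<^bsub>id_plus_group\<^esub>" for x
    using id_plus_comp_lagrange_inverse by (auto simp: id_plus_group_def)
qed (auto simp: id_plus_group_def id_plus_comp_assoc)

lemma inv_id_plus_group:
  "inv\<^bsub>id_plus_group\<^esub> (fps_const \<sigma> + \<phi>) = id_plus_comp (lagrange_inverse \<phi>) (fps_const (- \<sigma>))"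
proof (rule group.inv_equality[OF group_id_plus_group])
  have "id_plus_comp (id_plus_comp (lagrange_inverse \<phi>) (fps_const (- \<sigma>))) (id_plus_comp (fps_const \<sigma>) \<phi>)
      = id_plus_comp (lagrange_inverse \<phi>) (id_plus_comp (id_plus_comp (fps_const (- \<sigma>)) (fps_const \<sigma>)) \<phi>)"
    by (simp only: id_plus_comp_assoc)
  also have "\<dots> = 0" by (simp add: id_plus_comp_lagrange_inverse)
  finally show "id_plus_comp (lagrange_inverse \<phi>) (fps_const (- \<sigma>)) \<otimes>\<^bsub>id_plus_group\<^esub> (fps_const \<sigma> + \<phi>)
      = \<one>\<^bsub>id_plus_group\<^esub>"
    by (simp add: id_plus_group_def)
qed (auto simp: id_plus_group_def)

section \<open>The Laplace transform on the half-line\<close>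

text \<open>Dominated convergence for the partial sums. Each term is a difference of two partial
  sums, hence bounded by 2 D and integrable by itself.\<close>

lemma dominated_series_integral:
  fixes u :: "nat \<Rightarrow> 'a \<Rightarrow> complex"
  assumes meas: "\<And>n. u n \<in> borel_measurable M" and D: "integrable M D"
    and sums: "\<And>x. x \<in> space M \<Longrightarrow> (\<lambda>n. u n x) sums s x"
    and bound: "\<And>N x. x \<in> space M \<Longrightarrow> norm (\<Sum>n<N. u n x) \<le> D x"
  shows "integrable M (u n)" "(\<lambda>n. integral\<^sup>L M (u n)) sums integral\<^sup>L M s" "integrable M s"
proof -
  note [measurable] = meas
  let ?S = "\<lambda>N x. \<Sum>n<N. u n x"
  have int: "integrable M (u n)" for n
  proof (rule Bochner_Integration.integrable_bound[of _ "\<lambda>x. 2 * D x"])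
    show "AE x in M. norm (u n x) \<le> norm (2 * D x)"
    proof (rule AE_I2)
      fix x assume x: "x \<in> space M"
      have "norm (u n x) = norm (?S (Suc n) x - ?S n x)" by simp
      also have "\<dots> \<le> 2 * D x"
        using norm_triangle_ineq4[of "?S (Suc n) x" "?S n x"] bound[OF x, of "Suc n"] bound[OF x, of n]
        by linarith
      finally show "norm (u n x) \<le> norm (2 * D x)" by simp
    qed
  qed (use D in auto)
  show "integrable M (u n)" by (rule int)
  have lim: "(\<lambda>N. ?S N x) \<longlonglongrightarrow> s x" if "x \<in> space M" for x
    using sums[OF that] by (simp add: sums_def)
  have s: "s \<in> borel_measurable M"
    by (rule borel_measurable_LIMSEQ_metric[of ?S]) (use lim in auto)
  have bd: "AE x in M. norm (?S N x) \<le> D x" for N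
    by (rule AE_I2) (rule bound)
  have "(\<lambda>N. integral\<^sup>L M (?S N)) \<longlonglongrightarrow> integral\<^sup>L M s"
    by (rule integral_dominated_convergence[where w = D]) (use s D lim bd in auto)
  then show "(\<lambda>n. integral\<^sup>L M (u n)) sums integral\<^sup>L M s"
    unfolding sums_def using int by simp
  show "integrable M s"
    by (rule integrable_dominated_convergence[where w = D and s = ?S]) (use s D lim bd in auto)
qed

definition laplace :: "(real \<Rightarrow> complex) \<Rightarrow> complex \<Rightarrow> complex"
  where "laplace g z = (LBINT t:{0<..}. exp (- (z * of_real t)) * g t)"

text \<open>Lebesgue integrability is absolute, so real arguments to the right of c decide about all
  z with Re z > c. Unlike a bound by a multiple of exp (c t), the property keeps its abscissa when g
  is multiplied by powers of t.\<close>

definition laplaceable :: "real \<Rightarrow> (real \<Rightarrow> complex) \<Rightarrow> bool"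
  where "laplaceable c g \<longleftrightarrow>
    (\<forall>x>c. set_integrable lborel {0<..} (\<lambda>t. exp (- (of_real x * of_real t)) * g t))"

text \<open>The integrand at x is the integrand at x - d times k(t) exp (- d t), a factor bounded by
  B. Measurability is taken from the integrand at x - d as well, since g itself is not assumed
  measurable.\<close>

lemma laplaceable_mult:
  assumes g: "laplaceable c g" and k [measurable]: "k \<in> borel_measurable borel"
    and bound: "\<And>t. t > 0 \<Longrightarrow> cmod (k t) \<le> B * exp (d * t)"
  shows "laplaceable (c + d) (\<lambda>t. k t * g t)"
  unfolding laplaceable_def
proof (intro allI impI)
  fix x assume "x > c + d"
  then have "x - d > c" by simp
  with g have "set_integrable lborel {0<..} (\<lambda>t. exp (- (of_real (x - d) * of_real t)) * g t)"
    unfolding laplaceable_def by blast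
  then have int: "integrable lborel (\<lambda>t. indicator {0<..} t *\<^sub>R (exp (- (of_real (x - d) * of_real t)) * g t))"
    (is "integrable _ ?v") by (simp add: set_integrable_def)
  note [measurable] = borel_measurable_integrable[OF int]
  have eq: "indicator {0<..} t *\<^sub>R (exp (- (of_real x * of_real t)) * (k t * g t))
      = exp (- (of_real d * of_real t)) * k t * ?v t" for t :: real
  proof -
    have "exp (- (complex_of_real x * of_real t)) = exp (- (of_real d * of_real t)) * exp (- (of_real (x - d) * of_real t))"
      by (simp add: algebra_simps flip: exp_add)
    then show ?thesis by simp
  qed
  show "set_integrable lborel {0<..} (\<lambda>t. exp (- (of_real x * of_real t)) * (k t * g t))"
    unfolding set_integrable_def eq
  proof (rule Bochner_Integration.integrable_bound)
    show "integrable lborel (\<lambda>t. B *\<^sub>R ?v t)" using int by (rule integrable_scaleR_right)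
    show "AE t in lborel. cmod (exp (- (of_real d * of_real t)) * k t * ?v t) \<le> cmod (B *\<^sub>R ?v t)"
    proof (rule AE_I2)
      fix t :: real
      show "cmod (exp (- (of_real d * of_real t)) * k t * ?v t) \<le> cmod (B *\<^sub>R ?v t)"
      proof (cases "t > 0")
        case True
        have "cmod (exp (- (of_real d * of_real t)) * k t) \<le> exp (- (d * t)) * (B * exp (d * t))"
          unfolding norm_mult norm_exp_eq_Re using bound[OF True]
          by (intro mult_mono) (auto)
        also have "\<dots> = B" by (simp add: exp_minus)
        finally have "cmod (exp (- (of_real d * of_real t)) * k t) \<le> \<bar>B\<bar>" by linarith
        then show ?thesis
          unfolding norm_mult[of _ "?v t"] norm_scaleR by (rule mult_right_mono) simp
      qed simp
    qed
  qed measurable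
qed

text \<open>exp (- z t) and exp (- Re z t) differ by a factor of modulus one.\<close>

lemma laplaceable_integrable:
  assumes "laplaceable c g" "Re z > c"
  shows "integrable lborel (\<lambda>t. indicator {0<..} t *\<^sub>R (exp (- (z * of_real t)) * g t))"
proof -
  have "laplaceable (c + 0) (\<lambda>t. exp (- (\<i> * of_real (Im z) * of_real t)) * g t)"
    by (rule laplaceable_mult[where B = 1]) (use assms in \<open>auto\<close>)
  with assms have "set_integrable lborel {0<..} (\<lambda>t. exp (- (of_real (Re z) * of_real t)) * (exp (- (\<i> * of_real (Im z) * of_real t)) * g t))"
    by (auto simp: laplaceable_def)
  moreover have "exp (- (of_real (Re z) * of_real t)) * (exp (- (\<i> * of_real (Im z) * of_real t)) * g t) = exp (- (z * of_real t)) * g t" for t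
    by (subst (5) complex_eq) (simp add: algebra_simps flip: exp_add)
  ultimately show ?thesis by (simp add: set_integrable_def)
qed

lemma laplaceable_cmult: "laplaceable c g \<Longrightarrow> laplaceable c (\<lambda>t. a * g t)"
  using laplaceable_mult[of c g "\<lambda>_. a" "cmod a" 0] by simp

lemma sum_power_div_fact_le_exp:
  fixes x :: real
  assumes "x \<ge> 0"
  shows "(\<Sum>p<N. x ^ p / fact p) \<le> exp x"
proof -
  have "(\<Sum>p<N. inverse (fact p) * x ^ p) \<le> (\<Sum>p. inverse (fact p) * x ^ p)"
    by (rule sum_le_suminf[OF summable_exp]) (use assms in auto)
  then show ?thesis
    by (simp add: exp_def field_simps)
qed

lemma power_div_fact_le_exp:
  fixes x :: real
  assumes "x \<ge> 0"
  shows "x ^ n / fact n \<le> exp x"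
proof -
  have "x ^ n / fact n \<le> (\<Sum>p<Suc n. x ^ p / fact p)"
    using assms by (intro member_le_sum) auto
  also have "\<dots> \<le> exp x" by (rule sum_power_div_fact_le_exp[OF assms])
  finally show ?thesis .
qed

text \<open>t^n is at most n! / e^n exp (e t) for every e > 0, so the abscissa moves by an
  arbitrarily small e. For a given x > c, half of the gap x - c is spent on it.\<close>

lemma laplaceable_power:
  assumes "laplaceable c g"
  shows "laplaceable c (\<lambda>t. of_real t ^ n * g t)"
proof -
  have "laplaceable (c + e) (\<lambda>t. of_real t ^ n * g t)" if "e > 0" for e
  proof (rule laplaceable_mult[OF assms, where B = "fact n / e ^ n"])
    fix t :: real assume "t > 0"
    then have "(e * t) ^ n / fact n \<le> exp (e * t)"
      using that by (intro power_div_fact_le_exp) auto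
    then show "cmod (of_real t ^ n) \<le> fact n / e ^ n * exp (e * t)"
      using that \<open>t > 0\<close> by (simp add: norm_power field_simps)
  qed measurable
  then have *: "laplaceable (c + (x - c) / 2) (\<lambda>t. of_real t ^ n * g t)" if "x > c" for x
    using that by auto
  show ?thesis
    unfolding laplaceable_def
  proof (intro allI impI)
    fix x assume "x > c"
    moreover from this have "x > c + (x - c) / 2" by (simp add: field_simps)
    ultimately show "set_integrable lborel {0<..} (\<lambda>t. exp (- (of_real x * of_real t)) * (of_real t ^ n * g t))"
      using * unfolding laplaceable_def by blast
  qed
qed

lemma laplace_cmult: "laplace (\<lambda>t. a * g t) z = a * laplace g z"
  by (simp add: laplace_def mult.left_commute)

lemma laplace_sum:
  assumes "finite A" "\<And>i. i \<in> A \<Longrightarrow> laplaceable c (g i)" "Re z > c"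
  shows "laplace (\<lambda>t. \<Sum>i\<in>A. g i t) z = (\<Sum>i\<in>A. laplace (g i) z)"
proof -
  have "laplace (\<lambda>t. \<Sum>i\<in>A. g i t) z = (LBINT t. (\<Sum>i\<in>A. indicator {0<..} t *\<^sub>R (exp (- (z * of_real t)) * g i t)))"
    by (simp add: laplace_def set_lebesgue_integral_def sum_distrib_left scaleR_sum_right)
  also have "\<dots> = (\<Sum>i\<in>A. laplace (g i) z)"
    unfolding laplace_def set_lebesgue_integral_def
    by (intro Bochner_Integration.integral_sum laplaceable_integrable) (use assms in auto)
  finally show ?thesis .
qed

lemma laplaceable_bounded:
  assumes meas: "set_borel_measurable borel {0<..} g"
    and bound: "\<And>t. t > 0 \<Longrightarrow> cmod (g t) \<le> C * exp (c * t)"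
  shows "laplaceable c g"
    and "Re z > c \<Longrightarrow> cmod (laplace g z) \<le> C / (Re z - c)"
proof -
  have dom: "integrable lborel (\<lambda>t. indicator {0<..} t *\<^sub>R (C * exp (- (t * x))))"
    and dom_eq: "(LBINT t. indicator {0<..} t *\<^sub>R (C * exp (- (t * x)))) = C / x" if "x > 0" for x
  proof -
    have "integrable lborel (\<lambda>t. indicator {0<..} t *\<^sub>R (exp (- (t * x))))"
      using integrable_I0i_exp_mscale[OF that] by (simp add: set_integrable_def)
    then have "integrable lborel (\<lambda>t. C * (indicator {0<..} t *\<^sub>R (exp (- (t * x)))))"
      by (rule integrable_mult_right)
    then show "integrable lborel (\<lambda>t. indicator {0<..} t *\<^sub>R (C * exp (- (t * x))))"
      by (simp add: mult.left_commute)
    have "(LBINT t. indicator {0<..} t *\<^sub>R exp (- (t * x))) = 1 / x"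
      using LBINT_I0i_exp_mscale[OF that]
      by (simp add: interval_lebesgue_integral_0_infty set_lebesgue_integral_def)
    then have "(LBINT t. C * (indicator {0<..} t *\<^sub>R exp (- (t * x)))) = C / x"
      by simp
    then show "(LBINT t. indicator {0<..} t *\<^sub>R (C * exp (- (t * x)))) = C / x"
      by (simp add: mult.left_commute)
  qed
  have le: "cmod (indicator {0<..} t *\<^sub>R (exp (- (w * of_real t)) * g t))
      \<le> indicator {0<..} t *\<^sub>R (C * exp (- (t * (Re w - c))))" for w t
  proof (cases "t > 0")
    case True
    have "cmod (exp (- (w * of_real t)) * g t) \<le> exp (- (Re w * t)) * (C * exp (c * t))"
      unfolding norm_mult norm_exp_eq_Re using bound[OF True] by (intro mult_mono) auto
    also have "\<dots> = C * exp (- (t * (Re w - c)))"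
      by (simp add: algebra_simps flip: exp_add)
    finally show ?thesis using True by simp
  qed simp
  have "integrable lborel (\<lambda>t. indicator {0<..} t *\<^sub>R (exp (- (of_real x * of_real t)) * g t))" if "x > c" for x
  proof (rule Bochner_Integration.integrable_bound[OF dom[of "x - c"]])
    have [measurable]: "(\<lambda>t. indicator {0<..} t *\<^sub>R g t) \<in> borel_measurable borel"
      using meas by (simp add: set_borel_measurable_def)
    have "(\<lambda>t. exp (- (of_real x * of_real t)) * (indicator {0<..} t *\<^sub>R g t)) \<in> borel_measurable borel"
      by measurable
    then show "(\<lambda>t. indicator {0<..} t *\<^sub>R (exp (- (of_real x * of_real t)) * g t)) \<in> borel_measurable lborel"
      by simp
    show "AE t in lborel. cmod (indicator {0<..} t *\<^sub>R (exp (- (of_real x * of_real t)) * g t))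
        \<le> norm (indicator {0<..} t *\<^sub>R (C * exp (- (t * (x - c)))))"
      using le[of _ "of_real x"] by (intro AE_I2) (auto intro: order_trans[OF _ abs_ge_self])
  qed (use that in auto)
  then show lap: "laplaceable c g"
    by (simp add: laplaceable_def set_integrable_def)
  show "cmod (laplace g z) \<le> C / (Re z - c)" if "Re z > c"
  proof -
    have "cmod (laplace g z) \<le> (LBINT t. cmod (indicator {0<..} t *\<^sub>R (exp (- (z * of_real t)) * g t)))"
      unfolding laplace_def set_lebesgue_integral_def by (rule integral_norm_bound)
    also have "\<dots> \<le> (LBINT t. indicator {0<..} t *\<^sub>R (C * exp (- (t * (Re z - c)))))"
      by (intro integral_mono integrable_norm laplaceable_integrable[OF lap] dom le) (use that in auto)
    also have "\<dots> = C / (Re z - c)" using that by (intro dom_eq) auto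
    finally show ?thesis .
  qed
qed

text \<open>exp (- w t) is expanded under the integral. Its partial sums are at most exp (|w| t), so
  the integrand at z - |w| is a majorant, integrable because Re z - |w| > c.\<close>

lemma laplace_taylor:
  assumes g: "laplaceable c g" and w: "cmod w < Re z - c"
  shows "(\<lambda>p. (- w) ^ p / fact p * laplace (\<lambda>t. of_real t ^ p * g t) z) sums laplace g (z + w)"
proof -
  let ?u = "\<lambda>t. indicator {0<..} t *\<^sub>R (exp (- (z * of_real t)) * g t)"
  have "Re z > c" using w norm_ge_zero[of w] by linarith
  then have [measurable]: "?u \<in> borel_measurable borel"
    using borel_measurable_integrable[OF laplaceable_integrable[OF g]] by simp
  have "integrable lborel (\<lambda>t. indicator {0<..} t *\<^sub>R (exp (- ((z - of_real (cmod w)) * of_real t)) * g t))"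
    by (rule laplaceable_integrable[OF g]) (use w in auto)
  then have D: "integrable lborel (\<lambda>t. cmod (indicator {0<..} t *\<^sub>R (exp (- ((z - of_real (cmod w)) * of_real t)) * g t)))"
    by (rule integrable_norm)
  have "(\<lambda>p. LBINT t. (- (w * of_real t)) ^ p / fact p * ?u t) sums (LBINT t. exp (- (w * of_real t)) * ?u t)"
  proof (rule dominated_series_integral(2)[OF _ D])
    show "(\<lambda>p. (- (w * of_real t)) ^ p / fact p * ?u t) sums (exp (- (w * of_real t)) * ?u t)" for t
      by (intro sums_mult2) (use exp_converges[of "- (w * of_real t)"] in \<open>simp add: scaleR_conv_of_real field_simps\<close>)
    fix N and t :: real
    have eq: "cmod (exp (- (z * of_real t))) * exp (cmod w * t) = cmod (exp (- ((z - of_real (cmod w)) * of_real t)))"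
      by (simp add: algebra_simps flip: exp_add)
    show "cmod (\<Sum>p<N. (- (w * of_real t)) ^ p / fact p * ?u t) \<le>
        cmod (indicator {0<..} t *\<^sub>R (exp (- ((z - of_real (cmod w)) * of_real t)) * g t))"
    proof (cases "t > 0")
      case True
      have "cmod (\<Sum>p<N. (- (w * of_real t)) ^ p / fact p) \<le> (\<Sum>p<N. (cmod w * t) ^ p / fact p)"
        using True by (intro sum_norm_le) (simp add: norm_mult norm_divide norm_power)
      also have "\<dots> \<le> exp (cmod w * t)"
        using True by (intro sum_power_div_fact_le_exp) auto
      finally have "cmod (\<Sum>p<N. (- (w * of_real t)) ^ p / fact p) * cmod (?u t) \<le> exp (cmod w * t) * cmod (?u t)"
        by (rule mult_right_mono) simp
      also have "\<dots> = cmod (exp (- (z * of_real t))) * exp (cmod w * t) * cmod (g t)"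
        using True by (simp add: norm_mult)
      also have "\<dots> = cmod (indicator {0<..} t *\<^sub>R (exp (- ((z - of_real (cmod w)) * of_real t)) * g t))"
        unfolding eq using True by (simp add: norm_mult)
      finally show ?thesis by (simp only: norm_mult flip: sum_distrib_right)
    qed simp
  qed measurable
  moreover have "(LBINT t. (- (w * of_real t)) ^ p / fact p * ?u t) = (- w) ^ p / fact p * laplace (\<lambda>t. of_real t ^ p * g t) z" for p
  proof -
    have "(LBINT t. (- (w * of_real t)) ^ p / fact p * ?u t) =
       (LBINT t. (- w) ^ p / fact p * (indicator {0<..} t *\<^sub>R (exp (- (z * of_real t)) * (of_real t ^ p * g t))))"
    proof (intro Bochner_Integration.integral_cong refl)
      fix t :: real
      have "(- (w * of_real t)) ^ p = (- w) ^ p * of_real t ^ p"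
        by (simp only: mult_minus_left[symmetric] power_mult_distrib)
      then show "(- (w * of_real t)) ^ p / fact p * ?u t =
          (- w) ^ p / fact p * (indicator {0<..} t *\<^sub>R (exp (- (z * of_real t)) * (of_real t ^ p * g t)))"
        by simp
    qed
    then show ?thesis
      by (simp only: laplace_def set_lebesgue_integral_def integral_mult_right_zero)
  qed
  moreover have "(LBINT t. exp (- (w * of_real t)) * ?u t) = laplace g (z + w)"
    unfolding laplace_def set_lebesgue_integral_def
    by (intro Bochner_Integration.integral_cong refl) (simp add: algebra_simps exp_add[symmetric])
  ultimately show ?thesis by simp
qed

definition laplace_fps :: "(real \<Rightarrow> complex) \<Rightarrow> complex \<Rightarrow> complex fps"
  where "laplace_fps g z = Abs_fps (\<lambda>p. (-1) ^ p / fact p * laplace (\<lambda>t. of_real t ^ p * g t) z)"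

lemma laplace_has_fps_expansion:
  assumes "laplaceable c g" "Re z > c"
  shows "(\<lambda>w. laplace g (z + w)) has_fps_expansion laplace_fps g z"
proof (rule has_fps_expansionI)
  have "(\<lambda>n. fps_nth (laplace_fps g z) n * w ^ n) sums laplace g (z + w)" if "cmod w < Re z - c" for w
    using laplace_taylor[OF assms(1) that]
    unfolding power_minus[of w] laplace_fps_def fps_nth_Abs_fps by (simp only: mult_ac times_divide_eq_right times_divide_eq_left)
  moreover have "eventually (\<lambda>w. w \<in> ball 0 (Re z - c)) (nhds 0)"
    using assms(2) by (intro eventually_nhds_in_open) auto
  ultimately show "eventually (\<lambda>w. (\<lambda>n. fps_nth (laplace_fps g z) n * w ^ n) sums laplace g (z + w)) (nhds 0)"
    by (auto elim!: eventually_mono)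
qed

lemma laplace_holomorphic:
  assumes "laplaceable c g"
  shows "laplace g holomorphic_on {z. Re z > c}"
proof -
  have "laplace g analytic_on {z}" if "Re z > c" for z
    by (rule has_fps_expansion_imp_analytic[OF laplace_has_fps_expansion[OF assms that]])
  then have "laplace g analytic_on {z. Re z > c}"
    using analytic_on_analytic_at by blast
  then show ?thesis by (rule analytic_imp_holomorphic)
qed

text \<open>Fubini for A(t) B(x - t) over the plane, where A and B carry the weights and vanish
  outside the positive half-line: the weights multiply to exp (- z x), and t is confined to 0 < t <
  x. Integrability of the weighted v is part of Fubini's theorem.\<close>

lemma laplace_convolution:
  assumes a: "laplaceable c a" and b: "laplaceable c b"
    and v: "\<And>x. x > 0 \<Longrightarrow> v x = (LBINT t:{0<..<x}. a t * b (x - t))"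
  shows "laplaceable c v" and "Re z > c \<Longrightarrow> laplace v z = laplace a z * laplace b z"
proof -
  have *: "integrable lborel (\<lambda>t. indicator {0<..} t *\<^sub>R (exp (- (z * of_real t)) * v t)) \<and>
      laplace v z = laplace a z * laplace b z" if z: "Re z > c" for z
  proof -
    define A where "A t = indicator {0<..} t *\<^sub>R (exp (- (z * of_real t)) * a t)" for t
    define B where "B t = indicator {0<..} t *\<^sub>R (exp (- (z * of_real t)) * b t)" for t
    have A: "integrable lborel A" and B: "integrable lborel B"
      unfolding A_def B_def using a b z by (auto intro: laplaceable_integrable)
    have [measurable]: "A \<in> borel_measurable borel" "B \<in> borel_measurable borel"
      using borel_measurable_integrable[OF A] borel_measurable_integrable[OF B] by auto
    have B_shift: "integrable lborel (\<lambda>x. B (x - t))" for t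
      using lborel_integrable_real_affine[OF B, of 1 "- t"] by simp
    have int_shift: "(LBINT x. g (x - t)) = (LBINT x. g x)" for g :: "real \<Rightarrow> 'b::{banach, second_countable_topology}" and t
      using lborel_integral_real_affine[of 1 g "- t"] by simp
    have int2: "integrable (lborel \<Otimes>\<^sub>M lborel) (\<lambda>(t, x). A t * B (x - t))"
    proof (rule lborel_pair.Fubini_integrable)
      show "integrable lborel (\<lambda>t. LBINT x. norm (case (t, x) of (t, x) \<Rightarrow> A t * B (x - t)))"
        using A int_shift[of "\<lambda>x. cmod (B x)"] by (simp add: norm_mult)
      show "AE t in lborel. integrable lborel (\<lambda>x. case (t, x) of (t, x) \<Rightarrow> A t * B (x - t))"
        using B_shift by (intro AE_I2) simp
    qed measurable
    have inner: "(LBINT t. A t * B (x - t)) = indicator {0<..} x *\<^sub>R (exp (- (z * of_real x)) * v x)" for x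
    proof (cases "x > 0")
      case True
      have "(LBINT t. A t * B (x - t)) = (LBINT t. exp (- (z * of_real x)) * (indicator {0<..<x} t *\<^sub>R (a t * b (x - t))))"
      proof (intro Bochner_Integration.integral_cong refl)
        fix t
        have "exp (- (z * of_real t)) * exp (- (z * of_real (x - t))) = exp (- (z * of_real x))"
          by (simp add: algebra_simps flip: exp_add)
        then show "A t * B (x - t) = exp (- (z * of_real x)) * (indicator {0<..<x} t *\<^sub>R (a t * b (x - t)))"
          by (auto simp: A_def B_def indicator_def)
      qed
      also have "\<dots> = exp (- (z * of_real x)) * v x"
        unfolding v[OF True] set_lebesgue_integral_def by (rule integral_mult_right_zero)
      finally show ?thesis using True by simp
    next
      case False
      have "(\<lambda>t. A t * B (x - t)) = (\<lambda>t. 0)"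
        using False by (auto simp: A_def B_def indicator_def fun_eq_iff)
      then show ?thesis using False by simp
    qed
    have "integrable lborel (\<lambda>x. LBINT t. A t * B (x - t))"
      by (rule lborel_pair.integrable_snd[OF int2])
    then have 1: "integrable lborel (\<lambda>t. indicator {0<..} t *\<^sub>R (exp (- (z * of_real t)) * v t))"
      by (simp only: inner)
    have "(LBINT x. (LBINT t. A t * B (x - t))) = (LBINT t. (LBINT x. A t * B (x - t)))"
      by (rule lborel_pair.Fubini_integral[OF int2])
    also have "\<dots> = (LBINT t. A t) * (LBINT x. B x)"
      using int_shift[of B] by simp
    finally have "laplace v z = laplace a z * laplace b z"
      unfolding inner by (simp add: laplace_def set_lebesgue_integral_def A_def B_def)
    with 1 show ?thesis by blast
  qed
  show "laplaceable c v"
    unfolding laplaceable_def set_integrable_def using *[of "of_real _"] by auto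
  show "Re z > c \<Longrightarrow> laplace v z = laplace a z * laplace b z"
    using * by blast
qed

section \<open>Convolution powers on the half-line\<close>

text \<open>For nonnegative terms the sum of squares is at most the square of the sum. The left side
  is a partial sum of the modified Bessel function I_0(2 y).\<close>

lemma sum_squares_le_exp:
  fixes y :: real
  assumes "y \<ge> 0"
  shows "(\<Sum>k<n. (y ^ k / fact k)\<^sup>2) \<le> exp (2 * y)"
proof -
  have "(\<Sum>k<n. (y ^ k / fact k)\<^sup>2) \<le> (\<Sum>k<n. y ^ k / fact k)\<^sup>2"
  proof (induction n)
    case (Suc n)
    have "0 \<le> (\<Sum>k<n. y ^ k / fact k) * (y ^ n / fact n)"
      using assms by (intro mult_nonneg_nonneg sum_nonneg) auto
    with Suc show ?case by (simp add: power2_sum)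
  qed simp
  also have "\<dots> \<le> (exp y)\<^sup>2"
    using assms by (intro power_mono sum_power_div_fact_le_exp sum_nonneg) auto
  also have "\<dots> = exp (2 * y)" by (simp flip: exp_double)
  finally show ?thesis .
qed

text \<open>One factor 1 / k! comes from the assumed bound, the other from 1 / (k + 1)! \<le> 1 /
  k!. With y = sqrt \<alpha> t the k-th term is then at most \<alpha> exp (\<gamma> t) (y^k /
  k!)^2.\<close>

lemma lagrange_series_bound:
  fixes a :: "nat \<Rightarrow> complex"
  assumes "\<alpha> \<ge> 0" "t \<ge> 0"
    and bound: "\<And>k. cmod (a k) \<le> \<alpha> ^ Suc k * t ^ k / fact k * exp (\<gamma> * t)"
  shows "summable (\<lambda>k. cmod (of_real t ^ k / fact (Suc k) * a k))"
    and "(\<Sum>k. cmod (of_real t ^ k / fact (Suc k) * a k)) \<le> \<alpha> * exp ((\<gamma> + 2 * sqrt \<alpha>) * t)"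
proof -
  let ?y = "sqrt \<alpha> * t"
  have "cmod (of_real t ^ k / fact (Suc k) * a k) \<le> \<alpha> * exp (\<gamma> * t) * (?y ^ k / fact k)\<^sup>2" for k
  proof -
    have "cmod (of_real t ^ k / fact (Suc k) * a k) = t ^ k / fact (Suc k) * cmod (a k)"
      using assms(2) by (simp add: norm_mult norm_divide norm_power del: fact_Suc)
    also have "\<dots> \<le> t ^ k / fact k * (\<alpha> ^ Suc k * t ^ k / fact k * exp (\<gamma> * t))"
      using assms(1,2) by (intro mult_mono bound divide_left_mono) (auto simp: fact_mono simp del: fact_Suc)
    also have "\<dots> = \<alpha> * exp (\<gamma> * t) * (?y ^ k / fact k)\<^sup>2"
    proof -
      have "?y ^ k * ?y ^ k = \<alpha> ^ k * (t ^ k * t ^ k)"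
      proof -
        have "?y ^ k * ?y ^ k = (sqrt \<alpha> ^ k * sqrt \<alpha> ^ k) * (t ^ k * t ^ k)"
          by (simp only: power_mult_distrib mult_ac)
        also have "sqrt \<alpha> ^ k * sqrt \<alpha> ^ k = \<alpha> ^ k"
          using assms(1) by (simp flip: power_mult_distrib)
        finally show ?thesis .
      qed
      then show ?thesis
        by (simp add: power2_eq_square)
    qed
    finally show ?thesis .
  qed
  then have "(\<Sum>k<n. cmod (of_real t ^ k / fact (Suc k) * a k)) \<le>
      (\<Sum>k<n. \<alpha> * exp (\<gamma> * t) * (?y ^ k / fact k)\<^sup>2)" for n
    by (intro sum_mono)
  also have "(\<Sum>k<n. \<alpha> * exp (\<gamma> * t) * (?y ^ k / fact k)\<^sup>2) \<le> \<alpha> * exp (\<gamma> * t) * exp (2 * ?y)" for n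
    unfolding sum_distrib_left[symmetric] using assms by (intro mult_left_mono sum_squares_le_exp) auto
  also have "\<alpha> * exp (\<gamma> * t) * exp (2 * ?y) = \<alpha> * exp ((\<gamma> + 2 * sqrt \<alpha>) * t)"
    by (simp add: algebra_simps flip: exp_add)
  finally have *: "(\<Sum>k<n. cmod (of_real t ^ k / fact (Suc k) * a k)) \<le> \<alpha> * exp ((\<gamma> + 2 * sqrt \<alpha>) * t)" for n .
  show s: "summable (\<lambda>k. cmod (of_real t ^ k / fact (Suc k) * a k))"
    by (rule summableI_nonneg_bounded[OF _ *]) simp
  show "(\<Sum>k. cmod (of_real t ^ k / fact (Suc k) * a k)) \<le> \<alpha> * exp ((\<gamma> + 2 * sqrt \<alpha>) * t)"
    by (rule suminf_le_const[OF s *])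
qed

text \<open>Mind the index: \<open>A k\<close> is the convolution power of exponent k + 1. The
  locale isolates the real-variable part of the proof; its assumptions are verified along a ray in
  \<open>convolution_powers_ray\<close>.\<close>

locale convolution_powers =
  fixes A :: "nat \<Rightarrow> real \<Rightarrow> complex" and \<alpha> \<gamma> :: real
  assumes \<alpha>_nonneg: "\<alpha> \<ge> 0"
    and A_meas: "\<And>k. set_borel_measurable borel {0<..} (A k)"
    and A_conv: "\<And>k x. x > 0 \<Longrightarrow> A (Suc k) x = (LBINT t:{0<..<x}. A 0 t * A k (x - t))"
    and A_bound: "\<And>k t. t > 0 \<Longrightarrow> cmod (A k t) \<le> \<alpha> ^ Suc k * t ^ k / fact k * exp (\<gamma> * t)"
begin

text \<open>With \<Phi> = \<open>laplace (A 0)\<close>, the inverse of z + \<Phi>(z) will be u -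
  \<open>laplace E u\<close>; thus E is, up to sign, the Borel transform of its non-constant
  part.\<close>

definition E :: "real \<Rightarrow> complex"
  where "E t = (\<Sum>k. of_real t ^ k / fact (Suc k) * A k t)"

lemma E_bound: "t > 0 \<Longrightarrow> cmod (E t) \<le> \<alpha> * exp ((\<gamma> + 2 * sqrt \<alpha>) * t)"
  unfolding E_def
  using summable_norm[of "\<lambda>k. of_real t ^ k / fact (Suc k) * A k t"]
    lagrange_series_bound[of \<alpha> t "\<lambda>k. A k t" \<gamma>] \<alpha>_nonneg A_bound by fastforce

lemma E_meas: "set_borel_measurable borel {0<..} E"
  unfolding set_borel_measurable_def
proof (rule borel_measurable_LIMSEQ_metric)
  have [measurable]: "(\<lambda>t. indicator {0<..} t *\<^sub>R A k t) \<in> borel_measurable borel" for k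
    using A_meas[of k] by (simp add: set_borel_measurable_def)
  have "(\<lambda>t. \<Sum>k<n. of_real t ^ k / fact (Suc k) * (indicator {0<..} t *\<^sub>R A k t)) \<in> borel_measurable borel" for n
    by measurable
  then show "(\<lambda>t. indicator {0<..} t *\<^sub>R (\<Sum>k<n. of_real t ^ k / fact (Suc k) * A k t)) \<in> borel_measurable borel" for n
    by (simp add: scaleR_sum_right)
  show "(\<lambda>n. indicator {0<..} t *\<^sub>R (\<Sum>k<n. of_real t ^ k / fact (Suc k) * A k t)) \<longlonglongrightarrow> indicator {0<..} t *\<^sub>R E t" for t
  proof (cases "t > 0")
    case True
    then have "summable (\<lambda>k. of_real t ^ k / fact (Suc k) * A k t)"
      using lagrange_series_bound(1)[of \<alpha> t "\<lambda>k. A k t" \<gamma>] \<alpha>_nonneg A_bound by (auto intro: summable_norm_cancel)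
    then show ?thesis
      using summable_LIMSEQ[of "\<lambda>k. of_real t ^ k / fact (Suc k) * A k t"] True by (simp add: E_def)
  qed simp
qed

lemma E_laplaceable: "laplaceable (\<gamma> + 2 * sqrt \<alpha>) E"
  by (rule laplaceable_bounded(1)[OF E_meas E_bound])

lemma A0_bound: "t > 0 \<Longrightarrow> cmod (A 0 t) \<le> \<alpha> * exp (\<gamma> * t)"
  using A_bound[of t 0] by simp

lemma A_laplaceable: "laplaceable \<gamma> (A k)"
  and laplace_A: "Re z > \<gamma> \<Longrightarrow> laplace (A k) z = laplace (A 0) z ^ Suc k"
proof -
  have "laplaceable \<gamma> (A k) \<and> (\<forall>z. Re z > \<gamma> \<longrightarrow> laplace (A k) z = laplace (A 0) z ^ Suc k)"
  proof (induction k)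
    case 0
    then show ?case
      using laplaceable_bounded(1)[OF A_meas A0_bound] by simp
  next
    case (Suc k)
    have 0: "laplaceable \<gamma> (A 0)"
      by (rule laplaceable_bounded(1)[OF A_meas A0_bound])
    show ?case
      using laplace_convolution[OF 0 conjunct1[OF Suc] A_conv] Suc by simp
  qed
  then show "laplaceable \<gamma> (A k)" "Re z > \<gamma> \<Longrightarrow> laplace (A k) z = laplace (A 0) z ^ Suc k"
    by blast+
qed

lemma laplace_A0_bound: "Re z > \<gamma> \<Longrightarrow> cmod (laplace (A 0) z) \<le> \<alpha> / (Re z - \<gamma>)"
  by (rule laplaceable_bounded(2)[OF A_meas A0_bound])

text \<open>Each derivative in z brings down a factor - t, so this is (-1)^N times the N-th
  derivative of \<Phi>^(k+1), \<Phi> = \<open>laplace (A 0)\<close>. Rather than differentiating,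
  the proof identifies two power series expansions of \<Phi>^(k+1) at z.\<close>

lemma laplace_power_A:
  assumes "Re z > \<gamma>"
  shows "laplace (\<lambda>t. of_real t ^ N * A k t) z = (-1) ^ N * fact N * fps_nth (laplace_fps (A 0) z ^ Suc k) N"
proof -
  have "(\<lambda>w. laplace (A k) (z + w)) has_fps_expansion laplace_fps (A k) z"
    by (rule laplace_has_fps_expansion[OF A_laplaceable assms])
  moreover have "(\<lambda>w. laplace (A k) (z + w)) has_fps_expansion laplace_fps (A 0) z ^ Suc k"
  proof -
    have pow: "(\<lambda>w. laplace (A 0) (z + w) ^ Suc k) has_fps_expansion laplace_fps (A 0) z ^ Suc k"
      by (intro has_fps_expansion_power laplace_has_fps_expansion[OF A_laplaceable assms])
    have "eventually (\<lambda>w. w \<in> ball 0 (Re z - \<gamma>)) (nhds 0)"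
      using assms by (intro eventually_nhds_in_open) auto
    then have ev: "eventually (\<lambda>w. laplace (A 0) (z + w) ^ Suc k = laplace (A k) (z + w)) (nhds 0)"
    proof eventually_elim
      case (elim w)
      then have "Re (z + w) > \<gamma>" using abs_Re_le_cmod[of w] by auto
      then show ?case by (rule laplace_A[symmetric])
    qed
    show ?thesis
      by (rule has_fps_expansion_cong[OF ev refl, THEN iffD1, OF pow])
  qed
  ultimately have "laplace_fps (A k) z = laplace_fps (A 0) z ^ Suc k"
    by (rule fps_expansion_unique_complex)
  then have "fps_nth (laplace_fps (A 0) z ^ Suc k) N = (-1) ^ N / fact N * laplace (\<lambda>t. of_real t ^ N * A k t) z"
    unfolding laplace_fps_def by (metis fps_nth_Abs_fps)
  then show ?thesis by simp
qed

text \<open>Lagrange inversion: with \<open>P\<close> the Taylor expansion of \<open>laplace (A 0)\<close> at \<open>z\<close> and \<open>\<Phi>\<close> its constant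
  term, the terms of total degree \<open>N > 0\<close> sum up to a multiple of the \<open>N\<close>-th coefficient of
  \<open>(P - \<Phi>)\<^bsup>N + 1\<^esup>\<close>, which is \<open>0\<close>.\<close>

lemma laplace_E:
  assumes z: "Re z - cmod (laplace (A 0) z) > \<gamma> + 2 * sqrt \<alpha>"
  shows "laplace E (z + laplace (A 0) z) = laplace (A 0) z"
proof -
  define \<Phi> where "\<Phi> = laplace (A 0) z"
  define P where "P = laplace_fps (A 0) z"
  have Re_z: "Re z > \<gamma>" "Re z > \<gamma> + 2 * sqrt \<alpha> + cmod \<Phi>"
    unfolding \<Phi>_def
    using z norm_ge_zero[of "laplace (A 0) z"] real_sqrt_ge_zero[OF \<alpha>_nonneg] by linarith+
  \<comment> \<open>exp (- (z + \<Phi>) t) E(t) is exp (- z t) times the Cauchy product of the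
    series \<open>a\<close> for exp (- \<Phi> t) and \<open>b\<close> for E(t); \<open>c t N\<close>
    collects everything that carries the factor t^N.\<close>
  define a where "a t i = (- (\<Phi> * of_real t)) ^ i / fact i" for t :: real and i
  define b where "b t k = of_real t ^ k / fact (Suc k) * A k t" for t :: real and k
  define c where "c t N = (\<Sum>i\<le>N. a t i * b t (N - i))" for t N
  have a_norm: "summable (\<lambda>i. cmod (a t i))" "(\<Sum>i. cmod (a t i)) = exp (cmod \<Phi> * t)"
    "a t sums exp (- (\<Phi> * of_real t))" if "t > 0" for t
  proof -
    have "(\<lambda>i. (cmod \<Phi> * t) ^ i /\<^sub>R fact i) sums exp (cmod \<Phi> * t)" by (rule exp_converges)
    also have "(\<lambda>i. (cmod \<Phi> * t) ^ i /\<^sub>R fact i) = (\<lambda>i. cmod (a t i))"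
      using that by (simp add: a_def norm_mult norm_divide norm_power norm_inverse divide_inverse mult.commute)
    finally show "summable (\<lambda>i. cmod (a t i))" "(\<Sum>i. cmod (a t i)) = exp (cmod \<Phi> * t)"
      by (simp_all add: sums_iff)
    show "a t sums exp (- (\<Phi> * of_real t))"
      using exp_converges[of "- (\<Phi> * of_real t)"] by (simp add: a_def[abs_def] scaleR_conv_of_real divide_inverse_commute)
  qed
  have b_norm: "summable (\<lambda>k. cmod (b t k))" "(\<Sum>k. cmod (b t k)) \<le> \<alpha> * exp ((\<gamma> + 2 * sqrt \<alpha>) * t)"
    "suminf (b t) = E t" if "t > 0" for t
    using lagrange_series_bound[of \<alpha> t "\<lambda>k. A k t" \<gamma>] \<alpha>_nonneg A_bound that
    by (simp_all add: b_def[abs_def] E_def del: fact_Suc)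
  have c_sums: "c t sums (exp (- (\<Phi> * of_real t)) * E t)" if "t > 0" for t
    using Cauchy_product_sums[OF a_norm(1)[OF that] b_norm(1)[OF that]] a_norm(3)[OF that] b_norm(3)[OF that]
    by (simp add: c_def[abs_def] sums_iff)
  \<comment> \<open>Replacing both series by their absolute values costs |\<Phi>| in the abscissa,
    exactly the room that the hypothesis on z provides.\<close>
  have c_bound: "cmod (\<Sum>N<n. c t N) \<le> \<alpha> * exp ((\<gamma> + 2 * sqrt \<alpha> + cmod \<Phi>) * t)" if "t > 0" for n t
  proof -
    have s: "(\<lambda>N. \<Sum>i\<le>N. cmod (a t i) * cmod (b t (N - i))) sums ((\<Sum>i. cmod (a t i)) * (\<Sum>k. cmod (b t k)))"
      by (rule Cauchy_product_sums) (simp_all add: a_norm b_norm that)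
    have "cmod (\<Sum>N<n. c t N) \<le> (\<Sum>N<n. \<Sum>i\<le>N. cmod (a t i) * cmod (b t (N - i)))"
      unfolding c_def by (intro sum_norm_le) (simp add: norm_mult)
    also have "\<dots> \<le> (\<Sum>i. cmod (a t i)) * (\<Sum>k. cmod (b t k))"
      unfolding sums_unique[OF s] by (rule sum_le_suminf) (use s in \<open>auto simp: sums_iff intro!: sum_nonneg\<close>)
    also have "\<dots> \<le> exp (cmod \<Phi> * t) * (\<alpha> * exp ((\<gamma> + 2 * sqrt \<alpha>) * t))"
      using b_norm(2) a_norm(2) that by (intro mult_mono) (auto intro!: suminf_nonneg b_norm(1))
    finally show ?thesis
      by (simp add: algebra_simps flip: exp_add)
  qed
  have c_eq: "c t N = (\<Sum>i\<le>N. (- \<Phi>) ^ i / (fact i * fact (Suc (N - i))) * (of_real t ^ N * A (N - i) t))" for t N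
    unfolding c_def
  proof (rule sum.cong[OF refl])
    fix i assume "i \<in> {..N}"
    then have "complex_of_real t ^ N = of_real t ^ i * of_real t ^ (N - i)"
      by (simp flip: power_add)
    moreover have "(- (\<Phi> * of_real t)) ^ i = (- \<Phi>) ^ i * of_real t ^ i"
      by (metis mult_minus_left power_mult_distrib)
    ultimately show "a t i * b t (N - i) = (- \<Phi>) ^ i / (fact i * fact (Suc (N - i))) * (of_real t ^ N * A (N - i) t)"
      by (simp add: a_def b_def del: fact_Suc)
  qed
  have c_lap: "laplaceable \<gamma> (\<lambda>t. (- \<Phi>) ^ i / (fact i * fact (Suc (N - i))) * (of_real t ^ N * A (N - i) t))" for N i
    by (intro laplaceable_cmult laplaceable_power A_laplaceable)
  have int: "integrable lborel (\<lambda>t. indicator {0<..} t *\<^sub>R (exp (- (z * of_real t)) * c t N))" for N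
  proof -
    have "integrable lborel (\<lambda>t. \<Sum>i\<le>N. indicator {0<..} t *\<^sub>R (exp (- (z * of_real t)) * ((- \<Phi>) ^ i / (fact i * fact (Suc (N - i))) * (of_real t ^ N * A (N - i) t))))"
      by (intro Bochner_Integration.integrable_sum laplaceable_integrable[OF c_lap] Re_z)
    then show ?thesis by (simp add: c_eq sum_distrib_left scaleR_sum_right del: fact_Suc)
  qed
  have D: "integrable lborel (\<lambda>t. cmod (indicator {0<..} t *\<^sub>R (exp (- (z * of_real t)) * (\<alpha> * exp ((\<gamma> + 2 * sqrt \<alpha> + cmod \<Phi>) * t)))))"
  proof (intro integrable_norm laplaceable_integrable[where c = "\<gamma> + 2 * sqrt \<alpha> + cmod \<Phi>"] laplaceable_bounded(1))
    show "set_borel_measurable borel {0<..} (\<lambda>t. complex_of_real (\<alpha> * exp ((\<gamma> + 2 * sqrt \<alpha> + cmod \<Phi>) * t)))"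
      unfolding set_borel_measurable_def by measurable
    show "cmod (complex_of_real (\<alpha> * exp ((\<gamma> + 2 * sqrt \<alpha> + cmod \<Phi>) * t))) \<le> \<alpha> * exp ((\<gamma> + 2 * sqrt \<alpha> + cmod \<Phi>) * t)" for t
      using \<alpha>_nonneg by (simp add: norm_mult)
  qed (use Re_z in auto)
  have "(\<lambda>N. LBINT t. indicator {0<..} t *\<^sub>R (exp (- (z * of_real t)) * c t N)) sums
      (LBINT t. indicator {0<..} t *\<^sub>R (exp (- (z * of_real t)) * (exp (- (\<Phi> * of_real t)) * E t)))"
  proof (rule dominated_series_integral(2)[OF borel_measurable_integrable[OF int] D])
    show "(\<lambda>N. indicator {0<..} t *\<^sub>R (exp (- (z * of_real t)) * c t N)) sums
        (indicator {0<..} t *\<^sub>R (exp (- (z * of_real t)) * (exp (- (\<Phi> * of_real t)) * E t)))" for t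
      by (cases "t > 0") (auto intro!: sums_mult c_sums)
    show "cmod (\<Sum>N<n. indicator {0<..} t *\<^sub>R (exp (- (z * of_real t)) * c t N)) \<le>
        cmod (indicator {0<..} t *\<^sub>R (exp (- (z * of_real t)) * (\<alpha> * exp ((\<gamma> + 2 * sqrt \<alpha> + cmod \<Phi>) * t))))" for n t
    proof (cases "t > 0")
      case True
      have "cmod (\<Sum>N<n. exp (- (z * of_real t)) * c t N) = cmod (exp (- (z * of_real t))) * cmod (\<Sum>N<n. c t N)"
        by (simp only: norm_mult flip: sum_distrib_left)
      also have "\<dots> \<le> cmod (exp (- (z * of_real t))) * (\<alpha> * exp ((\<gamma> + 2 * sqrt \<alpha> + cmod \<Phi>) * t))"
        by (intro mult_left_mono c_bound[OF True]) simp
      finally show ?thesis using True \<alpha>_nonneg by (simp add: norm_mult)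
    qed simp
  qed
  also have "(LBINT t. indicator {0<..} t *\<^sub>R (exp (- (z * of_real t)) * (exp (- (\<Phi> * of_real t)) * E t))) = laplace E (z + \<Phi>)"
    unfolding laplace_def set_lebesgue_integral_def
    by (intro Bochner_Integration.integral_cong refl) (simp add: algebra_simps exp_add[symmetric])
  also have "(\<lambda>N. LBINT t. indicator {0<..} t *\<^sub>R (exp (- (z * of_real t)) * c t N)) = (\<lambda>N. if N = 0 then \<Phi> else 0)"
  proof
    fix N
    have "(LBINT t. indicator {0<..} t *\<^sub>R (exp (- (z * of_real t)) * c t N)) =
        laplace (\<lambda>t. c t N) z"
      by (simp only: laplace_def set_lebesgue_integral_def)
    also have "\<dots> = (\<Sum>i\<le>N. laplace (\<lambda>t. (- \<Phi>) ^ i / (fact i * fact (Suc (N - i))) * (of_real t ^ N * A (N - i) t)) z)"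
      unfolding c_eq by (rule laplace_sum[OF _ c_lap Re_z(1)]) simp
    also have "\<dots> = (\<Sum>i\<le>N. (- \<Phi>) ^ i / (fact i * fact (Suc (N - i))) * ((-1) ^ N * fact N * fps_nth (P ^ Suc (N - i)) N))"
      by (simp only: laplace_cmult laplace_power_A[OF Re_z(1)] P_def)
    also have "\<dots> = (-1) ^ N * fact N / fact (Suc N) *
        (\<Sum>i\<le>N. of_nat (Suc N choose i) * (- \<Phi>) ^ i * fps_nth (P ^ (Suc N - i)) N)"
      unfolding sum_distrib_left
    proof (rule sum.cong[OF refl])
      fix i assume "i \<in> {..N}"
      then have "of_nat (Suc N choose i) = (fact (Suc N) / (fact i * fact (Suc (N - i))) :: complex)" "Suc N - i = Suc (N - i)"
        using binomial_fact[of i "Suc N", where 'a = complex] by (auto simp: Suc_diff_le simp del: fact_Suc)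
      then show "(- \<Phi>) ^ i / (fact i * fact (Suc (N - i))) * ((-1) ^ N * fact N * fps_nth (P ^ Suc (N - i)) N) =
         (-1) ^ N * fact N / fact (Suc N) * (of_nat (Suc N choose i) * (- \<Phi>) ^ i * fps_nth (P ^ (Suc N - i)) N)"
        by (simp del: fact_Suc binomial_Suc_Suc power_Suc)
    qed
    \<comment> \<open>The full binomial sum also has the term i = N + 1, which is (- \<Phi>)^(N+1)
      times coefficient N of the series 1. It contributes for N = 0 only, and this is where the
      value \<Phi> comes from.\<close>
    also have "(\<Sum>i\<le>N. of_nat (Suc N choose i) * (- \<Phi>) ^ i * fps_nth (P ^ (Suc N - i)) N) = (if N = 0 then \<Phi> else 0)"
    proof -
      have "(fps_const (- \<Phi>) + P) ^ Suc N = (\<Sum>i\<le>Suc N. of_nat (Suc N choose i) * fps_const (- \<Phi>) ^ i * P ^ (Suc N - i))"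
        by (rule binomial_ring)
      then have "fps_nth ((fps_const (- \<Phi>) + P) ^ Suc N) N =
          (\<Sum>i\<le>Suc N. fps_nth (fps_const (of_nat (Suc N choose i) * (- \<Phi>) ^ i) * P ^ (Suc N - i)) N)"
        by (simp only: fps_sum_nth fps_of_nat[symmetric] fps_const_power fps_const_mult)
      also have "\<dots> = (\<Sum>i\<le>Suc N. of_nat (Suc N choose i) * (- \<Phi>) ^ i * fps_nth (P ^ (Suc N - i)) N)"
        by (simp only: fps_mult_left_const_nth)
      also have "\<dots> = (\<Sum>i\<le>N. of_nat (Suc N choose i) * (- \<Phi>) ^ i * fps_nth (P ^ (Suc N - i)) N)
          + (- \<Phi>) ^ Suc N * (if N = 0 then 1 else 0)"
        by (simp add: binomial_eq_0)
      finally have "fps_nth ((fps_const (- \<Phi>) + P) ^ Suc N) N = \<dots>" .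
      moreover have "fps_nth ((fps_const (- \<Phi>) + P) ^ Suc N) N = 0"
        by (rule startsby_zero_power_prefix[rule_format]) (auto simp: P_def laplace_fps_def \<Phi>_def)
      ultimately show ?thesis by (auto simp: algebra_simps eq_neg_iff_add_eq_0 simp del: power_Suc binomial_Suc_Suc split: if_splits)
    qed
    finally show "(LBINT t. indicator {0<..} t *\<^sub>R (exp (- (z * of_real t)) * c t N)) = (if N = 0 then \<Phi> else 0)"
      by (simp split: if_splits)
  qed
  finally have "(\<lambda>N. if N = 0 then \<Phi> else 0) sums laplace E (z + \<Phi>)" .
  moreover have "(\<lambda>N. if N = 0 then \<Phi> else 0) sums \<Phi>"
    using sums_single[of 0 "\<lambda>_. \<Phi>"] by simp
  ultimately show ?thesis
    unfolding \<Phi>_def[symmetric] by (rule sums_unique2)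
qed

end

text \<open>For s > 0, x - s^2 / x increases with x and equals 2 s at the positive root (1 + sqrt 2)
  s of x^2 - 2 s x - s^2 = 0, where s^2 / x = (sqrt 2 - 1) s.\<close>

lemma inverse_gap:
  fixes s x :: real
  assumes "s \<ge> 0" "x > (1 + sqrt 2) * s"
  shows "s\<^sup>2 / x \<le> (sqrt 2 - 1) * s" "x - s\<^sup>2 / x > 2 * s"
proof -
  have sq: "(sqrt 2 - 1) * (1 + sqrt 2) = 1"
    using real_sqrt_pow2[of 2] by (simp add: algebra_simps power2_eq_square)
  have "sqrt 2 - 1 > 0" by simp
  have x: "x > 0" using assms by (smt (verit) mult_nonneg_nonneg real_sqrt_ge_zero)
  have "s\<^sup>2 = (sqrt 2 - 1) * s * ((1 + sqrt 2) * s)"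
    using sq by (simp add: power2_eq_square algebra_simps)
  also have "\<dots> \<le> (sqrt 2 - 1) * s * x"
    using assms \<open>sqrt 2 - 1 > 0\<close> by (intro mult_left_mono) auto
  finally show le: "s\<^sup>2 / x \<le> (sqrt 2 - 1) * s"
    using x by (simp add: field_simps)
  show "x - s\<^sup>2 / x > 2 * s"
    using le assms(2) by (simp add: algebra_simps)
qed

section \<open>Two-sided inversion on a half-plane with explicit constants\<close>

context convolution_powers
begin

abbreviation "s \<equiv> sqrt \<alpha>"

lemma s_nonneg: "s \<ge> 0" and s_sq: "s\<^sup>2 = \<alpha>"
  using \<alpha>_nonneg by auto

lemma laplace_A0_small:
  assumes "Re z > \<gamma> + (1 + sqrt 2) * s"
  shows "cmod (laplace (A 0) z) \<le> (sqrt 2 - 1) * s"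
proof -
  have "Re z > \<gamma>" using assms s_nonneg by (smt (verit) mult_nonneg_nonneg real_sqrt_ge_zero)
  from laplace_A0_bound[OF this] inverse_gap(1)[OF s_nonneg, of "Re z - \<gamma>"] assms s_sq
  show ?thesis by simp
qed

text \<open>The distance from Re z to the abscissa \<gamma> + 2 s of E exceeds (sqrt 2 - 1) s, and
  s^2 divided by this is (1 + sqrt 2) s. Comparing after multiplying out covers s = 0. The bound is
  what keeps z - \<open>laplace E z\<close> to the right of \<gamma>.\<close>

lemma laplace_E_small:
  assumes "Re z > \<gamma> + (1 + sqrt 2) * s"
  shows "cmod (laplace E z) \<le> (1 + sqrt 2) * s"
proof -
  let ?x = "Re z - (\<gamma> + 2 * s)"
  have sq: "(sqrt 2 - 1) * (1 + sqrt 2) = 1"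
    using real_sqrt_pow2[of 2] by (simp add: algebra_simps power2_eq_square)
  have x: "?x > (sqrt 2 - 1) * s" using assms by (simp add: algebra_simps)
  have "(sqrt 2 - 1) * s \<ge> 0" using s_nonneg by simp
  with x have x0: "?x > 0" by linarith
  have "cmod (laplace E z) \<le> \<alpha> / ?x"
    by (rule laplaceable_bounded(2)[OF E_meas E_bound]) (use x0 in auto)
  also have "\<dots> \<le> (1 + sqrt 2) * s"
  proof -
    have "\<alpha> = (1 + sqrt 2) * s * ((sqrt 2 - 1) * s)"
      using sq s_sq by (simp add: power2_eq_square algebra_simps)
    also have "\<dots> \<le> (1 + sqrt 2) * s * ?x"
      using x s_nonneg by (intro mult_left_mono) auto
    finally show ?thesis using x0 by (simp add: pos_divide_le_eq)
  qed
  finally show ?thesis .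
qed

text \<open>\<open>laplace_E\<close> asks for Re z - |\<Phi>| > \<gamma> + 2 s. Since |\<Phi>| is at
  most s^2 / x for x = Re z - \<gamma>, this is the second part of
  \<open>inverse_gap\<close>.\<close>

lemma laplace_left_inverse:
  assumes "Re z > \<gamma> + (1 + sqrt 2) * s"
  shows "laplace E (z + laplace (A 0) z) = laplace (A 0) z"
proof (rule laplace_E)
  have "Re z > \<gamma>" using assms s_nonneg by (smt (verit) mult_nonneg_nonneg real_sqrt_ge_zero)
  from laplace_A0_bound[OF this] inverse_gap(2)[OF s_nonneg, of "Re z - \<gamma>"] assms s_sq
  show "Re z - cmod (laplace (A 0) z) > \<gamma> + 2 * s" by simp
qed

text \<open>\<open>laplace_left_inverse\<close> settles every u of the form w + \<Phi>(w) with w in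
  its half-plane. Such a w is found where \<Phi> is small. The defect of the identity is holomorphic
  on the whole half-plane, because u - \<open>laplace E u\<close> stays in the domain of
  \<Phi>.\<close>

lemma laplace_right_inverse:
  assumes u: "Re u > \<gamma> + (1 + sqrt 2) * s"
  shows "Re (u - laplace E u) > \<gamma>" "laplace (A 0) (u - laplace E u) = laplace E u"
proof -
  let ?H = "\<lambda>c. {u. Re u > c}"
  define c where "c = \<gamma> + (1 + sqrt 2) * s"
  have re: "Re (u - laplace E u) > \<gamma>" if "Re u > c" for u
    using laplace_E_small[of u] that abs_Re_le_cmod[of "laplace E u"] by (simp add: c_def)
  then show "Re (u - laplace E u) > \<gamma>" using u by (simp add: c_def)
  have c: "c \<ge> \<gamma> + 2 * s"
  proof -
    have "(1 + sqrt 2) * s \<ge> 2 * s" using s_nonneg by (intro mult_right_mono) auto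
    then show ?thesis by (simp add: c_def)
  qed
  have E_holo: "laplace E holomorphic_on ?H c"
    by (rule holomorphic_on_subset[OF laplace_holomorphic[OF E_laplaceable]]) (use c in auto)
  have A_holo: "laplace (A 0) holomorphic_on ?H \<gamma>"
    by (rule laplace_holomorphic[OF A_laplaceable])
  \<comment> \<open>For Re u > R the closed unit disc about u lies where Re w - \<gamma> > \<alpha>
    + 1. There |\<Phi>(w)| is at most 1, and u - \<Phi>(w) maps the disc into itself.\<close>
  define R where "R = c + \<alpha> + 2"
  have "laplace (A 0) (u - laplace E u) - laplace E u = 0"
  proof (rule analytic_continuation_open[where s = "?H R" and s' = "?H c" and g = "\<lambda>_. 0"
        and f = "\<lambda>u. laplace (A 0) (u - laplace E u) - laplace E u"])
    show "?H R \<subseteq> ?H c" using \<alpha>_nonneg by (auto simp: R_def)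
    show "?H R \<noteq> {}" using gt_ex[of R] by (auto intro: exI[of _ "of_real _"])
    show "connected (?H c)" by (intro convex_connected convex_halfspace_Re_gt)
    show "(\<lambda>u. laplace (A 0) (u - laplace E u) - laplace E u) holomorphic_on ?H c"
      by (intro holomorphic_intros E_holo holomorphic_on_compose_gen[OF _ A_holo, unfolded o_def])
         (use re in auto)
    show "u \<in> ?H c" using u by (simp add: c_def)
    fix u assume u: "u \<in> ?H R"
    have B: "cmod (laplace (A 0) w) \<le> 1" "Re w > c" if "w \<in> cball u 1" for w
    proof -
      have "\<bar>Re (u - w)\<bar> \<le> 1"
        using that abs_Re_le_cmod[of "u - w"] by (simp add: dist_norm)
      then have 1: "Re w > c + \<alpha> + 1" using u by (auto simp: R_def)
      then show "Re w > c" using \<alpha>_nonneg by simp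
      have 2: "Re w - \<gamma> > \<alpha> + 1" using 1 c s_nonneg by linarith
      then have "\<alpha> / (Re w - \<gamma>) \<le> 1" using \<alpha>_nonneg by (simp add: divide_le_eq)
      moreover have "Re w > \<gamma>" using 2 \<alpha>_nonneg by linarith
      ultimately show "cmod (laplace (A 0) w) \<le> 1"
        using laplace_A0_bound[of w] by linarith
    qed
    have "continuous_on (cball u 1) (\<lambda>w. u - laplace (A 0) w)"
    proof (intro continuous_intros continuous_on_subset[OF holomorphic_on_imp_continuous_on[OF A_holo]] subsetI)
      show "w \<in> ?H \<gamma>" if "w \<in> cball u 1" for w
        using B(2)[OF that] c s_nonneg by (simp only: mem_Collect_eq)
    qed
    moreover have "(\<lambda>w. u - laplace (A 0) w) \<in> cball u 1 \<rightarrow> cball u 1"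
      using B(1) by (auto simp: dist_norm)
    \<comment> \<open>The fixed point solves w + \<Phi>(w) = u.\<close>
    ultimately obtain w where w: "w \<in> cball u 1" "u - laplace (A 0) w = w"
      using brouwer[of "cball u 1"] by auto
    have "laplace E u = laplace (A 0) w"
      using laplace_left_inverse[of w] B(2)[OF w(1)] w(2) unfolding c_def
      by (metis add.commute diff_add_cancel)
    moreover from this have "u - laplace E u = w" using w(2) by simp
    ultimately show "laplace (A 0) (u - laplace E u) - laplace E u = 0" by simp
  qed (auto simp: open_halfspace_Re_gt)
  then show "laplace (A 0) (u - laplace E u) = laplace E u" by simp
qed

end

section \<open>Convolution on star-shaped domains\<close>

text \<open>Euler's Beta integral at positive integers. It enters twice: as the constant in the
  convolution of two monomials, and as the gain from k! to (k + 1)! in the bound for convolution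
  powers.\<close>

lemma has_integral_beta_nat:
  "((\<lambda>s::real. s ^ i * (1 - s) ^ j) has_integral (fact i * fact j / fact (i + j + 1))) {0..1}"
proof (induction j arbitrary: i)
  case 0
  have "((\<lambda>s::real. s ^ i) has_integral (1 ^ Suc i / real (Suc i) - 0 ^ Suc i / real (Suc i))) {0..1}"
  proof (intro fundamental_theorem_of_calculus)
    fix x :: real
    have "((\<lambda>s. s ^ Suc i / real (Suc i)) has_real_derivative x ^ i) (at x within {0..1})"
      by (rule derivative_eq_intros refl | simp)+
    then show "((\<lambda>s. s ^ Suc i / real (Suc i)) has_vector_derivative x ^ i) (at x within {0..1})"
      by (simp only: has_real_derivative_iff_has_vector_derivative)
  qed simp
  then show ?case by simp
next
  case (Suc j)
  let ?c = "real (Suc j) / real (Suc i)"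
  \<comment> \<open>Integration by parts: the antiderivative s^(i+1) (1 - s)^(j+1) / (i + 1)
    vanishes at both ends.\<close>
  have "((\<lambda>s::real. s ^ i * (1 - s) ^ Suc j - ?c * (s ^ Suc i * (1 - s) ^ j)) has_integral
      (1 ^ Suc i * (1 - 1) ^ Suc j / real (Suc i) - 0 ^ Suc i * (1 - 0) ^ Suc j / real (Suc i))) {0..1}"
  proof (intro fundamental_theorem_of_calculus)
    fix x :: real
    have "((\<lambda>s. s ^ Suc i * (1 - s) ^ Suc j / real (Suc i)) has_real_derivative
        x ^ i * (1 - x) ^ Suc j - ?c * (x ^ Suc i * (1 - x) ^ j)) (at x within {0..1})"
      by (rule derivative_eq_intros refl | simp)+ (simp add: diff_divide_distrib mult_ac)
    then show "((\<lambda>s. s ^ Suc i * (1 - s) ^ Suc j / real (Suc i)) has_vector_derivative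
        x ^ i * (1 - x) ^ Suc j - ?c * (x ^ Suc i * (1 - x) ^ j)) (at x within {0..1})"
      by (simp only: has_real_derivative_iff_has_vector_derivative)
  qed simp
  from has_integral_add[OF this has_integral_mult_right[OF Suc[of "Suc i"], of ?c]]
  have "((\<lambda>s::real. s ^ i * (1 - s) ^ Suc j) has_integral ?c * (fact (Suc i) * fact j / fact (Suc i + j + 1))) {0..1}"
    by simp
  moreover have "?c * (fact (Suc i) * fact j / fact (Suc i + j + 1)) = fact i * fact (Suc j) / fact (i + Suc j + 1)"
    by simp
  ultimately show ?case by metis
qed

text \<open>The integral of F(w) G(z - w) over the segment from 0 to z, parametrised so that the
  range of integration does not depend on z.\<close>

definition conv :: "(complex \<Rightarrow> complex) \<Rightarrow> (complex \<Rightarrow> complex) \<Rightarrow> complex \<Rightarrow> complex"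
  where "conv F G z = z * integral {0..1} (\<lambda>s. F (of_real s * z) * G (of_real (1 - s) * z))"

text \<open>The exponent is k + 1: counting starts at F, since the unit \<delta> of convolution is
  not a function.\<close>

fun conv_pow :: "(complex \<Rightarrow> complex) \<Rightarrow> nat \<Rightarrow> complex \<Rightarrow> complex"
  where "conv_pow F 0 = F" | "conv_pow F (Suc k) = conv F (conv_pow F k)"

text \<open>By the Beta integral, monomials of degree i and j convolve to i! j! / (i + j + 1)! times
  the monomial of degree i + j + 1. The degree goes up by one, so the constant coefficient is an
  empty sum.\<close>

definition fps_conv :: "complex fps \<Rightarrow> complex fps \<Rightarrow> complex fps"
  where "fps_conv f g = Abs_fps (\<lambda>n. \<Sum>i<n. fps_nth f i * fps_nth g (n - 1 - i) * (fact i * fact (n - 1 - i) / fact n))"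

fun fps_conv_pow :: "complex fps \<Rightarrow> nat \<Rightarrow> complex fps"
  where "fps_conv_pow f 0 = f" | "fps_conv_pow f (Suc k) = fps_conv f (fps_conv_pow f k)"

text \<open>On a disc where both series represent their functions, the Cauchy product for F(s z)
  G((1 - s) z) converges uniformly in s and is integrated term by term into Beta integrals.\<close>

lemma conv_has_fps_expansion:
  assumes F: "F has_fps_expansion f" and G: "G has_fps_expansion g"
  shows "conv F G has_fps_expansion fps_conv f g"
proof -
  have "eventually (\<lambda>z. eval_fps f z = F z \<and> eval_fps g z = G z \<and> z \<in> eball 0 (min (fps_conv_radius f) (fps_conv_radius g))) (nhds 0)"
    using F G unfolding has_fps_expansion_def
    by (intro eventually_conj eventually_nhds_in_open) (auto simp: min_def zero_ereal_def)
  then obtain e where e: "e > 0" and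
    *: "\<And>z. dist z 0 < e \<Longrightarrow> eval_fps f z = F z \<and> eval_fps g z = G z \<and> z \<in> eball 0 (min (fps_conv_radius f) (fps_conv_radius g))"
    unfolding eventually_nhds_metric by auto
  have "(\<lambda>n. fps_nth (fps_conv f g) n * z ^ n) sums conv F G z" if z: "dist z 0 < e" for z
  proof -
    define M where "M n = (\<Sum>i\<le>n. cmod (fps_nth f i * z ^ i) * cmod (fps_nth g (n - i) * z ^ (n - i)))" for n
    define a where "a s i = fps_nth f i * (of_real s * z) ^ i" for s :: real and i
    define b where "b s i = fps_nth g i * (of_real (1 - s) * z) ^ i" for s :: real and i
    define c where "c n s = (\<Sum>i\<le>n. a s i * b s (n - i))" for n s
    have summ: "summable (\<lambda>i. cmod (fps_nth f i * w ^ i))" "summable (\<lambda>i. cmod (fps_nth g i * w ^ i))"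
      if "dist w 0 < e" for w
      using *[OF that] by (auto intro!: abs_summable_in_conv_radius simp: fps_conv_radius_def)
    have in_e: "dist (of_real s * z) 0 < e" "dist (of_real (1 - s) * z) 0 < e" if "s \<in> {0..1}" for s
    proof -
      have "s * cmod z \<le> 1 * cmod z" "(1 - s) * cmod z \<le> 1 * cmod z"
        using that by (intro mult_right_mono; simp)+
      then show "dist (of_real s * z) 0 < e" "dist (of_real (1 - s) * z) 0 < e"
        using z that by (auto simp: norm_mult simp flip: of_real_diff)
    qed
    have "summable M"
      using Cauchy_product_sums[of "\<lambda>i. cmod (fps_nth f i * z ^ i)" "\<lambda>i. cmod (fps_nth g i * z ^ i)"] summ[OF z]
      by (auto simp: M_def[abs_def] sums_iff)
    moreover have "cmod (c n s) \<le> M n" if s: "s \<in> {0..1}" for n s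
      unfolding c_def M_def
    proof (rule sum_norm_le)
      fix i
      have "cmod (a s i * b s (n - i)) =
          (s ^ i * (1 - s) ^ (n - i)) * (cmod (fps_nth f i * z ^ i) * cmod (fps_nth g (n - i) * z ^ (n - i)))"
        using s by (simp add: a_def b_def norm_mult norm_power power_mult_distrib mult_ac flip: of_real_diff)
      also have "\<dots> \<le> 1 * (cmod (fps_nth f i * z ^ i) * cmod (fps_nth g (n - i) * z ^ (n - i)))"
        using s by (intro mult_right_mono mult_le_one power_le_one) auto
      finally show "cmod (a s i * b s (n - i)) \<le> cmod (fps_nth f i * z ^ i) * cmod (fps_nth g (n - i) * z ^ (n - i))"
        by simp
    qed
    ultimately have ul: "uniform_limit {0..1} (\<lambda>N s. \<Sum>n<N. c n s) (\<lambda>s. \<Sum>n. c n s) sequentially"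
      by (intro Weierstrass_m_test) auto
    have "continuous_on {0..1} (\<lambda>s. \<Sum>n<N. c n s)" for N
      unfolding c_def a_def b_def by (intro continuous_intros)
    from uniform_limit_integral[OF ul this] obtain I J where
      I: "\<And>N. ((\<lambda>s. \<Sum>n<N. c n s) has_integral I N) {0..1}" and
      J: "((\<lambda>s. \<Sum>n. c n s) has_integral J) {0..1}" and lim: "I \<longlonglongrightarrow> J"
      by auto
    define d where "d n = z ^ n * (\<Sum>i\<le>n. fps_nth f i * fps_nth g (n - i) * (fact i * fact (n - i) / fact (Suc n)))" for n
    have "(c n has_integral d n) {0..1}" for n
    proof -
      have "((\<lambda>s. \<Sum>i\<le>n. fps_nth f i * fps_nth g (n - i) * z ^ n * complex_of_real (s ^ i * (1 - s) ^ (n - i))) has_integral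
          (\<Sum>i\<le>n. fps_nth f i * fps_nth g (n - i) * z ^ n * complex_of_real (fact i * fact (n - i) / fact (i + (n - i) + 1)))) {0..1}"
        by (intro has_integral_sum has_integral_mult_right
            has_integral_linear[OF has_integral_beta_nat bounded_linear_of_real, unfolded o_def]) auto
      also have "(\<lambda>s. \<Sum>i\<le>n. fps_nth f i * fps_nth g (n - i) * z ^ n * complex_of_real (s ^ i * (1 - s) ^ (n - i))) = c n"
      proof
        fix s
        show "(\<Sum>i\<le>n. fps_nth f i * fps_nth g (n - i) * z ^ n * complex_of_real (s ^ i * (1 - s) ^ (n - i))) = c n s"
          unfolding c_def
        proof (rule sum.cong[OF refl])
          fix i assume "i \<in> {..n}"
          then have "z ^ n = z ^ i * z ^ (n - i)" by (simp flip: power_add)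
          then show "fps_nth f i * fps_nth g (n - i) * z ^ n * complex_of_real (s ^ i * (1 - s) ^ (n - i)) = a s i * b s (n - i)"
            by (simp add: a_def b_def power_mult_distrib mult_ac)
        qed
      qed
      also have "(\<Sum>i\<le>n. fps_nth f i * fps_nth g (n - i) * z ^ n * complex_of_real (fact i * fact (n - i) / fact (i + (n - i) + 1))) = d n"
        unfolding d_def sum_distrib_left by (intro sum.cong refl) (simp del: fact_Suc)
      finally show ?thesis .
    qed
    then have "((\<lambda>s. \<Sum>n<N. c n s) has_integral (\<Sum>n<N. d n)) {0..1}" for N
      by (intro has_integral_sum) auto
    then have "I = (\<lambda>N. \<Sum>n<N. d n)"
      using I has_integral_unique by blast
    then have "d sums J" using lim by (simp add: sums_def)
    then have "(\<lambda>n. z * d n) sums (z * J)" by (rule sums_mult)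
    \<comment> \<open>The factor z in \<open>conv\<close> makes \<open>d n\<close> the term of
      degree n + 1; the constant term is zero.\<close>
    also have "(\<lambda>n. z * d n) = (\<lambda>n. fps_nth (fps_conv f g) (Suc n) * z ^ Suc n)"
      by (simp add: d_def fps_conv_def fun_eq_iff lessThan_Suc_atMost del: fact_Suc)
    finally have "(\<lambda>n. fps_nth (fps_conv f g) n * z ^ n) sums (z * J)"
      by (subst (asm) sums_Suc_iff) (simp add: fps_conv_def)
    moreover have "z * J = conv F G z"
    proof -
      have "(\<Sum>n. c n s) = F (of_real s * z) * G (of_real (1 - s) * z)" if s: "s \<in> {0..1}" for s
      proof -
        have "(\<lambda>n. c n s) sums ((\<Sum>i. a s i) * (\<Sum>i. b s i))"
          unfolding c_def by (rule Cauchy_product_sums) (use summ in_e[OF s] in \<open>auto simp: a_def b_def\<close>)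
        moreover have "(\<Sum>i. a s i) = F (of_real s * z)" "(\<Sum>i. b s i) = G (of_real (1 - s) * z)"
          using *[OF in_e(1)[OF s]] *[OF in_e(2)[OF s]] by (simp_all add: a_def b_def eval_fps_def)
        ultimately show ?thesis by (simp add: sums_iff)
      qed
      then have "((\<lambda>s. F (of_real s * z) * G (of_real (1 - s) * z)) has_integral J) {0..1}"
        using J by (subst has_integral_cong) (auto simp: eq_commute)
      then show ?thesis by (simp add: conv_def integral_unique)
    qed
    ultimately show ?thesis by simp
  qed
  then show ?thesis
    using e by (intro has_fps_expansionI) (auto simp: eventually_nhds_metric)
qed

lemma conv_pow_has_fps_expansion:
  assumes "F has_fps_expansion f"
  shows "conv_pow F k has_fps_expansion fps_conv_pow f k"
  by (induction k) (use assms conv_has_fps_expansion in auto)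

locale star_domain =
  fixes W :: "complex set"
  assumes open_W: "open W" and zero_W: "0 \<in> W"
    and star: "z \<in> W \<Longrightarrow> s \<in> {0..1} \<Longrightarrow> of_real s * z \<in> W"
begin

lemma star': "z \<in> W \<Longrightarrow> s \<in> {0..1} \<Longrightarrow> of_real (1 - s) * z \<in> W"
  using star[of z "1 - s"] by auto

lemma conv_continuous:
  assumes "F holomorphic_on W" "G holomorphic_on W" "z \<in> W"
  shows "continuous_on {0..1} (\<lambda>s. F (of_real s * z) * G (of_real (1 - s) * z))"
  by (intro continuous_intros continuous_on_compose2[OF holomorphic_on_imp_continuous_on[OF assms(1)]]
      continuous_on_compose2[OF holomorphic_on_imp_continuous_on[OF assms(2)]])
     (use star star' assms(3) in auto)

text \<open>Differentiation under an integral over a fixed interval. The Leibniz rule is applied on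
  balls because it is stated for convex sets, while W is only star-shaped.\<close>

lemma conv_holomorphic:
  assumes F: "F holomorphic_on W" and G: "G holomorphic_on W"
  shows "conv F G holomorphic_on W"
proof -
  have "\<exists>d>0. conv F G holomorphic_on ball z d" if z: "z \<in> W" for z
  proof -
    obtain d where d: "d > 0" "ball z d \<subseteq> W"
      using open_W z openE by blast
    let ?f = "\<lambda>x s. F (of_real s * x) * G (of_real (1 - s) * x)"
    let ?f' = "\<lambda>x s. of_real s * deriv F (of_real s * x) * G (of_real (1 - s) * x) +
        F (of_real s * x) * (of_real (1 - s) * deriv G (of_real (1 - s) * x))"
    have F': "deriv F holomorphic_on W" and G': "deriv G holomorphic_on W"
      using F G open_W by (auto intro: holomorphic_deriv)
    have "(\<lambda>x. integral (cbox 0 1) (?f x)) holomorphic_on ball z d"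
    proof (rule leibniz_rule_holomorphic[where fx = ?f'])
      fix x and s :: real assume x: "x \<in> ball z d" and "s \<in> cbox 0 1"
      then have s: "s \<in> {0..1}" and W: "of_real s * x \<in> W" "of_real (1 - s) * x \<in> W"
        using d star star' by auto
      have "(F has_field_derivative deriv F (of_real s * x)) (at (of_real s * x))"
        "(G has_field_derivative deriv G (of_real (1 - s) * x)) (at (of_real (1 - s) * x))"
        using F G open_W W by (auto intro: holomorphic_derivI)
      from DERIV_chain2[where g = "\<lambda>x. of_real s * x", OF this(1)]
        DERIV_chain2[where g = "\<lambda>x. of_real (1 - s) * x", OF this(2)]
      have "((\<lambda>x. F (of_real s * x)) has_field_derivative deriv F (of_real s * x) * of_real s) (at x within ball z d)"
        "((\<lambda>x. G (of_real (1 - s) * x)) has_field_derivative deriv G (of_real (1 - s) * x) * of_real (1 - s)) (at x within ball z d)"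
        by (auto intro!: derivative_eq_intros)
      from DERIV_mult[OF this] show "((\<lambda>x. ?f x s) has_field_derivative ?f' x s) (at x within ball z d)"
        by (rule DERIV_cong) (simp add: algebra_simps)
    next
      fix x assume "x \<in> ball z d"
      then have "x \<in> W" using d by blast
      then show "?f x integrable_on cbox 0 1"
        unfolding box_real by (intro integrable_continuous_interval conv_continuous F G)
    next
      have "of_real (snd p) * fst p \<in> W \<and> of_real (1 - snd p) * fst p \<in> W" if "p \<in> ball z d \<times> cbox 0 1" for p
        using that d star[of "fst p" "snd p"] star'[of "fst p" "snd p"] by auto
      then show "continuous_on (ball z d \<times> cbox 0 1) (\<lambda>(x, s). ?f' x s)"
        unfolding case_prod_unfold
        by (intro continuous_intros continuous_on_compose2[OF holomorphic_on_imp_continuous_on[OF F]]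
            continuous_on_compose2[OF holomorphic_on_imp_continuous_on[OF G]]
            continuous_on_compose2[OF holomorphic_on_imp_continuous_on[OF F']]
            continuous_on_compose2[OF holomorphic_on_imp_continuous_on[OF G']]) blast+
    qed auto
    then have "conv F G holomorphic_on ball z d"
      unfolding conv_def by (intro holomorphic_intros) simp
    with d show ?thesis by blast
  qed
  then have "conv F G analytic_on W"
    by (simp add: analytic_on_def)
  then show ?thesis by (rule analytic_imp_holomorphic)
qed

lemma conv_pow_holomorphic:
  assumes "F holomorphic_on W"
  shows "conv_pow F k holomorphic_on W"
  by (induction k) (use assms conv_holomorphic in auto)

text \<open>F is bounded on one segment only, so the estimate may depend on the direction, and it is
  proved at all points of the segment because the induction evaluates both factors at intermediate
  points. The exponentials recombine exactly, and the integral of (1 - t)^k turns k! into (k +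
  1)!.\<close>

lemma conv_pow_bound:
  assumes F: "F holomorphic_on W" and z: "z \<in> W" and "A \<ge> 0"
    and bound: "\<And>s. s \<in> {0..1} \<Longrightarrow> cmod (F (of_real s * z)) \<le> A * exp (g * (s * cmod z))"
    and s: "s \<in> {0..1}"
  shows "cmod (conv_pow F k (of_real s * z)) \<le> A ^ Suc k * (s * cmod z) ^ k / fact k * exp (g * (s * cmod z))"
  using s
proof (induction k arbitrary: s)
  case 0
  then show ?case using bound by simp
next
  case (Suc k)
  let ?x = "s * cmod z"
  let ?G = "conv_pow F k"
  have W: "of_real s * z \<in> W" using star z Suc by auto
  have "cmod (integral {0..1} (\<lambda>t. F (of_real t * (of_real s * z)) * ?G (of_real (1 - t) * (of_real s * z)))) \<le>
      integral {0..1} (\<lambda>t. A ^ Suc (Suc k) * ?x ^ k / fact k * exp (g * ?x) * (t ^ 0 * (1 - t) ^ k))"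
  proof (rule integral_norm_bound_integral)
    show "(\<lambda>t. F (of_real t * (of_real s * z)) * ?G (of_real (1 - t) * (of_real s * z))) integrable_on {0..1}"
      by (intro integrable_continuous_interval conv_continuous F conv_pow_holomorphic W)
    show "(\<lambda>t. A ^ Suc (Suc k) * ?x ^ k / fact k * exp (g * ?x) * (t ^ 0 * (1 - t) ^ k)) integrable_on {0..1}"
      by (intro integrable_continuous_interval continuous_intros)
    fix t :: real assume t: "t \<in> {0..1}"
    have ts: "t * s \<in> {0..1}" "(1 - t) * s \<in> {0..1}"
      using t Suc.prems by (auto intro!: mult_le_one)
    have eq: "complex_of_real t * (of_real s * z) = of_real (t * s) * z"
      "complex_of_real (1 - t) * (of_real s * z) = of_real ((1 - t) * s) * z"
      by simp_all
    have "cmod (F (of_real t * (of_real s * z)) * ?G (of_real (1 - t) * (of_real s * z))) \<le>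
        (A * exp (g * (t * s * cmod z))) *
        (A ^ Suc k * ((1 - t) * s * cmod z) ^ k / fact k * exp (g * ((1 - t) * s * cmod z)))"
      unfolding norm_mult eq using ts \<open>A \<ge> 0\<close>
      by (intro mult_mono bound Suc.IH) auto
    also have "\<dots> = A ^ Suc (Suc k) * ?x ^ k / fact k * (exp (g * (t * s * cmod z)) * exp (g * ((1 - t) * s * cmod z))) * (1 - t) ^ k"
      by (simp add: power_mult_distrib mult_ac)
    also have "exp (g * (t * s * cmod z)) * exp (g * ((1 - t) * s * cmod z)) = exp (g * ?x)"
      by (simp add: algebra_simps flip: exp_add)
    finally show "cmod (F (of_real t * (of_real s * z)) * ?G (of_real (1 - t) * (of_real s * z))) \<le>
        A ^ Suc (Suc k) * ?x ^ k / fact k * exp (g * ?x) * (t ^ 0 * (1 - t) ^ k)"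
      by simp
  qed
  also have "\<dots> = A ^ Suc (Suc k) * ?x ^ k / fact k * exp (g * ?x) * (fact 0 * fact k / fact (0 + k + 1))"
    by (intro integral_unique has_integral_mult_right has_integral_beta_nat)
  finally have I: "cmod (integral {0..1} (\<lambda>t. F (of_real t * (of_real s * z)) * ?G (of_real (1 - t) * (of_real s * z)))) \<le>
    A ^ Suc (Suc k) * ?x ^ k / fact k * exp (g * ?x) * (fact 0 * fact k / fact (0 + k + 1))" .
  have "cmod (conv_pow F (Suc k) (of_real s * z)) \<le>
      ?x * (A ^ Suc (Suc k) * ?x ^ k / fact k * exp (g * ?x) * (fact 0 * fact k / fact (0 + k + 1)))"
    using Suc.prems mult_left_mono[OF I, of ?x] by (simp add: conv_def norm_mult del: fact_Suc)
  also have "\<dots> = A ^ Suc (Suc k) * ?x ^ Suc k / fact (Suc k) * exp (g * ?x)"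
    by (simp del: fact_Suc)
  finally show ?case .
qed

text \<open>The substitution t = x s leads from the parameter interval to the convolution on the
  half-line; the remaining factor \<open>w\<close> is d\<zeta> / dt.\<close>

lemma conv_ray:
  assumes F: "F holomorphic_on W" and G: "G holomorphic_on W" and x: "x > 0" "of_real x * w \<in> W"
  shows "conv F G (of_real x * w) = w * (LBINT t:{0<..<x}. F (of_real t * w) * G (of_real (x - t) * w))"
proof -
  let ?h = "\<lambda>t. F (of_real t * w) * G (of_real (x - t) * w)"
  have W: "of_real t * w \<in> W" if "t \<in> {0..x}" for t
    using star[OF x(2), of "t / x"] that x(1) by (simp add: field_simps)
  have cont: "continuous_on {0..x} ?h"
  proof (intro continuous_intros continuous_on_compose2[OF holomorphic_on_imp_continuous_on[OF F]]
      continuous_on_compose2[OF holomorphic_on_imp_continuous_on[OF G]])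
    show "(\<lambda>t. of_real (x - t) * w) ` {0..x} \<subseteq> W" using W[of "x - _"] by fastforce
  qed (use W in auto)
  have "set_integrable lborel {0<..<x} ?h"
    by (rule set_integrable_subset[OF borel_integrable_atLeastAtMost'[OF cont]]) auto
  then have "(LBINT t:{0<..<x}. ?h t) = integral {0..x} ?h"
    by (simp add: set_borel_integral_eq_integral integral_open_interval_real)
  moreover have "((\<lambda>s. ?h (x * s)) has_integral (1 / \<bar>x\<bar>) *\<^sub>R integral {0..x} ?h) ((\<lambda>s. s / x) ` {0..x})"
    using x by (intro has_integral_stretch_real integrable_integral integrable_continuous_interval cont) auto
  moreover have "(\<lambda>s. s / x) ` {0..x} = {0..1}"
    using x by (auto simp: image_iff field_simps intro!: bexI[of _ "x * _"])
  ultimately have "integral {0..1} (\<lambda>s. ?h (x * s)) = (1 / x) *\<^sub>R (LBINT t:{0<..<x}. ?h t)"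
    using x by (simp add: integral_unique)
  moreover have "(\<lambda>s. ?h (x * s)) = (\<lambda>s. F (of_real s * (of_real x * w)) * G (of_real (1 - s) * (of_real x * w)))"
    by (simp add: fun_eq_iff algebra_simps)
  ultimately show ?thesis
    using x by (simp add: conv_def scaleR_conv_of_real)
qed

end

section \<open>The Lagrange series of convolution powers as a holomorphic function\<close>

definition lagrange_sum :: "(complex \<Rightarrow> complex) \<Rightarrow> complex \<Rightarrow> complex"
  where "lagrange_sum F z = (\<Sum>k. z ^ k / fact (Suc k) * conv_pow F k z)"

text \<open>The factor \<open>fps_X ^ k\<close> keeps terms with k > m out of degree m, so the sum
  over all k is finite in each degree.\<close>

definition fps_lagrange_sum :: "complex fps \<Rightarrow> complex fps"
  where "fps_lagrange_sum f =
    Abs_fps (\<lambda>m. \<Sum>k\<le>m. fps_nth (fps_X ^ k * (fps_const (1 / fact (Suc k)) * fps_conv_pow f k)) m)"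

context star_domain
begin

text \<open>Convolution powers at z see only the segment from 0 to z. For z in a closed ball these
  segments fill a compact subset K of W on which F is bounded, and
  \<open>lagrange_series_bound\<close> with exponential rate 0 yields a summable majorant.\<close>

lemma lagrange_sum_uniform:
  assumes F: "F holomorphic_on W" and x: "x \<in> W"
  obtains d where "d > 0" "cball x d \<subseteq> W"
    "uniform_limit (cball x d) (\<lambda>n z. \<Sum>k<n. z ^ k / fact (Suc k) * conv_pow F k z) (lagrange_sum F) sequentially"
proof -
  obtain d where d: "d > 0" "cball x d \<subseteq> W"
    using open_W x open_contains_cball by blast
  define K where "K = (\<lambda>p. of_real (fst p) * snd p) ` ({0..1} \<times> cball x d)"
  have "compact K"
    unfolding K_def by (intro compact_continuous_image continuous_intros compact_Times) auto
  moreover have "K \<subseteq> W" using d star by (auto simp: K_def)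
  then have "continuous_on K F"
    using holomorphic_on_imp_continuous_on[OF F] continuous_on_subset by blast
  ultimately have "bounded (F ` K)"
    using compact_continuous_image compact_imp_bounded by blast
  then obtain C where C: "\<And>w. w \<in> K \<Longrightarrow> cmod (F w) \<le> C" "C > 0"
    unfolding bounded_pos by auto
  define R where "R = cmod x + d"
  have R: "cmod z \<le> R" if "z \<in> cball x d" for z
    using that norm_triangle_ineq2[of z x] by (simp add: R_def dist_norm norm_minus_commute)
  have "R \<ge> 0" using d by (simp add: R_def)
  define M where "M k = cmod (of_real R ^ k / fact (Suc k) * complex_of_real (C ^ Suc k * R ^ k / fact k))" for k
  have "summable M"
    unfolding M_def
    by (rule lagrange_series_bound(1)[of C R _ 0]) (use C \<open>R \<ge> 0\<close> in \<open>auto simp: norm_mult norm_power norm_divide\<close>)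
  moreover have "cmod (z ^ k / fact (Suc k) * conv_pow F k z) \<le> M k" if z: "z \<in> cball x d" for k z
  proof -
    have b: "cmod (F (of_real s * z)) \<le> C * exp (0 * (s * cmod z))" if "s \<in> {0..1}" for s
    proof -
      have "of_real s * z \<in> K"
        using z that unfolding K_def by (intro image_eqI[of _ _ "(s, z)"]) auto
      then show ?thesis using C(1) by simp
    qed
    have "cmod (conv_pow F k (of_real 1 * z)) \<le> C ^ Suc k * (1 * cmod z) ^ k / fact k * exp (0 * (1 * cmod z))"
      by (rule conv_pow_bound[OF F _ _ b]) (use z d C in auto)
    also have "\<dots> \<le> C ^ Suc k * R ^ k / fact k"
      using C R[OF z] by (auto intro!: divide_right_mono mult_left_mono power_mono)
    finally have "cmod (conv_pow F k z) \<le> C ^ Suc k * R ^ k / fact k" by simp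
    then have "cmod z ^ k / fact (Suc k) * cmod (conv_pow F k z) \<le> R ^ k / fact (Suc k) * (C ^ Suc k * R ^ k / fact k)"
      using R[OF z] \<open>R \<ge> 0\<close> by (intro mult_mono divide_right_mono power_mono) auto
    also have "\<dots> = M k"
      using C \<open>R \<ge> 0\<close> by (simp add: M_def norm_mult norm_divide norm_power del: fact_Suc)
    finally show ?thesis by (simp add: norm_mult norm_divide norm_power del: fact_Suc)
  qed
  ultimately have "uniform_limit (cball x d) (\<lambda>n z. \<Sum>k<n. z ^ k / fact (Suc k) * conv_pow F k z) (lagrange_sum F) sequentially"
    unfolding lagrange_sum_def by (intro Weierstrass_m_test) auto
  with d show ?thesis by (rule that)
qed

lemma lagrange_partial_sum_holomorphic:
  assumes "F holomorphic_on W"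
  shows "(\<lambda>z. \<Sum>k<n. z ^ k / fact (Suc k) * conv_pow F k z) holomorphic_on W"
  by (intro holomorphic_intros conv_pow_holomorphic assms) auto

lemma lagrange_sum_holomorphic:
  assumes "F holomorphic_on W"
  shows "lagrange_sum F holomorphic_on W"
proof (rule holomorphic_uniform_sequence[OF open_W])
  show "(\<lambda>z. \<Sum>k<n. z ^ k / fact (Suc k) * conv_pow F k z) holomorphic_on W" for n
    by (rule lagrange_partial_sum_holomorphic[OF assms])
  show "\<exists>d>0. cball x d \<subseteq> W \<and> uniform_limit (cball x d)
      (\<lambda>n z. \<Sum>k<n. z ^ k / fact (Suc k) * conv_pow F k z) (lagrange_sum F) sequentially" if "x \<in> W" for x
    using lagrange_sum_uniform[OF assms that] by blast
qed

text \<open>Taylor coefficients at 0 pass to the locally uniform limit, and coefficient m of the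
  partial sums no longer changes once n > m.\<close>

lemma lagrange_sum_has_fps_expansion:
  assumes F: "F holomorphic_on W" and f: "F has_fps_expansion f"
  shows "lagrange_sum F has_fps_expansion fps_lagrange_sum f"
proof -
  have "lagrange_sum F analytic_on {0}"
    using lagrange_sum_holomorphic[OF F] open_W zero_W analytic_at by blast
  then have exp: "lagrange_sum F has_fps_expansion fps_expansion (lagrange_sum F) 0"
    by (rule analytic_at_imp_has_fps_expansion_0)
  let ?S = "\<lambda>n z. \<Sum>k<n. z ^ k / fact (Suc k) * conv_pow F k z"
  let ?P = "\<lambda>k. fps_X ^ k * (fps_const (1 / fact (Suc k)) * fps_conv_pow f k)"
  obtain d where d: "d > 0" "cball 0 d \<subseteq> W" and ul: "uniform_limit (cball 0 d) ?S (lagrange_sum F) sequentially"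
    using lagrange_sum_uniform[OF F zero_W] by blast
  have "fps_nth (fps_expansion (lagrange_sum F) 0) m = fps_nth (fps_lagrange_sum f) m" for m
  proof -
    have "(\<lambda>n. (deriv ^^ m) (?S n) 0) \<longlonglongrightarrow> (deriv ^^ m) (lagrange_sum F) 0"
    proof (rule higher_deriv_complex_uniform_limit)
      show "uniform_limit (ball 0 d) ?S (lagrange_sum F) sequentially"
        by (rule uniform_limit_on_subset[OF ul]) auto
      show "eventually (\<lambda>n. ?S n holomorphic_on ball 0 d) sequentially"
        using d by (intro always_eventually allI holomorphic_on_subset[OF lagrange_partial_sum_holomorphic[OF F]]) auto
    qed (use d in auto)
    moreover have "(deriv ^^ m) (?S n) 0 = fact m * fps_nth (fps_lagrange_sum f) m" if "n > m" for n
    proof -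
      have "(\<lambda>z. \<Sum>k<n. z ^ k * (1 / fact (Suc k) * conv_pow F k z)) has_fps_expansion (\<Sum>k<n. ?P k)"
        by (intro has_fps_expansion_sum has_fps_expansion_mult has_fps_expansion_cmult_left
            has_fps_expansion_fps_X_power conv_pow_has_fps_expansion f)
      then have "?S n has_fps_expansion (\<Sum>k<n. ?P k)"
        by (simp del: fact_Suc)
      from fps_nth_fps_expansion[OF this, of m]
      have "(deriv ^^ m) (?S n) 0 = fact m * fps_nth (\<Sum>k<n. ?P k) m"
        by (simp del: fact_Suc)
      also have "fps_nth (\<Sum>k<n. ?P k) m = fps_nth (fps_lagrange_sum f) m"
        unfolding fps_sum_nth fps_lagrange_sum_def fps_nth_Abs_fps using that
        by (intro sum.mono_neutral_right) (auto simp: fps_X_power_mult_nth)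
      finally show ?thesis .
    qed
    then have "(\<lambda>n. (deriv ^^ m) (?S n) 0) \<longlonglongrightarrow> fact m * fps_nth (fps_lagrange_sum f) m"
      by (intro tendsto_eventually eventually_mono[OF eventually_gt_at_top[of m]]) auto
    ultimately have "(deriv ^^ m) (lagrange_sum F) 0 = fact m * fps_nth (fps_lagrange_sum f) m"
      by (rule LIMSEQ_unique)
    then show ?thesis
      by (simp add: fps_expansion_def)
  qed
  then show ?thesis using exp by (metis fps_ext)
qed

end

section \<open>Formal Borel transform of the inverse\<close>

abbreviation minor :: "complex fps \<Rightarrow> complex fps"
  where "minor \<phi> \<equiv> snd (formal_borel \<phi>)"

lemma fps_nth_minor: "fps_nth (minor \<phi>) n = fps_nth \<phi> (Suc n) / fact n"
  by (simp add: formal_borel_def)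

lemma minor_const_add: "minor (fps_const c + \<phi>) = minor \<phi>"
  by (simp add: formal_borel_def)

lemma minor_const_mult: "minor (fps_const c * a) = fps_const c * minor a"
  by (rule fps_ext) (simp add: fps_nth_minor)

lemma minor_ddz: "minor (ddz a) = - fps_X * minor a"
proof (rule fps_ext)
  show "fps_nth (minor (ddz a)) n = fps_nth (- fps_X * minor a) n" for n
    by (cases n) (simp_all add: fps_nth_minor fps_nth_ddz del: of_nat_Suc)
qed

lemma minor_ddz_funpow: "minor ((ddz ^^ p) a) = (- fps_X) ^ p * minor a"
  by (induction p) (simp_all add: minor_ddz mult.assoc)

text \<open>With vanishing constant terms neither factor has a \<delta> component, so the product
  becomes a pure convolution.\<close>

lemma minor_mult:
  assumes "fps_nth a 0 = 0" "fps_nth b 0 = 0"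
  shows "minor (a * b) = fps_conv (minor a) (minor b)"
proof (rule fps_ext)
  fix n
  have "fps_nth (a * b) (Suc n) = (\<Sum>j\<in>{0..Suc n}. fps_nth a j * fps_nth b (Suc n - j))"
    by (rule fps_mult_nth)
  also have "\<dots> = (\<Sum>j\<in>Suc ` {..<n}. fps_nth a j * fps_nth b (Suc n - j))"
  proof (rule sum.mono_neutral_right)
    show "\<forall>j\<in>{0..Suc n} - Suc ` {..<n}. fps_nth a j * fps_nth b (Suc n - j) = 0"
    proof
      fix j assume j: "j \<in> {0..Suc n} - Suc ` {..<n}"
      then have "j = 0 \<or> j = Suc n"
        by (cases j) auto
      then show "fps_nth a j * fps_nth b (Suc n - j) = 0" using assms by auto
    qed
  qed auto
  also have "\<dots> = (\<Sum>i<n. fps_nth a (Suc i) * fps_nth b (n - i))"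
    by (subst sum.reindex) auto
  also have "\<dots> / fact n = fps_nth (fps_conv (minor a) (minor b)) n"
    unfolding sum_divide_distrib fps_conv_def fps_nth_Abs_fps fps_nth_minor
  proof (rule sum.cong[OF refl])
    fix i assume "i \<in> {..<n}"
    then have "Suc (n - 1 - i) = n - i" by auto
    then show "fps_nth a (Suc i) * fps_nth b (n - i) / fact n =
       fps_nth a (Suc i) / fact i * (fps_nth b (Suc (n - 1 - i)) / fact (n - 1 - i)) *
         (fact i * fact (n - 1 - i) / fact n)" by simp
  qed
  finally show "fps_nth (minor (a * b)) n = fps_nth (fps_conv (minor a) (minor b)) n"
    by (simp add: fps_nth_minor)
qed

lemma minor_power:
  assumes "fps_nth a 0 = 0"
  shows "minor (a ^ Suc k) = fps_conv_pow (minor a) k"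
proof (induction k)
  case (Suc k)
  have "minor (a ^ Suc (Suc k)) = minor (a * a ^ Suc k)" by simp
  also have "\<dots> = fps_conv (minor a) (minor (a ^ Suc k))"
    using assms by (intro minor_mult) auto
  finally show ?case using Suc by simp
qed simp

text \<open>Term k + 1 of the Lagrange series has the sign (-1)^(k+1), and its k derivatives
  contribute (-1)^k; together they give -1 for every k.\<close>

lemma minor_lagrange_inverse:
  assumes "fps_nth \<phi> 0 = 0"
  shows "minor (lagrange_inverse \<phi>) = - fps_lagrange_sum (minor \<phi>)"
proof (rule fps_ext)
  fix n
  let ?P = "\<lambda>k. fps_X ^ k * (fps_const (1 / fact (Suc k)) * fps_conv_pow (minor \<phi>) k)"
  have summand: "minor (lagrange_term \<phi> (Suc k)) = - ?P k" for k
  proof -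
    have "minor (lagrange_term \<phi> (Suc k)) =
        fps_const ((-1) ^ Suc k / fact (Suc k)) * ((- fps_X) ^ k * fps_conv_pow (minor \<phi>) k)"
      unfolding lagrange_term_def minor_const_mult diff_Suc_1 minor_ddz_funpow minor_power[OF assms] ..
    also have "(- fps_X) ^ k = fps_const ((-1) ^ k) * (fps_X ^ k :: complex fps)"
      by (metis fps_const_1_eq_1 fps_const_neg fps_const_power power_minus)
    also have "fps_const ((-1) ^ Suc k / fact (Suc k)) * (fps_const ((-1) ^ k) * fps_X ^ k * fps_conv_pow (minor \<phi>) k)
        = (fps_const ((-1) ^ Suc k / fact (Suc k)) * fps_const ((-1) ^ k)) * (fps_X ^ k * fps_conv_pow (minor \<phi>) k)"
      by (simp only: mult_ac)
    also have "fps_const ((-1) ^ Suc k / fact (Suc k)) * fps_const ((-1) ^ k) = (- fps_const (1 / fact (Suc k)) :: complex fps)"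
      by (simp del: fact_Suc flip: power_add)
    finally show ?thesis by (simp only: mult_ac mult_minus_left mult_minus_right)
  qed
  have "fps_nth (lagrange_inverse \<phi>) (Suc n) = (\<Sum>k=1..Suc (Suc n). fps_nth (lagrange_term \<phi> k) (Suc n))"
    by (rule fps_nth_lagrange_inverse) simp
  also have "{1..Suc (Suc n)} = Suc ` {..Suc n}"
    by (auto simp: image_iff) (metis Suc_le_D Suc_le_mono atMost_iff)
  finally have "fps_nth (minor (lagrange_inverse \<phi>)) n = (\<Sum>k\<le>Suc n. fps_nth (minor (lagrange_term \<phi> (Suc k))) n)"
    by (simp add: fps_nth_minor sum.reindex sum_divide_distrib del: sum.atMost_Suc)
  also have "\<dots> = - (\<Sum>k\<le>Suc n. fps_nth (?P k) n)"
    unfolding summand by (simp add: sum_negf del: sum.atMost_Suc fact_Suc)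
  \<comment> \<open>The term k = n + 1 has order above n.\<close>
  also have "(\<Sum>k\<le>Suc n. fps_nth (?P k) n) = (\<Sum>k\<le>n. fps_nth (?P k) n)"
    by (simp add: fps_X_power_mult_nth)
  finally show "fps_nth (minor (lagrange_inverse \<phi>)) n = fps_nth (- fps_lagrange_sum (minor \<phi>)) n"
    by (simp add: fps_lagrange_sum_def del: fact_Suc)
qed

text \<open>In Taylor's formula for the shift by - \<sigma> each derivative becomes a factor -
  \<zeta>; the signs cancel and the exponential series of \<sigma> \<zeta> remains.\<close>

lemma minor_id_plus_comp_const:
  "minor (id_plus_comp H (fps_const (- \<sigma>))) = fps_exp \<sigma> * minor H"
proof -
  have summand: "minor (comp_summand H (fps_const (- \<sigma>)) p) = fps_const (\<sigma> ^ p / fact p) * (fps_X ^ p * minor H)" for p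
  proof -
    have "comp_summand H (fps_const (- \<sigma>)) p = fps_const ((- \<sigma>) ^ p / fact p) * (ddz ^^ p) H"
      by (simp add: comp_summand_def fps_const_power)
    then have "minor (comp_summand H (fps_const (- \<sigma>)) p) = fps_const ((- \<sigma>) ^ p / fact p) * ((- fps_X) ^ p * minor H)"
      by (simp only: minor_const_mult minor_ddz_funpow)
    also have "(- fps_X) ^ p = fps_const ((-1) ^ p) * (fps_X ^ p :: complex fps)"
      by (metis fps_const_1_eq_1 fps_const_neg fps_const_power power_minus)
    also have "fps_const ((- \<sigma>) ^ p / fact p) * (fps_const ((-1) ^ p) * fps_X ^ p * minor H) =
        (fps_const ((- \<sigma>) ^ p / fact p) * fps_const ((-1) ^ p)) * (fps_X ^ p * minor H)"
      by (simp only: mult_ac)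
    also have "fps_const ((- \<sigma>) ^ p / fact p) * fps_const ((-1) ^ p) = fps_const (\<sigma> ^ p / fact p)"
    proof -
      have "(- \<sigma>) ^ p / fact p * (-1) ^ p = \<sigma> ^ p / fact p"
        by (simp flip: power_mult_distrib)
      then show ?thesis by simp
    qed
    finally show ?thesis .
  qed
  show ?thesis
  proof (rule fps_ext)
    fix n
    have "fps_nth (minor (id_plus_comp H (fps_const (- \<sigma>)))) n =
        (\<Sum>p\<le>Suc n. fps_nth (minor (comp_summand H (fps_const (- \<sigma>)) p)) n)"
      by (simp add: id_plus_comp_def fps_nth_minor fps_nth_suminf_comp_summand[of "Suc n" "Suc n"] sum_divide_distrib
          del: sum.atMost_Suc)
    also have "\<dots> = (\<Sum>p\<le>n. \<sigma> ^ p / fact p * fps_nth (minor H) (n - p))"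
      unfolding summand by (simp add: fps_X_power_mult_nth)
    also have "\<dots> = fps_nth (fps_exp \<sigma> * minor H) n"
      by (simp add: fps_mult_nth atLeast0AtMost)
    finally show "fps_nth (minor (id_plus_comp H (fps_const (- \<sigma>)))) n = fps_nth (fps_exp \<sigma> * minor H) n" .
  qed
qed

lemma fps_nth_0_id_plus_comp: "fps_nth (id_plus_comp H \<eta>) 0 = fps_nth \<eta> 0 + fps_nth H 0"
  by (simp add: id_plus_comp_eq)

lemma fps_nth_0_lagrange_inverse: "fps_nth (lagrange_inverse \<phi>) 0 = - fps_nth \<phi> 0"
  by (simp add: lagrange_inverse_def lagrange_term_def)

section \<open>Sectors and rotation of the direction\<close>

lemma sectorI: "\<xi> > 0 \<Longrightarrow> \<theta> \<in> I \<Longrightarrow> of_real \<xi> * cis \<theta> \<in> sector I"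
  by (auto simp: sector_def)

text \<open>Near direction \<theta> the plane is rotated by - \<theta>, so that the ray becomes the
  positive axis and \<theta> + Im (Ln w) is a continuous choice of the argument. This avoids the
  branch cut of \<open>Ln\<close>, which the sector may cross.\<close>

lemma open_sector:
  assumes "open I"
  shows "open (sector I)"
proof -
  let ?U = "\<lambda>\<theta>. {w. Re w > 0} \<inter> (\<lambda>w. \<theta> + Im (Ln w)) -` I"
  have "open (?U \<theta>)" for \<theta>
  proof (rule continuous_open_preimage)
    have "w \<notin> \<real>\<^sub>\<le>\<^sub>0" if "Re w > 0" for w
      using that by (auto simp: complex_nonpos_Reals_iff)
    then show "continuous_on {w. Re w > 0} (\<lambda>w. \<theta> + Im (Ln w))"
      by (intro continuous_intros) auto
  qed (use assms in \<open>auto simp: open_halfspace_Re_gt\<close>)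
  then have op: "open ((\<lambda>z. z * cis (- \<theta>)) -` ?U \<theta>)" for \<theta>
    by (intro continuous_open_vimage) (auto intro!: continuous_intros)
  have "sector I = (\<Union>\<theta>\<in>I. (\<lambda>z. z * cis (- \<theta>)) -` ?U \<theta>)"
  proof (intro Set.set_eqI iffI)
    fix z assume "z \<in> sector I"
    then obtain \<xi> \<theta> where z: "z = of_real \<xi> * cis \<theta>" "\<xi> > 0" "\<theta> \<in> I"
      by (auto simp: sector_def)
    then have eq: "z * cis (- \<theta>) = of_real \<xi>" by (simp add: mult.assoc cis_mult)
    have "z \<in> (\<lambda>z. z * cis (- \<theta>)) -` ?U \<theta>"
      unfolding vimage_def mem_Collect_eq Int_iff eq using z by (simp add: Ln_of_real)
    with z(3) show "z \<in> (\<Union>\<theta>\<in>I. (\<lambda>z. z * cis (- \<theta>)) -` ?U \<theta>)" by blast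
  next
    fix z assume "z \<in> (\<Union>\<theta>\<in>I. (\<lambda>z. z * cis (- \<theta>)) -` ?U \<theta>)"
    then obtain \<theta> where \<theta>: "\<theta> \<in> I" "Re (z * cis (- \<theta>)) > 0" "\<theta> + Im (Ln (z * cis (- \<theta>))) \<in> I"
      by auto
    define w where "w = z * cis (- \<theta>)"
    have "w \<noteq> 0" using \<theta>(2) by (auto simp: w_def)
    then have w_eq: "w = of_real (exp (Re (Ln w))) * cis (Im (Ln w))"
      using exp_eq_polar[of "Ln w"] by (simp add: of_real_exp)
    have zw: "z = w * cis \<theta>" by (simp add: w_def mult.assoc cis_mult)
    have z_eq: "z = of_real (exp (Re (Ln w))) * cis (\<theta> + Im (Ln w))"
      by (subst zw, subst (1) w_eq) (simp only: mult.assoc cis_mult add.commute)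
    show "z \<in> sector I"
      by (subst z_eq, rule sectorI) (use \<theta>(3) in \<open>auto simp: w_def\<close>)
  qed
  then show ?thesis using op by auto
qed

lemma connected_sector:
  assumes "is_interval I"
  shows "connected (sector I)"
proof -
  have "sector I = (\<lambda>p. of_real (fst p) * cis (snd p)) ` ({0<..} \<times> I)"
    by (force simp: sector_def image_iff)
  also have "connected \<dots>"
    using assms by (intro connected_continuous_image connected_Times continuous_intros)
      (auto simp: is_interval_connected_1[symmetric])
  finally show ?thesis .
qed

lemma zero_notin_sector: "0 \<notin> sector I"
  by (auto simp: sector_def)

lemma sector_scale: "z \<in> sector I \<Longrightarrow> s > 0 \<Longrightarrow> of_real s * z \<in> sector I"
  unfolding sector_def by (smt (verit, best) mem_Collect_eq mult.assoc mult_pos_pos of_real_mult)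

lemma extends_to_sector_agree:
  assumes "extends_to_sector I \<psi> F"
  shows "\<exists>e>0. ereal e \<le> fps_conv_radius \<psi> \<and> (\<forall>\<zeta>\<in>sector I. cmod \<zeta> < e \<longrightarrow> F \<zeta> = eval_fps \<psi> \<zeta>)"
proof -
  from assms have "\<forall>\<^sub>F \<zeta> in at 0 within sector I. F \<zeta> = eval_fps \<psi> \<zeta>"
    by (simp add: extends_to_sector_def)
  then obtain d where d: "d > 0" "\<And>\<zeta>. \<zeta> \<in> sector I \<Longrightarrow> \<zeta> \<noteq> 0 \<Longrightarrow> dist \<zeta> 0 < d \<Longrightarrow> F \<zeta> = eval_fps \<psi> \<zeta>"
    unfolding eventually_at by auto
  have "fps_conv_radius \<psi> > 0" using assms by (simp add: extends_to_sector_def)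
  then obtain r where r: "r > 0" "ereal r < fps_conv_radius \<psi>"
    using ereal_dense2 by (metis ereal_less(2) zero_ereal_def ereal_less_eq(3) less_ereal.simps(1))
  show ?thesis
  proof (intro exI[of _ "min d r"] conjI ballI impI)
    have "ereal (min d r) \<le> ereal r" by simp
    with r show "ereal (min d r) \<le> fps_conv_radius \<psi>" by (meson less_imp_le order_trans)
    show "F \<zeta> = eval_fps \<psi> \<zeta>" if "\<zeta> \<in> sector I" "cmod \<zeta> < min d r" for \<zeta>
      using d(2)[of \<zeta>] that zero_notin_sector by auto
  qed (use d r in auto)
qed

text \<open>The identity theorem applies: the sector is connected, and it meets every disc about 0,
  in particular one where both functions are the sum of the series.\<close>

lemma extends_to_sector_unique:
  assumes I: "open I" "is_interval I"
    and F: "extends_to_sector I \<psi> F" and G: "extends_to_sector I \<psi> G" and z: "z \<in> sector I"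
  shows "F z = G z"
proof -
  obtain e where e: "e > 0" "ereal e \<le> fps_conv_radius \<psi>"
      "\<And>\<zeta>. \<zeta> \<in> sector I \<Longrightarrow> cmod \<zeta> < e \<Longrightarrow> F \<zeta> = eval_fps \<psi> \<zeta>"
    using extends_to_sector_agree[OF F] by blast
  obtain d where d: "d > 0" "ereal d \<le> fps_conv_radius \<psi>"
      "\<And>\<zeta>. \<zeta> \<in> sector I \<Longrightarrow> cmod \<zeta> < d \<Longrightarrow> G \<zeta> = eval_fps \<psi> \<zeta>"
    using extends_to_sector_agree[OF G] by blast
  show ?thesis
  proof (rule analytic_continuation_open[where s = "sector I \<inter> ball 0 (min e d)" and s' = "sector I"
        and f = F and g = G])
    obtain \<theta> where "\<theta> \<in> I" using z by (auto simp: sector_def)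
    define m where "m = min e d"
    have "m > 0" using e d by (simp add: m_def)
    then have "of_real (m / 2) * cis \<theta> \<in> sector I"
      using \<open>\<theta> \<in> I\<close> by (intro sectorI) auto
    moreover have "of_real (m / 2) * cis \<theta> \<in> ball 0 (min e d)"
      using \<open>m > 0\<close> by (simp only: mem_ball_0 norm_mult norm_of_real norm_cis flip: m_def)
    ultimately show "sector I \<inter> ball 0 (min e d) \<noteq> {}" by blast
  qed (use assms e d open_sector connected_sector in \<open>auto simp: extends_to_sector_def\<close>)
qed

text \<open>Makes the choice operator in \<open>sector_extension\<close> harmless.\<close>

lemma sector_extension_eq:
  assumes I: "open I" "is_interval I" and F: "extends_to_sector I \<psi> F" and "z \<in> sector I"
  shows "sector_extension I \<psi> z = F z"
proof -
  have "extends_to_sector I \<psi> (sector_extension I \<psi>)"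
    unfolding sector_extension_def by (rule someI[of _ F]) (rule F)
  then show ?thesis using assms extends_to_sector_unique by blast
qed

text \<open>The sector misses 0, where convolutions start. It is glued to a disc so small that F
  agrees with the series on the overlap; the union is star-shaped about 0.\<close>

lemma extends_to_starlike:
  assumes "open I" and F: "extends_to_sector I \<psi> F"
  obtains W G where "star_domain W" "sector I \<subseteq> W" "G holomorphic_on W" "G has_fps_expansion \<psi>"
    "\<And>\<zeta>. \<zeta> \<in> sector I \<Longrightarrow> G \<zeta> = F \<zeta>"
proof -
  obtain e where e: "e > 0" "ereal e \<le> fps_conv_radius \<psi>"
    "\<And>\<zeta>. \<zeta> \<in> sector I \<Longrightarrow> cmod \<zeta> < e \<Longrightarrow> F \<zeta> = eval_fps \<psi> \<zeta>"
    using extends_to_sector_agree[OF F] by blast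
  define W where "W = ball 0 e \<union> sector I"
  define G where "G \<zeta> = (if \<zeta> \<in> ball 0 e then eval_fps \<psi> \<zeta> else F \<zeta>)" for \<zeta>
  have "star_domain W"
  proof
    show "open W" using open_sector assms by (auto simp: W_def)
    show "0 \<in> W" using e by (simp add: W_def)
    fix z and s :: real assume z: "z \<in> W" and s: "s \<in> {0..1}"
    show "of_real s * z \<in> W"
    proof (cases "z \<in> ball 0 e")
      case True
      have "s * cmod z \<le> 1 * cmod z" using s by (intro mult_right_mono) auto
      with True s show ?thesis by (simp add: W_def norm_mult)
    next
      case False
      then have "z \<in> sector I" using z by (simp add: W_def)
      then show ?thesis
        using s e sector_scale[of z I s] by (cases "s = 0") (auto simp: W_def)
    qed
  qed
  moreover have "G holomorphic_on W"
    unfolding W_def G_def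
  proof (rule holomorphic_on_If_Un)
    have "(ball 0 e :: complex set) \<subseteq> eball 0 (fps_conv_radius \<psi>)"
    proof
      fix x :: complex assume "x \<in> ball 0 e"
      then have "ereal (cmod x) < ereal e" by simp
      also note e(2)
      finally show "x \<in> eball 0 (fps_conv_radius \<psi>)" by (simp add: in_eball_iff)
    qed
    then show "eval_fps \<psi> holomorphic_on ball 0 e"
      by (intro holomorphic_on_eval_fps)
    show "F holomorphic_on sector I" using F by (simp add: extends_to_sector_def)
  qed (use e open_sector assms in auto)
  moreover have "eventually (\<lambda>\<zeta>. \<zeta> \<in> ball 0 e) (nhds 0)"
    using e by (intro eventually_nhds_in_open) auto
  then have "G has_fps_expansion \<psi>"
    using F unfolding has_fps_expansion_def extends_to_sector_def
    by (auto elim!: eventually_mono simp: G_def)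
  ultimately show ?thesis
    using e by (intro that[of W G]) (auto simp: W_def G_def)
qed

text \<open>Used for the Borel transform of \<phi> and again for that of the inverse
  (\<open>sector_function_inverse\<close>), so that directions are compared by one argument.\<close>

locale sector_function = star_domain W for W +
  fixes I :: "real set" and \<gamma> \<alpha> :: "real \<Rightarrow> real" and G :: "complex \<Rightarrow> complex"
  assumes I_open: "open I" and I_interval: "is_interval I" and sector_W: "sector I \<subseteq> W"
    and G_holo: "G holomorphic_on W"
    and G_bound: "\<theta> \<in> I \<Longrightarrow> \<xi> > 0 \<Longrightarrow> cmod (G (of_real \<xi> * cis \<theta>)) \<le> \<alpha> \<theta> * exp (\<gamma> \<theta> * \<xi>)"
    and \<gamma>_bounded: "locally_bounded_on I \<gamma>" and \<alpha>_bounded: "locally_bounded_on I \<alpha>"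
begin

lemma ray_in_W: "\<theta> \<in> I \<Longrightarrow> t \<ge> 0 \<Longrightarrow> of_real t * cis \<theta> \<in> W"
  using sector_W zero_W sectorI[of t \<theta> I] by (cases "t = 0") auto

lemma ray_continuous: "\<theta> \<in> I \<Longrightarrow> g holomorphic_on W \<Longrightarrow> continuous_on {0..} (\<lambda>t. g (of_real t * cis \<theta>))"
  by (intro continuous_on_compose2[OF holomorphic_on_imp_continuous_on[of g W]] continuous_intros)
     (auto intro: ray_in_W)

lemma ray_meas:
  assumes "\<theta> \<in> I" "g holomorphic_on W"
  shows "set_borel_measurable borel {0<..} (\<lambda>t. g (of_real t * cis \<theta>))"
  unfolding set_borel_measurable_def
  by (rule borel_measurable_continuous_on_indicator)
     (auto intro: continuous_on_subset[OF ray_continuous[OF assms]])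

text \<open>The end point is added by continuity, because \<open>conv_pow_bound\<close> asks for the
  bound on a closed segment from 0.\<close>

lemma G_bound0:
  assumes "\<theta> \<in> I" "t \<ge> 0"
  shows "cmod (G (of_real t * cis \<theta>)) \<le> \<alpha> \<theta> * exp (\<gamma> \<theta> * t)"
proof -
  have "cmod (G (of_real t * cis \<theta>)) - \<alpha> \<theta> * exp (\<gamma> \<theta> * t) \<le> 0"
  proof (rule continuous_le_on_closure[of "{0<..}" "\<lambda>t. cmod (G (of_real t * cis \<theta>)) - \<alpha> \<theta> * exp (\<gamma> \<theta> * t)"])
    show "continuous_on (closure {0<..}) (\<lambda>t. cmod (G (of_real t * cis \<theta>)) - \<alpha> \<theta> * exp (\<gamma> \<theta> * t))"
      using ray_continuous[OF assms(1) G_holo] by (auto intro!: continuous_intros)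
  qed (use assms G_bound in auto)
  then show ?thesis by simp
qed

lemma ray_laplaceable: "\<theta> \<in> I \<Longrightarrow> laplaceable (\<gamma> \<theta>) (\<lambda>t. G (of_real t * cis \<theta>))"
  by (rule laplaceable_bounded(1)[OF ray_meas[OF _ G_holo]]) (auto intro: G_bound)

definition ray_integral :: "real \<Rightarrow> complex \<Rightarrow> complex"
  where "ray_integral \<theta> z = laplace (\<lambda>t. G (of_real t * cis \<theta>)) (z * cis \<theta>) * cis \<theta>"

lemma ray_integral_holomorphic:
  assumes "\<theta> \<in> I"
  shows "ray_integral \<theta> holomorphic_on half_plane \<theta> (\<gamma> \<theta>)"
proof -
  have "(\<lambda>z. laplace (\<lambda>t. G (of_real t * cis \<theta>)) (z * cis \<theta>)) holomorphic_on half_plane \<theta> (\<gamma> \<theta>)"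
    by (rule holomorphic_on_compose_gen[OF _ laplace_holomorphic[OF ray_laplaceable[OF assms]], unfolded o_def])
       (auto intro!: holomorphic_intros simp: half_plane_def)
  then show ?thesis
    unfolding ray_integral_def by (intro holomorphic_intros)
qed

text \<open>Expresses the integral by a primitive P. Rays of different directions share the value P
  0, so they are compared through P at their far ends.\<close>

lemma ray_integral_primitive:
  assumes \<theta>: "\<theta> \<in> I" and z: "z \<in> half_plane \<theta> (\<gamma> \<theta>)"
    and P: "\<And>\<zeta>. \<zeta> \<in> W \<Longrightarrow> (P has_field_derivative exp (- (z * \<zeta>)) * G \<zeta>) (at \<zeta>)"
  shows "((\<lambda>R. P (of_real R * cis \<theta>) - P 0) \<longlongrightarrow> ray_integral \<theta> z) at_top"
proof -
  let ?g = "\<lambda>t. exp (- (z * cis \<theta> * of_real t)) * G (of_real t * cis \<theta>)"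
  have diff: "({0..} - {0<..}) \<union> ({0<..} - {0..}) \<subseteq> {0::real}" by auto
  have "set_integrable lborel {0<..} ?g"
    using laplaceable_integrable[OF ray_laplaceable[OF \<theta>], of "z * cis \<theta>"] z
    by (simp add: set_integrable_def half_plane_def)
  then have int: "set_integrable lborel {0..} ?g"
    by (subst set_integrable_discrete_difference[OF _ diff]) auto
  have "(LBINT t:{0..}. ?g t) = laplace (\<lambda>t. G (of_real t * cis \<theta>)) (z * cis \<theta>)"
    unfolding laplace_def by (rule set_integral_discrete_difference[OF _ diff]) auto
  with tendsto_set_lebesgue_integral_at_top[OF _ int]
  have "((\<lambda>R. LBINT t:{0..R}. ?g t) \<longlongrightarrow> laplace (\<lambda>t. G (of_real t * cis \<theta>)) (z * cis \<theta>)) at_top"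
    by simp
  then have lim: "((\<lambda>R. (LBINT t:{0..R}. ?g t) * cis \<theta>) \<longlongrightarrow> ray_integral \<theta> z) at_top"
    unfolding ray_integral_def by (intro tendsto_intros)
  have "(LBINT t:{0..R}. ?g t) * cis \<theta> = P (of_real R * cis \<theta>) - P 0" if "R \<ge> 0" for R
  proof -
    have "(LBINT t:{0..R}. ?g t * cis \<theta>) = P (of_real R * cis \<theta>) - P (of_real 0 * cis \<theta>)"
      unfolding set_lebesgue_integral_def
    proof (rule integral_FTC_atLeastAtMost[OF that])
      fix t assume "0 \<le> t" "t \<le> R"
      then have 1: "(P has_field_derivative exp (- (z * (of_real t * cis \<theta>))) * G (of_real t * cis \<theta>)) (at (of_real t * cis \<theta>))"
        by (intro P ray_in_W \<theta>)
      have 2: "((\<lambda>t. of_real t * cis \<theta>) has_vector_derivative cis \<theta>) (at t within {0..R})"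
        by (auto intro!: derivative_eq_intros)
      have "((P \<circ> (\<lambda>t. of_real t * cis \<theta>)) has_vector_derivative
          cis \<theta> * (exp (- (z * (of_real t * cis \<theta>))) * G (of_real t * cis \<theta>))) (at t within {0..R})"
        by (rule field_vector_diff_chain_within[OF 2 has_field_derivative_at_within[OF 1]])
      then show "((\<lambda>t. P (of_real t * cis \<theta>)) has_vector_derivative ?g t * cis \<theta>) (at t within {0..R})"
        by (simp add: o_def mult_ac)
    next
      show "continuous_on {0..R} (\<lambda>t. ?g t * cis \<theta>)"
        by (intro continuous_intros continuous_on_subset[OF ray_continuous[OF \<theta> G_holo]]) auto
    qed
    then show ?thesis by simp
  qed
  then have "eventually (\<lambda>R. (LBINT t:{0..R}. ?g t) * cis \<theta> = P (of_real R * cis \<theta>) - P 0) at_top"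
    by (rule eventually_mono[OF eventually_ge_at_top[of 0]])
  then show ?thesis
    using lim by (rule Lim_transform_eventually[rotated])
qed

end

section \<open>Independence of the direction of integration\<close>

lemma locally_bounded_onE:
  assumes "locally_bounded_on I g" "{a..b} \<subseteq> I"
  obtains M where "M > 0" "\<And>x. x \<in> {a..b} \<Longrightarrow> g x \<le> M"
proof -
  have "bounded (g ` {a..b})" using assms by (simp add: locally_bounded_on_def)
  then obtain M where "M > 0" "\<And>x. x \<in> {a..b} \<Longrightarrow> norm (g x) \<le> M"
    unfolding bounded_pos by blast
  then show ?thesis
    by (intro that[of M]) (auto intro: order_trans[OF abs_ge_self])
qed

text \<open>\<open>cis \<theta>\<close> is a combination of \<open>cis \<theta>\<^sub>1\<close> and \<open>cis \<theta>\<^sub>2\<close> with nonnegative coefficients of sum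
  at least \<open>1\<close>.\<close>

lemma half_plane_between:
  assumes "\<theta>\<^sub>1 \<le> \<theta>" "\<theta> \<le> \<theta>\<^sub>2" "\<theta>\<^sub>2 - \<theta>\<^sub>1 < pi" "c \<ge> 0"
    and "z \<in> half_plane \<theta>\<^sub>1 c" "z \<in> half_plane \<theta>\<^sub>2 c"
  shows "Re (z * cis \<theta>) \<ge> c"
proof (cases "\<theta>\<^sub>1 = \<theta>\<^sub>2")
  case True
  then have "\<theta> = \<theta>\<^sub>1" using assms by simp
  with assms show ?thesis by (simp add: half_plane_def)
next
  case False
  define a where "a = sin (\<theta>\<^sub>2 - \<theta>)"
  define b where "b = sin (\<theta> - \<theta>\<^sub>1)"
  define D where "D = sin (\<theta>\<^sub>2 - \<theta>\<^sub>1)"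
  have D: "D > 0" using False assms by (auto simp: D_def intro!: sin_gt_zero)
  have ab: "a \<ge> 0" "b \<ge> 0" using assms by (auto simp: a_def b_def intro!: sin_ge_zero)
  have "D = a * cos (\<theta> - \<theta>\<^sub>1) + cos (\<theta>\<^sub>2 - \<theta>) * b"
    using sin_add[of "\<theta>\<^sub>2 - \<theta>" "\<theta> - \<theta>\<^sub>1"] by (simp add: D_def a_def b_def)
  also have "\<dots> \<le> a * 1 + 1 * b"
    using ab by (intro add_mono mult_left_mono mult_right_mono) auto
  finally have Dab: "D \<le> a + b" by simp
  have "D * cos \<theta> = a * cos \<theta>\<^sub>1 + b * cos \<theta>\<^sub>2" "D * sin \<theta> = a * sin \<theta>\<^sub>1 + b * sin \<theta>\<^sub>2"
    by (simp_all add: D_def a_def b_def sin_diff algebra_simps)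
  then have "D * Re (z * cis \<theta>) = a * Re (z * cis \<theta>\<^sub>1) + b * Re (z * cis \<theta>\<^sub>2)"
    unfolding times_complex.sel cis.sel by algebra
  moreover have "a * c + b * c \<le> a * Re (z * cis \<theta>\<^sub>1) + b * Re (z * cis \<theta>\<^sub>2)"
    using assms ab by (intro add_mono mult_left_mono) (auto simp: half_plane_def)
  moreover have "D * c \<le> (a + b) * c"
    by (rule mult_right_mono[OF Dab assms(4)])
  ultimately have "D * c \<le> D * Re (z * cis \<theta>)"
    by (simp only: distrib_right)
  with D show ?thesis by simp
qed

lemma open_half_plane: "open (half_plane \<theta> c)"
  unfolding half_plane_def by (intro open_Collect_less continuous_intros)

lemma convex_half_plane: "convex (half_plane \<theta> c)"
proof -
  have "half_plane \<theta> c = {z. inner (cis (- \<theta>)) z > c}"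
    by (simp add: half_plane_def inner_complex_def algebra_simps)
  then show ?thesis by (simp add: convex_halfspace_gt)
qed

context sector_function
begin

text \<open>Cauchy's theorem by means of a primitive on the star-shaped W: the two integrals differ
  by the limit of its increment along the arc of radius R. That increment tends to 0 when z lies far
  inside both half-planes, and the identity theorem extends the equality to their convex
  intersection.\<close>

lemma ray_integral_consistent_aux:
  assumes \<theta>: "\<theta>\<^sub>1 \<in> I" "\<theta>\<^sub>2 \<in> I" "\<theta>\<^sub>1 \<le> \<theta>\<^sub>2" "\<theta>\<^sub>2 - \<theta>\<^sub>1 < pi"
    and z: "z \<in> half_plane \<theta>\<^sub>1 (\<gamma> \<theta>\<^sub>1)" "z \<in> half_plane \<theta>\<^sub>2 (\<gamma> \<theta>\<^sub>2)"
  shows "ray_integral \<theta>\<^sub>1 z = ray_integral \<theta>\<^sub>2 z"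
proof -
  have sub: "{\<theta>\<^sub>1..\<theta>\<^sub>2} \<subseteq> I"
    using mem_is_interval_1_I[OF I_interval \<theta>(1,2)] by auto
  \<comment> \<open>Local boundedness is used here: one pair of constants serves the whole compact
    range of directions.\<close>
  obtain M where M: "M > 0" "\<And>\<theta>. \<theta> \<in> {\<theta>\<^sub>1..\<theta>\<^sub>2} \<Longrightarrow> \<gamma> \<theta> \<le> M"
    using locally_bounded_onE[OF \<gamma>_bounded sub] by blast
  obtain A where A: "A > 0" "\<And>\<theta>. \<theta> \<in> {\<theta>\<^sub>1..\<theta>\<^sub>2} \<Longrightarrow> \<alpha> \<theta> \<le> A"
    using locally_bounded_onE[OF \<alpha>_bounded sub] by blast
  let ?U = "half_plane \<theta>\<^sub>1 (\<gamma> \<theta>\<^sub>1) \<inter> half_plane \<theta>\<^sub>2 (\<gamma> \<theta>\<^sub>2)"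
  \<comment> \<open>The margin 1 leaves a factor exp (- R) on the arc against the growth exp (M R)
    of G.\<close>
  let ?V = "half_plane \<theta>\<^sub>1 (M + 1) \<inter> half_plane \<theta>\<^sub>2 (M + 1)"
  show ?thesis
  proof (rule analytic_continuation_open[where s = ?V and s' = ?U and f = "ray_integral \<theta>\<^sub>1" and g = "ray_integral \<theta>\<^sub>2"])
    show "open ?V" "open ?U" by (intro open_Int open_half_plane)+
    show "connected ?U" by (intro convex_connected convex_Int convex_half_plane)
    show "?V \<subseteq> ?U" using M(2)[of \<theta>\<^sub>1] M(2)[of \<theta>\<^sub>2] \<theta> by (auto simp: half_plane_def)
    show "z \<in> ?U" using z by simp
    show "ray_integral \<theta>\<^sub>1 holomorphic_on ?U" "ray_integral \<theta>\<^sub>2 holomorphic_on ?U"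
      using ray_integral_holomorphic \<theta> holomorphic_on_subset by blast+
    show "?V \<noteq> {}"
    proof -
      \<comment> \<open>Witness on the bisecting direction: both real parts equal r cos \<delta> = M
        + 2, and cos \<delta> > 0 because the directions differ by less than \<pi>.\<close>
      define \<delta> where "\<delta> = (\<theta>\<^sub>2 - \<theta>\<^sub>1) / 2"
      have c: "cos \<delta> > 0" using \<theta> by (intro cos_gt_zero_pi) (auto simp: \<delta>_def)
      define r where "r = (M + 2) / cos \<delta>"
      define \<tau> where "\<tau> = - (\<theta>\<^sub>1 + \<theta>\<^sub>2) / 2"
      have "Re (rcis r \<tau> * cis \<theta>) = r * cos (\<tau> + \<theta>)" for \<theta>
        by (simp only: rcis_def mult.assoc cis_mult) simp
      moreover have "\<tau> + \<theta>\<^sub>1 = - \<delta>" "\<tau> + \<theta>\<^sub>2 = \<delta>"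
        by (simp_all add: \<tau>_def \<delta>_def field_simps)
      ultimately have "Re (rcis r \<tau> * cis \<theta>\<^sub>1) = r * cos \<delta>" "Re (rcis r \<tau> * cis \<theta>\<^sub>2) = r * cos \<delta>"
        by simp_all
      then have "rcis r \<tau> \<in> ?V"
        using c by (simp add: half_plane_def r_def)
      then show ?thesis by blast
    qed
    fix z assume z: "z \<in> ?V"
    have "starlike W"
      unfolding starlike_def using zero_W star by (auto simp: closed_segment_def scaleR_conv_of_real intro!: bexI[of _ 0])
    moreover have h: "(\<lambda>\<zeta>. exp (- (z * \<zeta>)) * G \<zeta>) holomorphic_on W"
      by (intro holomorphic_intros G_holo)
    ultimately obtain P where P: "\<And>\<zeta>. \<zeta> \<in> W \<Longrightarrow> (P has_field_derivative exp (- (z * \<zeta>)) * G \<zeta>) (at \<zeta>)"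
      using holomorphic_starlike_primitive[OF holomorphic_on_imp_continuous_on[OF h] _ open_W finite.emptyI]
        holomorphic_on_imp_differentiable_at[OF h open_W] by blast
    have arc: "cmod (P (of_real R * cis \<theta>\<^sub>2) - P (of_real R * cis \<theta>\<^sub>1)) \<le> A * (\<theta>\<^sub>2 - \<theta>\<^sub>1) * (R * exp (- R))"
      if R: "R > 0" for R
    proof -
      let ?d = "\<lambda>\<theta>. of_real R * (\<i> * cis \<theta>) * (exp (- (z * (of_real R * cis \<theta>))) * G (of_real R * cis \<theta>))"
      have int: "(?d has_integral (P (of_real R * cis \<theta>\<^sub>2) - P (of_real R * cis \<theta>\<^sub>1))) {\<theta>\<^sub>1..\<theta>\<^sub>2}"
      proof (rule fundamental_theorem_of_calculus[OF \<theta>(3)])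
        fix \<theta> assume "\<theta> \<in> {\<theta>\<^sub>1..\<theta>\<^sub>2}"
        then have 1: "(P has_field_derivative exp (- (z * (of_real R * cis \<theta>))) * G (of_real R * cis \<theta>)) (at (of_real R * cis \<theta>))"
          using sub R by (intro P ray_in_W) auto
        have 2: "((\<lambda>\<theta>. of_real R * cis \<theta>) has_vector_derivative of_real R * (\<i> * cis \<theta>)) (at \<theta> within {\<theta>\<^sub>1..\<theta>\<^sub>2})"
        proof -
          have "((\<lambda>x. of_real R * exp (\<i> * x)) has_field_derivative of_real R * (\<i> * cis \<theta>)) (at (of_real \<theta>))"
            by (rule derivative_eq_intros refl | simp)+ (simp add: cis_conv_exp)
          then have "((\<lambda>x. of_real R * exp (\<i> * of_real x)) has_vector_derivative of_real R * (\<i> * cis \<theta>)) (at \<theta> within {\<theta>\<^sub>1..\<theta>\<^sub>2})"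
            by (rule has_vector_derivative_real_field)
          then show ?thesis by (simp add: cis_conv_exp)
        qed
        have "((P \<circ> (\<lambda>\<theta>. of_real R * cis \<theta>)) has_vector_derivative ?d \<theta>) (at \<theta> within {\<theta>\<^sub>1..\<theta>\<^sub>2})"
          by (rule field_vector_diff_chain_within[OF 2 has_field_derivative_at_within[OF 1]])
        then show "((\<lambda>\<theta>. P (of_real R * cis \<theta>)) has_vector_derivative ?d \<theta>) (at \<theta> within {\<theta>\<^sub>1..\<theta>\<^sub>2})"
          by (simp add: o_def)
      qed
      have "cmod (P (of_real R * cis \<theta>\<^sub>2) - P (of_real R * cis \<theta>\<^sub>1)) \<le> (A * (R * exp (- R))) * measure lborel {\<theta>\<^sub>1..\<theta>\<^sub>2}"
      proof (rule has_integral_bound_real[OF _ finite.emptyI int])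
        show "0 \<le> A * (R * exp (- R))" using A R by simp
        have "cmod (?d \<theta>) \<le> A * (R * exp (- R))" if t: "\<theta> \<in> {\<theta>\<^sub>1..\<theta>\<^sub>2}" for \<theta>
        proof -
          have "Re (z * cis \<theta>) \<ge> M + 1"
            using z t M \<theta> by (intro half_plane_between[of \<theta>\<^sub>1 \<theta> \<theta>\<^sub>2]) auto
          then have "R * Re (z * cis \<theta>) \<ge> R * (M + 1)" using R by (intro mult_left_mono) auto
          moreover have "Re (z * (of_real R * cis \<theta>)) = R * Re (z * cis \<theta>)" by (simp add: algebra_simps)
          ultimately have 1: "cmod (exp (- (z * (of_real R * cis \<theta>)))) \<le> exp (- (R * (M + 1)))"
            by (simp only: norm_exp_eq_Re uminus_complex.simps exp_le_cancel_iff neg_le_iff_le)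
          have "cmod (G (of_real R * cis \<theta>)) \<le> \<alpha> \<theta> * exp (\<gamma> \<theta> * R)"
            using sub t R by (intro G_bound) auto
          also have "\<dots> \<le> A * exp (M * R)"
            using A M t R by (intro mult_mono) auto
          finally have 2: "cmod (G (of_real R * cis \<theta>)) \<le> A * exp (M * R)" .
          have "cmod (?d \<theta>) = R * (cmod (exp (- (z * (of_real R * cis \<theta>)))) * cmod (G (of_real R * cis \<theta>)))"
            using R by (simp add: norm_mult)
          also have "\<dots> \<le> R * (exp (- (R * (M + 1))) * (A * exp (M * R)))"
            using R 1 2 by (intro mult_left_mono mult_mono) auto
          also have "\<dots> = A * (R * (exp (- (R * (M + 1))) * exp (M * R)))" by simp
          also have "exp (- (R * (M + 1))) * exp (M * R) = exp (- R)"
            by (simp add: algebra_simps flip: exp_add)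
          finally show ?thesis .
        qed
        then show "cmod (?d \<theta>) \<le> A * (R * exp (- R))" if "\<theta> \<in> {\<theta>\<^sub>1..\<theta>\<^sub>2} - {}" for \<theta>
          using that by blast
      qed
      then show ?thesis using \<theta> by (simp add: mult_ac)
    qed
    have V: "z \<in> half_plane \<theta>\<^sub>1 (\<gamma> \<theta>\<^sub>1)" "z \<in> half_plane \<theta>\<^sub>2 (\<gamma> \<theta>\<^sub>2)"
      using z M(2)[of \<theta>\<^sub>1] M(2)[of \<theta>\<^sub>2] \<theta> by (auto simp: half_plane_def)
    have "((\<lambda>R::real. A * (\<theta>\<^sub>2 - \<theta>\<^sub>1) * (R * exp (- R))) \<longlongrightarrow> 0) at_top"
      by real_asymp
    then have "((\<lambda>R. P (of_real R * cis \<theta>\<^sub>2) - P (of_real R * cis \<theta>\<^sub>1)) \<longlongrightarrow> 0) at_top"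
      by (rule Lim_null_comparison[rotated]) (rule eventually_mono[OF eventually_gt_at_top[of 0] arc])
    moreover have "((\<lambda>R. (P (of_real R * cis \<theta>\<^sub>2) - P 0) - (P (of_real R * cis \<theta>\<^sub>1) - P 0)) \<longlongrightarrow> ray_integral \<theta>\<^sub>2 z - ray_integral \<theta>\<^sub>1 z) at_top"
      by (intro tendsto_diff ray_integral_primitive[OF _ _ P] \<theta> V)
    then have "((\<lambda>R. P (of_real R * cis \<theta>\<^sub>2) - P (of_real R * cis \<theta>\<^sub>1)) \<longlongrightarrow> ray_integral \<theta>\<^sub>2 z - ray_integral \<theta>\<^sub>1 z) at_top"
      by simp
    ultimately have "0 = ray_integral \<theta>\<^sub>2 z - ray_integral \<theta>\<^sub>1 z"
      by (rule tendsto_unique[OF trivial_limit_at_top_linorder])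
    then show "ray_integral \<theta>\<^sub>1 z = ray_integral \<theta>\<^sub>2 z" by simp
  qed
qed

lemma ray_integral_consistent:
  assumes "\<theta>\<^sub>1 \<in> I" "\<theta>\<^sub>2 \<in> I" "\<bar>\<theta>\<^sub>1 - \<theta>\<^sub>2\<bar> < pi"
    and "z \<in> half_plane \<theta>\<^sub>1 (\<gamma> \<theta>\<^sub>1)" "z \<in> half_plane \<theta>\<^sub>2 (\<gamma> \<theta>\<^sub>2)"
  shows "ray_integral \<theta>\<^sub>1 z = ray_integral \<theta>\<^sub>2 z"
proof (cases "\<theta>\<^sub>1 \<le> \<theta>\<^sub>2")
  case True
  with assms show ?thesis by (intro ray_integral_consistent_aux) auto
next
  case False
  with assms have "ray_integral \<theta>\<^sub>2 z = ray_integral \<theta>\<^sub>1 z" by (intro ray_integral_consistent_aux) auto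
  then show ?thesis by simp
qed

end

section \<open>The inverse in a fixed direction\<close>

lemma laplace_cong: "(\<And>t. t > 0 \<Longrightarrow> g t = g' t) \<Longrightarrow> laplace g z = laplace g' z"
  unfolding laplace_def by (rule set_lebesgue_integral_cong) auto

definition inverse_minor :: "(complex \<Rightarrow> complex) \<Rightarrow> complex \<Rightarrow> complex \<Rightarrow> complex"
  where "inverse_minor G \<sigma> \<zeta> = - (exp (\<sigma> * \<zeta>) * lagrange_sum G \<zeta>)"

context sector_function
begin

text \<open>In the variable Z = z cis \<theta> the map z + \<phi>(z) is Z plus the Laplace transform
  of \<open>cis \<theta> ^ 2 * G (of_real t * cis \<theta>)\<close>, with one factor from d\<zeta>
  and one from rotating the value. The convolution power of exponent k + 1 has 2 k + 2 such factors,
  k of which are contained in \<open>conv_pow\<close>.\<close>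

definition ray_powers :: "real \<Rightarrow> nat \<Rightarrow> real \<Rightarrow> complex"
  where "ray_powers \<theta> k t = cis \<theta> ^ (k + 2) * conv_pow G k (of_real t * cis \<theta>)"

lemma convolution_powers_ray:
  assumes \<theta>: "\<theta> \<in> I" and "\<alpha> \<theta> \<ge> 0"
  shows "convolution_powers (ray_powers \<theta>) (\<alpha> \<theta>) (\<gamma> \<theta>)"
proof
  show "\<alpha> \<theta> \<ge> 0" by fact
  fix k
  have "(\<lambda>\<zeta>. cis \<theta> ^ (k + 2) * conv_pow G k \<zeta>) holomorphic_on W"
    by (intro holomorphic_intros conv_pow_holomorphic G_holo)
  from ray_meas[OF \<theta> this] show "set_borel_measurable borel {0<..} (ray_powers \<theta> k)"
    by (simp add: ray_powers_def[abs_def])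
  fix x :: real assume x: "x > 0"
  have "ray_powers \<theta> (Suc k) x = cis \<theta> ^ (k + 4) *
      (LBINT t:{0<..<x}. G (of_real t * cis \<theta>) * conv_pow G k (of_real (x - t) * cis \<theta>))"
    using conv_ray[OF G_holo conv_pow_holomorphic[OF G_holo] x ray_in_W[OF \<theta>]] x
    by (simp add: ray_powers_def eval_nat_numeral mult_ac)
  also have "\<dots> = (LBINT t:{0<..<x}. ray_powers \<theta> 0 t * ray_powers \<theta> k (x - t))"
    by (simp add: ray_powers_def eval_nat_numeral mult_ac flip: set_integral_mult_right)
  finally show "ray_powers \<theta> (Suc k) x = (LBINT t:{0<..<x}. ray_powers \<theta> 0 t * ray_powers \<theta> k (x - t))" .
  have "cmod (conv_pow G k (of_real 1 * (of_real x * cis \<theta>))) \<le>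
      \<alpha> \<theta> ^ Suc k * (1 * cmod (of_real x * cis \<theta>)) ^ k / fact k * exp (\<gamma> \<theta> * (1 * cmod (of_real x * cis \<theta>)))"
  proof (rule conv_pow_bound[OF G_holo])
    fix s :: real assume "s \<in> {0..1}"
    with G_bound0[OF \<theta>, of "s * x"] x
    show "cmod (G (of_real s * (of_real x * cis \<theta>))) \<le> \<alpha> \<theta> * exp (\<gamma> \<theta> * (s * cmod (of_real x * cis \<theta>)))"
      by (simp add: norm_mult mult.assoc)
  qed (use x assms ray_in_W in auto)
  then show "cmod (ray_powers \<theta> k x) \<le> \<alpha> \<theta> ^ Suc k * x ^ k / fact k * exp (\<gamma> \<theta> * x)"
    using x by (simp add: ray_powers_def norm_mult norm_power)
qed

lemma ray_powers_E:
  assumes \<theta>: "\<theta> \<in> I" "\<alpha> \<theta> \<ge> 0" and t: "t > 0"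
  shows "convolution_powers.E (ray_powers \<theta>) t = cis \<theta> ^ 2 * lagrange_sum G (of_real t * cis \<theta>)"
proof -
  interpret convolution_powers "ray_powers \<theta>" "\<alpha> \<theta>" "\<gamma> \<theta>"
    by (rule convolution_powers_ray[OF \<theta>])
  let ?a = "\<lambda>k. (of_real t * cis \<theta>) ^ k / fact (Suc k) * conv_pow G k (of_real t * cis \<theta>)"
  have eq: "of_real t ^ k / fact (Suc k) * ray_powers \<theta> k t = cis \<theta> ^ 2 * ?a k" for k
    by (simp add: ray_powers_def power_mult_distrib power_add power2_eq_square mult_ac del: fact_Suc)
  have "summable (\<lambda>k. cmod (of_real t ^ k / fact (Suc k) * ray_powers \<theta> k t))"
    by (rule lagrange_series_bound(1)[OF \<alpha>_nonneg _ A_bound[OF t]]) (use t in auto)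
  then have "summable (\<lambda>k. cis \<theta> ^ 2 * ?a k)"
    unfolding eq by (rule summable_norm_cancel)
  then have "summable ?a"
    by (simp only: summable_cmult_iff) auto
  then show ?thesis
    unfolding E_def lagrange_sum_def eq by (rule suminf_mult)
qed

lemma inverse_minor_bound:
  assumes \<theta>: "\<theta> \<in> I" "\<alpha> \<theta> \<ge> 0" and t: "t > 0"
  shows "cmod (inverse_minor G \<sigma> (of_real t * cis \<theta>)) \<le> \<alpha> \<theta> * exp ((\<gamma> \<theta> + cmod \<sigma> + 2 * sqrt (\<alpha> \<theta>)) * t)"
proof -
  interpret convolution_powers "ray_powers \<theta>" "\<alpha> \<theta>" "\<gamma> \<theta>"
    by (rule convolution_powers_ray[OF \<theta>])
  have "cmod (lagrange_sum G (of_real t * cis \<theta>)) \<le> \<alpha> \<theta> * exp ((\<gamma> \<theta> + 2 * sqrt (\<alpha> \<theta>)) * t)"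
    using E_bound[OF t] ray_powers_E[OF \<theta> t] by (simp add: norm_mult norm_power)
  moreover have "Re (\<sigma> * (of_real t * cis \<theta>)) \<le> cmod \<sigma> * t"
    using complex_Re_le_cmod[of "\<sigma> * (of_real t * cis \<theta>)"] t by (simp add: norm_mult)
  then have "cmod (exp (\<sigma> * (of_real t * cis \<theta>))) \<le> exp (cmod \<sigma> * t)"
    unfolding norm_exp_eq_Re by simp
  ultimately have "cmod (inverse_minor G \<sigma> (of_real t * cis \<theta>)) \<le>
      exp (cmod \<sigma> * t) * (\<alpha> \<theta> * exp ((\<gamma> \<theta> + 2 * sqrt (\<alpha> \<theta>)) * t))"
    unfolding inverse_minor_def norm_minus_cancel norm_mult by (intro mult_mono) auto
  then show ?thesis by (simp add: algebra_simps exp_add)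
qed

lemma inverse_minor_holomorphic: "inverse_minor G \<sigma> holomorphic_on W"
  unfolding inverse_minor_def
  by (intro holomorphic_intros lagrange_sum_holomorphic G_holo)

text \<open>\<sigma> is a parameter independent of G, so that injectivity can be deduced from the
  inverse for \<sigma> = 0.\<close>

definition dir_map :: "complex \<Rightarrow> real \<Rightarrow> complex \<Rightarrow> complex"
  where "dir_map \<sigma> \<theta> z = z + \<sigma> + laplace (\<lambda>t. G (of_real t * cis \<theta>)) (z * cis \<theta>) * cis \<theta>"

definition dir_inverse :: "complex \<Rightarrow> real \<Rightarrow> complex \<Rightarrow> complex"
  where "dir_inverse \<sigma> \<theta> z = z - \<sigma> + laplace (\<lambda>t. inverse_minor G \<sigma> (of_real t * cis \<theta>)) (z * cis \<theta>) * cis \<theta>"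

lemma cis_cancel: "cis \<theta> * cis (- \<theta>) = 1" "cis \<theta> * (cis (- \<theta>) * x) = x" "cis (- \<theta>) * (cis \<theta> * x) = x"
  by (simp_all add: cis_mult flip: mult.assoc)

text \<open>The map is computed in the rotated variable of \<open>ray_powers\<close>; the factor cis
  (- \<theta>) rotates the result back.\<close>

lemma dir_map_eq: "dir_map \<sigma> \<theta> z = z + \<sigma> + cis (- \<theta>) * laplace (ray_powers \<theta> 0) (z * cis \<theta>)"
  by (simp add: dir_map_def ray_powers_def[abs_def] laplace_cmult power2_eq_square mult.assoc cis_cancel mult.commute)

text \<open>The factor exp (\<sigma> \<zeta>) in \<open>inverse_minor\<close> shifts the Laplace
  variable from z to z - \<sigma>: the translation is undone before the inverse of id + \<phi> is
  applied.\<close>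

lemma dir_inverse_eq:
  assumes "\<theta> \<in> I" "\<alpha> \<theta> \<ge> 0"
  shows "dir_inverse \<sigma> \<theta> z = z - \<sigma> - cis (- \<theta>) * laplace (convolution_powers.E (ray_powers \<theta>)) ((z - \<sigma>) * cis \<theta>)"
proof -
  have "laplace (convolution_powers.E (ray_powers \<theta>)) ((z - \<sigma>) * cis \<theta>) =
      laplace (\<lambda>t. cis \<theta> ^ 2 * lagrange_sum G (of_real t * cis \<theta>)) ((z - \<sigma>) * cis \<theta>)"
    by (rule laplace_cong) (simp add: ray_powers_E assms)
  also have "\<dots> = cis \<theta> ^ 2 * laplace (\<lambda>t. lagrange_sum G (of_real t * cis \<theta>)) ((z - \<sigma>) * cis \<theta>)"
    by (rule laplace_cmult)
  also have "laplace (\<lambda>t. lagrange_sum G (of_real t * cis \<theta>)) ((z - \<sigma>) * cis \<theta>) =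
      laplace (\<lambda>t. - inverse_minor G \<sigma> (of_real t * cis \<theta>)) (z * cis \<theta>)"
    unfolding laplace_def by (rule set_lebesgue_integral_cong) (auto simp: inverse_minor_def algebra_simps simp flip: exp_add)
  also have "\<dots> = - laplace (\<lambda>t. inverse_minor G \<sigma> (of_real t * cis \<theta>)) (z * cis \<theta>)"
    using laplace_cmult[of "-1" "\<lambda>t. inverse_minor G \<sigma> (of_real t * cis \<theta>)" "z * cis \<theta>"] by simp
  finally show ?thesis
    by (simp add: dir_inverse_def power2_eq_square mult.assoc cis_cancel mult.commute)
qed

text \<open>In the rotated variable the map changes the real part by at most |\<sigma>| + (sqrt 2 -
  1) s, where s = sqrt \<alpha>. Out of 2 |\<sigma>| + (1 + sqrt 2) s above \<gamma> this leaves
  |\<sigma>| + 2 s, the threshold for the inverse.\<close>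

lemma dir_inverse_dir_map:
  assumes \<theta>: "\<theta> \<in> I" "\<alpha> \<theta> \<ge> 0"
    and z: "z \<in> half_plane \<theta> (\<gamma> \<theta> + 2 * cmod \<sigma> + (1 + sqrt 2) * sqrt (\<alpha> \<theta>))"
  shows "dir_map \<sigma> \<theta> z \<in> half_plane \<theta> (\<gamma> \<theta> + cmod \<sigma> + 2 * sqrt (\<alpha> \<theta>))"
    and "dir_inverse \<sigma> \<theta> (dir_map \<sigma> \<theta> z) = z"
proof -
  interpret convolution_powers "ray_powers \<theta>" "\<alpha> \<theta>" "\<gamma> \<theta>"
    by (rule convolution_powers_ray[OF \<theta>])
  let ?Z = "z * cis \<theta>"
  let ?\<Phi> = "laplace (ray_powers \<theta> 0) ?Z"
  have Z: "Re ?Z > \<gamma> \<theta> + 2 * cmod \<sigma> + (1 + sqrt 2) * s" using z by (simp only: half_plane_def mem_Collect_eq)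
  then have Z': "Re ?Z > \<gamma> \<theta> + (1 + sqrt 2) * s" using norm_ge_zero[of \<sigma>] by linarith
  have c: "dir_map \<sigma> \<theta> z * cis \<theta> = ?Z + \<sigma> * cis \<theta> + ?\<Phi>"
    unfolding dir_map_eq distrib_right using cis_cancel(2)[of \<theta> ?\<Phi>] by (simp only: mult.commute)
  have "\<bar>Re (\<sigma> * cis \<theta>)\<bar> \<le> cmod \<sigma>"
    using abs_Re_le_cmod[of "\<sigma> * cis \<theta>"] by (simp only: norm_mult norm_cis mult_1_right)
  moreover have "\<bar>Re ?\<Phi>\<bar> \<le> (sqrt 2 - 1) * s"
    using abs_Re_le_cmod[of ?\<Phi>] laplace_A0_small[OF Z'] by linarith
  ultimately have "Re (dir_map \<sigma> \<theta> z * cis \<theta>) > \<gamma> \<theta> + cmod \<sigma> + 2 * s"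
    unfolding c plus_complex.sel using Z by (simp only: distrib_right left_diff_distrib)
  then show "dir_map \<sigma> \<theta> z \<in> half_plane \<theta> (\<gamma> \<theta> + cmod \<sigma> + 2 * s)"
    by (simp only: half_plane_def mem_Collect_eq)
  have "(dir_map \<sigma> \<theta> z - \<sigma>) * cis \<theta> = ?Z + ?\<Phi>"
    unfolding left_diff_distrib c by simp
  then show "dir_inverse \<sigma> \<theta> (dir_map \<sigma> \<theta> z) = z"
    unfolding dir_inverse_eq[OF \<theta>] by (simp only: laplace_left_inverse[OF Z']) (simp add: dir_map_eq)
qed

text \<open>Subtracting \<sigma> costs at most |\<sigma>| of the real part, which leaves a point in
  the half-plane of \<open>laplace_right_inverse\<close>.\<close>

lemma dir_map_dir_inverse:
  assumes \<theta>: "\<theta> \<in> I" "\<alpha> \<theta> \<ge> 0"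
    and z: "z \<in> half_plane \<theta> (\<gamma> \<theta> + cmod \<sigma> + (1 + sqrt 2) * sqrt (\<alpha> \<theta>))"
  shows "dir_inverse \<sigma> \<theta> z \<in> half_plane \<theta> (\<gamma> \<theta>)"
    and "dir_map \<sigma> \<theta> (dir_inverse \<sigma> \<theta> z) = z"
proof -
  interpret convolution_powers "ray_powers \<theta>" "\<alpha> \<theta>" "\<gamma> \<theta>"
    by (rule convolution_powers_ray[OF \<theta>])
  define U where "U = (z - \<sigma>) * cis \<theta>"
  have "Re (z * cis \<theta>) > \<gamma> \<theta> + cmod \<sigma> + (1 + sqrt 2) * s" using z by (simp only: half_plane_def mem_Collect_eq)
  moreover have "\<bar>Re (\<sigma> * cis \<theta>)\<bar> \<le> cmod \<sigma>"
    using abs_Re_le_cmod[of "\<sigma> * cis \<theta>"] by (simp only: norm_mult norm_cis mult_1_right)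
  ultimately have U: "Re U > \<gamma> \<theta> + (1 + sqrt 2) * s"
    unfolding U_def left_diff_distrib minus_complex.sel by linarith
  have d: "dir_inverse \<sigma> \<theta> z = z - \<sigma> - cis (- \<theta>) * laplace E U"
    unfolding dir_inverse_eq[OF \<theta>] U_def ..
  have c: "dir_inverse \<sigma> \<theta> z * cis \<theta> = U - laplace E U"
    unfolding d left_diff_distrib[of _ "cis (- \<theta>) * laplace E U"] U_def[symmetric]
    using cis_cancel(2)[of \<theta> "laplace E U"] by (simp only: mult.commute)
  show "dir_inverse \<sigma> \<theta> z \<in> half_plane \<theta> (\<gamma> \<theta>)"
    unfolding half_plane_def mem_Collect_eq c by (rule laplace_right_inverse(1)[OF U])
  show "dir_map \<sigma> \<theta> (dir_inverse \<sigma> \<theta> z) = z"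
    unfolding dir_map_eq c laplace_right_inverse(2)[OF U] by (simp add: d)
qed

text \<open>Gives the inverse the independence of the direction already proved for G. Besides the
  exponential bound this needs its new rate to be locally bounded.\<close>

lemma sector_function_inverse:
  assumes \<alpha>: "\<And>\<theta>. \<theta> \<in> I \<Longrightarrow> \<alpha> \<theta> \<ge> 0"
  shows "sector_function W I (\<lambda>\<theta>. \<gamma> \<theta> + cmod \<sigma> + 2 * sqrt (\<alpha> \<theta>)) \<alpha> (inverse_minor G \<sigma>)"
proof
  show "locally_bounded_on I (\<lambda>\<theta>. \<gamma> \<theta> + cmod \<sigma> + 2 * sqrt (\<alpha> \<theta>))"
    unfolding locally_bounded_on_def
  proof (intro allI impI)
    fix a b assume sub: "{a..b} \<subseteq> I"
    have "bounded (\<gamma> ` {a..b})" "bounded (\<alpha> ` {a..b})"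
      using \<gamma>_bounded \<alpha>_bounded sub unfolding locally_bounded_on_def by auto
    then obtain M A where "\<forall>y\<in>\<gamma> ` {a..b}. norm y \<le> M" "\<forall>y\<in>\<alpha> ` {a..b}. norm y \<le> A"
      unfolding bounded_iff by blast
    then have M: "\<bar>\<gamma> x\<bar> \<le> M" and A: "\<bar>\<alpha> x\<bar> \<le> A" if "x \<in> {a..b}" for x
      using that by auto
    have "norm (\<gamma> x + cmod \<sigma> + 2 * sqrt (\<alpha> x)) \<le> M + cmod \<sigma> + 2 * sqrt A" if "x \<in> {a..b}" for x
    proof -
      have "sqrt (\<alpha> x) \<le> sqrt A" using A[OF that] by (intro real_sqrt_le_mono) linarith
      moreover have "sqrt (\<alpha> x) \<ge> 0" using \<alpha> sub that by auto
      ultimately show ?thesis using M[OF that] norm_ge_zero[of \<sigma>] unfolding real_norm_def by linarith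
    qed
    then show "bounded ((\<lambda>\<theta>. \<gamma> \<theta> + cmod \<sigma> + 2 * sqrt (\<alpha> \<theta>)) ` {a..b})"
      unfolding bounded_iff by blast
  qed
qed (use I_open I_interval sector_W inverse_minor_holomorphic inverse_minor_bound \<alpha>_bounded \<alpha> in auto)

lemma dir_map_consistent:
  assumes "\<theta>\<^sub>1 \<in> I" "\<theta>\<^sub>2 \<in> I" "\<bar>\<theta>\<^sub>1 - \<theta>\<^sub>2\<bar> < pi"
    and "z \<in> half_plane \<theta>\<^sub>1 (\<gamma> \<theta>\<^sub>1)" "z \<in> half_plane \<theta>\<^sub>2 (\<gamma> \<theta>\<^sub>2)"
  shows "dir_map \<sigma> \<theta>\<^sub>1 z = dir_map \<sigma> \<theta>\<^sub>2 z"
  using ray_integral_consistent[OF assms] by (simp add: dir_map_def ray_integral_def)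

lemma dir_inverse_consistent:
  assumes "\<And>\<theta>. \<theta> \<in> I \<Longrightarrow> \<alpha> \<theta> \<ge> 0"
    and "\<theta>\<^sub>1 \<in> I" "\<theta>\<^sub>2 \<in> I" "\<bar>\<theta>\<^sub>1 - \<theta>\<^sub>2\<bar> < pi"
    and "z \<in> half_plane \<theta>\<^sub>1 (\<gamma> \<theta>\<^sub>1 + cmod \<sigma> + 2 * sqrt (\<alpha> \<theta>\<^sub>1))"
    and "z \<in> half_plane \<theta>\<^sub>2 (\<gamma> \<theta>\<^sub>2 + cmod \<sigma> + 2 * sqrt (\<alpha> \<theta>\<^sub>2))"
  shows "dir_inverse \<sigma> \<theta>\<^sub>1 z = dir_inverse \<sigma> \<theta>\<^sub>2 z"
proof -
  interpret inv: sector_function W I "\<lambda>\<theta>. \<gamma> \<theta> + cmod \<sigma> + 2 * sqrt (\<alpha> \<theta>)" \<alpha> "inverse_minor G \<sigma>"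
    by (rule sector_function_inverse[OF assms(1)])
  show ?thesis
    using inv.ray_integral_consistent[OF assms(2-)] by (simp add: dir_inverse_def inv.ray_integral_def)
qed

text \<open>Two points with the same image are both recovered from it by the inverse for \<open>\<sigma> = 0\<close>.\<close>

lemma dir_map_injective:
  assumes \<alpha>: "\<And>\<theta>. \<theta> \<in> I \<Longrightarrow> \<alpha> \<theta> \<ge> 0"
    and \<theta>: "\<theta>\<^sub>1 \<in> I" "\<theta>\<^sub>2 \<in> I" "\<bar>\<theta>\<^sub>1 - \<theta>\<^sub>2\<bar> < pi"
    and z: "z\<^sub>1 \<in> half_plane \<theta>\<^sub>1 (\<gamma> \<theta>\<^sub>1 + (1 + sqrt 2) * sqrt (\<alpha> \<theta>\<^sub>1))"
      "z\<^sub>2 \<in> half_plane \<theta>\<^sub>2 (\<gamma> \<theta>\<^sub>2 + (1 + sqrt 2) * sqrt (\<alpha> \<theta>\<^sub>2))"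
    and eq: "dir_map \<sigma> \<theta>\<^sub>1 z\<^sub>1 = dir_map \<sigma> \<theta>\<^sub>2 z\<^sub>2"
  shows "z\<^sub>1 = z\<^sub>2"
proof -
  have eq0: "dir_map 0 \<theta>\<^sub>1 z\<^sub>1 = dir_map 0 \<theta>\<^sub>2 z\<^sub>2"
    using eq by (simp add: dir_map_def algebra_simps)
  have "z\<^sub>1 = dir_inverse 0 \<theta>\<^sub>1 (dir_map 0 \<theta>\<^sub>1 z\<^sub>1)"
    using dir_inverse_dir_map(2)[of \<theta>\<^sub>1 z\<^sub>1 0] \<theta> \<alpha> z by simp
  also have "\<dots> = dir_inverse 0 \<theta>\<^sub>2 (dir_map 0 \<theta>\<^sub>1 z\<^sub>1)"
    using dir_inverse_dir_map(1)[of \<theta>\<^sub>1 z\<^sub>1 0] dir_inverse_dir_map(1)[of \<theta>\<^sub>2 z\<^sub>2 0] \<theta> \<alpha> z eq0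
    by (intro dir_inverse_consistent) auto
  also have "\<dots> = z\<^sub>2"
    using dir_inverse_dir_map(2)[of \<theta>\<^sub>2 z\<^sub>2 0] \<theta> \<alpha> z eq0 by simp
  finally show ?thesis .
qed

end

section \<open>Laplace sums in the plane and on the Riemann surface of the logarithm\<close>

lemma dir_sum_eq:
  assumes "open I" "is_interval I" "\<theta> \<in> I" and F: "extends_to_sector I (minor f) F"
    and G: "\<And>\<zeta>. \<zeta> \<in> sector I \<Longrightarrow> G \<zeta> = F \<zeta>"
  shows "dir_sum I f \<theta> z = z + fps_nth f 0 + laplace (\<lambda>t. G (of_real t * cis \<theta>)) (z * cis \<theta>) * cis \<theta>"
proof -
  have "(LBINT \<xi>:{0<..}. exp (- (z * of_real \<xi> * cis \<theta>)) *
       sector_extension I (minor f) (of_real \<xi> * cis \<theta>) * cis \<theta>) =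
     (LBINT t:{0<..}. exp (- (z * cis \<theta> * of_real t)) * G (of_real t * cis \<theta>) * cis \<theta>)"
  proof (rule set_lebesgue_integral_cong)
    show "\<forall>t. t \<in> {0<..} \<longrightarrow> exp (- (z * of_real t * cis \<theta>)) * sector_extension I (minor f) (of_real t * cis \<theta>) * cis \<theta> =
        exp (- (z * cis \<theta> * of_real t)) * G (of_real t * cis \<theta>) * cis \<theta>"
    proof (intro allI impI)
      fix t :: real assume "t \<in> {0<..}"
      then have "of_real t * cis \<theta> \<in> sector I" using assms by (intro sectorI) auto
      then show "exp (- (z * of_real t * cis \<theta>)) * sector_extension I (minor f) (of_real t * cis \<theta>) * cis \<theta> =
        exp (- (z * cis \<theta> * of_real t)) * G (of_real t * cis \<theta>) * cis \<theta>"
        using sector_extension_eq[OF assms(1,2) F] G by (simp add: mult_ac)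
    qed
  qed simp
  then show ?thesis
    by (simp add: dir_sum_def laplace_def formal_borel_def)
qed

text \<open>The negation of \<open>long_interval\<close> only gives a distance of at most \<pi>;
  equality is excluded because the open set I extends slightly beyond its point b.\<close>

lemma short_interval_less_pi:
  assumes "\<not> long_interval I" "open I" "a \<in> I" "b \<in> I"
  shows "\<bar>a - b\<bar> < pi"
proof -
  have *: "b - a < pi" if "a \<in> I" "b \<in> I" for a b
  proof -
    obtain e where "e > 0" "ball b e \<subseteq> I"
      using assms(2) \<open>b \<in> I\<close> openE by blast
    then have "b + e / 2 \<in> I" by (auto simp: subset_iff dist_real_def)
    with assms(1) \<open>a \<in> I\<close> have "b + e / 2 - a \<le> pi"
      unfolding long_interval_def by (meson not_le)
    with \<open>e > 0\<close> show ?thesis by simp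
  qed
  from *[OF assms(3,4)] *[OF assms(4,3)] show ?thesis by linarith
qed

lemma half_plane_mono: "z \<in> half_plane \<theta> d \<Longrightarrow> c \<le> d \<Longrightarrow> z \<in> half_plane \<theta> c"
  by (auto simp: half_plane_def)

text \<open>In a short interval any two directions are close enough for \<open>consistent\<close>,
  so the description in \<open>plane_sum\<close> has a unique solution.\<close>

lemma plane_sum_eq:
  assumes consistent: "\<And>\<theta>\<^sub>1 \<theta>\<^sub>2 z. \<theta>\<^sub>1 \<in> I \<Longrightarrow> \<theta>\<^sub>2 \<in> I \<Longrightarrow> \<bar>\<theta>\<^sub>1 - \<theta>\<^sub>2\<bar> < pi \<Longrightarrow>
      z \<in> half_plane \<theta>\<^sub>1 (\<gamma> \<theta>\<^sub>1) \<Longrightarrow> z \<in> half_plane \<theta>\<^sub>2 (\<gamma> \<theta>\<^sub>2) \<Longrightarrow> dir_sum I f \<theta>\<^sub>1 z = dir_sum I f \<theta>\<^sub>2 z"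
    and "\<not> long_interval I" "open I" "\<theta> \<in> I" "z \<in> half_plane \<theta> (\<gamma> \<theta>)"
  shows "plane_sum I \<gamma> f z = dir_sum I f \<theta> z"
  unfolding plane_sum_def
proof (rule the_equality)
  fix w assume "\<exists>\<theta>\<in>I. z \<in> half_plane \<theta> (\<gamma> \<theta>) \<and> w = dir_sum I f \<theta> z"
  then show "w = dir_sum I f \<theta> z"
    using consistent short_interval_less_pi[OF assms(2,3)] assms(4,5) by blast
qed (use assms in blast)

text \<open>arccos decreases, and c \<ge> 0 keeps arccos (c / r) within \<pi> / 2. The condition
  splits into a choice of sheet and the half-plane inequality for the projection.\<close>

lemma log_half_plane_iff:
  assumes "c \<ge> 0"
  shows "(r, t) \<in> log_half_plane \<theta> c \<longleftrightarrow> r > 0 \<and> \<bar>t + \<theta>\<bar> < pi / 2 \<and> r * cos (t + \<theta>) > c"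
proof (cases "r > c")
  case True
  define y where "y = c / r"
  have r: "r > 0" and y: "0 \<le> y" "y < 1" using True assms by (auto simp: y_def)
  define x where "x = \<bar>t + \<theta>\<bar>"
  have cos: "cos (t + \<theta>) = cos x" by (simp add: x_def)
  have "x < arccos y \<longleftrightarrow> x < pi / 2 \<and> cos x > y"
  proof
    assume *: "x < arccos y"
    have "arccos y \<le> pi / 2" using y by (intro arccos_le_pi2) auto
    moreover have "cos x > cos (arccos y)"
      using * arccos_ubound[of y] y by (intro cos_monotone_0_pi) (auto simp: x_def)
    ultimately show "x < pi / 2 \<and> cos x > y" using * y by simp
  next
    assume *: "x < pi / 2 \<and> cos x > y"
    then have "arccos (cos x) < arccos y"
      using y by (intro arccos_less_arccos) auto
    moreover have "x \<le> pi" using * pi_gt_zero by linarith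
    then have "arccos (cos x) = x" by (intro arccos_cos) (auto simp: x_def)
    ultimately show "x < arccos y" by simp
  qed
  moreover have "cos x > y \<longleftrightarrow> r * cos x > c" using r by (simp add: y_def field_simps)
  ultimately show ?thesis
    using True r by (simp add: log_half_plane_def cos x_def[symmetric] y_def[symmetric])
next
  case False
  have "r * cos (t + \<theta>) \<le> c" if "r > 0"
  proof -
    have "r * cos (t + \<theta>) \<le> r * 1" using that by (intro mult_left_mono) auto
    with False show ?thesis by simp
  qed
  with False show ?thesis by (auto simp: log_half_plane_def)
qed

lemma log_half_plane_mono: "p \<in> log_half_plane \<theta> d \<Longrightarrow> 0 \<le> c \<Longrightarrow> c \<le> d \<Longrightarrow> p \<in> log_half_plane \<theta> c"
  by (cases p) (auto simp: log_half_plane_iff)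

lemma log_proj_times_cis: "log_proj (r, t) * cis \<theta> = rcis r (t + \<theta>)"
  by (simp add: log_proj_def rcis_def cis_mult)

lemma log_proj_in_half_plane:
  assumes "p \<in> log_half_plane \<theta> c" "c \<ge> 0"
  shows "log_proj p \<in> half_plane \<theta> c"
  using assms by (cases p) (simp only: log_half_plane_iff half_plane_def mem_Collect_eq log_proj_times_cis Re_rcis)

text \<open>Multiplication by cis \<theta> brings w into the right half-plane, where the principal
  logarithm supplies an argument of modulus below \<pi> / 2.\<close>

lemma log_lift_exists:
  assumes w: "w \<in> half_plane \<theta> c" and "c \<ge> 0"
  obtains q where "q \<in> log_half_plane \<theta> c" "log_proj q = w"
proof -
  define u where "u = w * cis \<theta>"
  have u: "Re u > c" using w by (simp only: half_plane_def u_def mem_Collect_eq)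
  then have "Re u > 0" using assms by simp
  then have "u \<noteq> 0" by auto
  define a where "a = Im (Ln u)"
  have a: "\<bar>a\<bar> < pi / 2" unfolding a_def by (rule Re_Ln_pos_lt_imp[OF \<open>Re u > 0\<close>])
  have ua: "u = rcis (cmod u) a"
    using exp_Ln[OF \<open>u \<noteq> 0\<close>] exp_eq_polar[of "Ln u"] \<open>u \<noteq> 0\<close> by (simp add: rcis_def a_def)
  have "w = u * cis (- \<theta>)" by (simp add: u_def mult.assoc cis_mult)
  also have "\<dots> = log_proj (cmod u, a - \<theta>)"
    by (subst ua) (simp add: log_proj_def rcis_def mult.assoc cis_mult)
  finally have "log_proj (cmod u, a - \<theta>) = w" ..
  moreover have "(cmod u, a - \<theta>) \<in> log_half_plane \<theta> c"
    using a u ua \<open>u \<noteq> 0\<close> \<open>c \<ge> 0\<close> by (simp add: log_half_plane_iff) (metis Re_rcis)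
  ultimately show ?thesis using that by blast
qed

text \<open>The two arguments agree modulo 2 \<pi> and differ by less than \<pi> / 2 + \<pi> / 2 +
  \<pi>.\<close>

lemma log_lift_unique:
  assumes p: "p\<^sub>1 \<in> log_half_plane \<theta>\<^sub>1 0" "p\<^sub>2 \<in> log_half_plane \<theta>\<^sub>2 0" and "\<bar>\<theta>\<^sub>1 - \<theta>\<^sub>2\<bar> < pi"
    and eq: "log_proj p\<^sub>1 = log_proj p\<^sub>2"
  shows "p\<^sub>1 = p\<^sub>2"
proof -
  obtain r\<^sub>1 t\<^sub>1 r\<^sub>2 t\<^sub>2 where p_eq: "p\<^sub>1 = (r\<^sub>1, t\<^sub>1)" "p\<^sub>2 = (r\<^sub>2, t\<^sub>2)" by fastforce
  with p have *: "r\<^sub>1 > 0" "r\<^sub>2 > 0" "\<bar>t\<^sub>1 + \<theta>\<^sub>1\<bar> < pi / 2" "\<bar>t\<^sub>2 + \<theta>\<^sub>2\<bar> < pi / 2"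
    by (simp_all add: log_half_plane_iff)
  have "rcis r\<^sub>1 t\<^sub>1 = rcis r\<^sub>2 t\<^sub>2" using eq by (simp add: p_eq log_proj_def)
  moreover from this have "r\<^sub>1 = r\<^sub>2" using * complex_mod_rcis by (metis abs_of_pos)
  ultimately have "cis t\<^sub>1 = cis t\<^sub>2" using * by (simp add: rcis_def)
  then have "cos (t\<^sub>1 - t\<^sub>2) = 1"
    by (metis cis.sel(1) cis_divide cis_zero cos_zero divide_self_if cis_neq_zero diff_self)
  then obtain n :: int where n: "t\<^sub>1 - t\<^sub>2 = of_int n * 2 * pi"
    using cos_one_2pi_int by auto
  have "\<bar>t\<^sub>1 - t\<^sub>2\<bar> < 2 * pi" using * assms(3) by linarith
  then have "\<bar>of_int n\<bar> < (1::real)" unfolding n by (simp add: abs_mult)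
  then have "n = 0" by linarith
  with n \<open>r\<^sub>1 = r\<^sub>2\<close> show ?thesis by (simp add: p_eq)
qed

text \<open>Two directions whose lifted half-planes contain p are both within \<pi> / 2 of minus its
  argument, hence less than \<pi> apart. On the surface this takes the place of the shortness of
  I.\<close>

lemma log_sum_eq:
  assumes consistent: "\<And>\<theta>\<^sub>1 \<theta>\<^sub>2 z. \<theta>\<^sub>1 \<in> I \<Longrightarrow> \<theta>\<^sub>2 \<in> I \<Longrightarrow> \<bar>\<theta>\<^sub>1 - \<theta>\<^sub>2\<bar> < pi \<Longrightarrow>
      z \<in> half_plane \<theta>\<^sub>1 (\<gamma> \<theta>\<^sub>1) \<Longrightarrow> z \<in> half_plane \<theta>\<^sub>2 (\<gamma> \<theta>\<^sub>2) \<Longrightarrow> dir_sum I f \<theta>\<^sub>1 z = dir_sum I f \<theta>\<^sub>2 z"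
    and \<gamma>: "\<And>\<theta>. \<theta> \<in> I \<Longrightarrow> \<gamma> \<theta> \<ge> 0" and \<theta>: "\<theta> \<in> I"
    and p: "p \<in> log_half_plane \<theta> (\<gamma> \<theta>)" and q: "q \<in> log_half_plane \<theta> 0"
    and eq: "log_proj q = dir_sum I f \<theta> (log_proj p)"
  shows "log_sum I \<gamma> f p = q"
  unfolding log_sum_def
proof (rule the_equality)
  show "is_log_value I \<gamma> f p q"
    using \<theta> p q eq unfolding is_log_value_def by blast
  fix q' assume "is_log_value I \<gamma> f p q'"
  then obtain \<theta>' where *: "\<theta>' \<in> I" "p \<in> log_half_plane \<theta>' (\<gamma> \<theta>')" "q' \<in> log_half_plane \<theta>' 0"
      "log_proj q' = dir_sum I f \<theta>' (log_proj p)"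
    unfolding is_log_value_def by blast
  have "p \<in> log_half_plane \<theta> 0" "p \<in> log_half_plane \<theta>' 0"
    using p *(2) \<gamma>[OF \<theta>] \<gamma>[OF *(1)] log_half_plane_mono by blast+
  moreover obtain r t where "p = (r, t)" by fastforce
  ultimately have "\<bar>t + \<theta>\<bar> < pi / 2" "\<bar>t + \<theta>'\<bar> < pi / 2"
    using log_half_plane_iff[of 0 r t] by auto
  then have "\<bar>\<theta>' - \<theta>\<bar> < pi"
    by linarith
  moreover from this have "log_proj q' = log_proj q"
    unfolding eq *(4) using p * \<theta> \<gamma> by (intro consistent log_proj_in_half_plane) auto
  ultimately show "q' = q"
    using *(3) q by (intro log_lift_unique)
qed

text \<open>The domains are unions of half-planes, so each claim is settled in fixed directions
  (\<open>left\<close>, \<open>right\<close>, \<open>inj\<close>) and carried over to the sums by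
  independence of the direction. On the surface, values are in addition lifted to the sheet of the
  same direction.\<close>

theorem theorem17p3:
  fixes I :: "real set" and \<gamma> \<alpha> \<gamma>\<^sub>s \<gamma>\<^sub>1 \<gamma>\<^sub>2 \<gamma>\<^sub>3 :: "real \<Rightarrow> real" and \<sigma> :: complex
    and f h :: "complex fps"
  assumes "open I" "is_interval I" "I \<noteq> {}"
    and "locally_bounded_on I \<gamma>" "locally_bounded_on I \<alpha>"
    and "\<And>\<theta>. \<theta> \<in> I \<Longrightarrow> \<alpha> \<theta> \<ge> 0"
    and "\<And>\<theta>. long_interval I \<Longrightarrow> \<theta> \<in> I \<Longrightarrow> \<gamma> \<theta> > 0"
    and "f \<in> G_space \<sigma> I \<gamma> \<alpha>"
    and "h = inv\<^bsub>id_plus_group\<^esub> f"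
    and "\<gamma>\<^sub>s = (\<lambda>\<theta>. \<gamma> \<theta> + cmod \<sigma> + 2 * sqrt (\<alpha> \<theta>))"
    and "\<gamma>\<^sub>1 = (\<lambda>\<theta>. \<gamma> \<theta> + 2 * cmod \<sigma> + (1 + sqrt 2) * sqrt (\<alpha> \<theta>))"
    and "\<gamma>\<^sub>2 = (\<lambda>\<theta>. \<gamma> \<theta> + cmod \<sigma> + (1 + sqrt 2) * sqrt (\<alpha> \<theta>))"
    and "\<gamma>\<^sub>3 = (\<lambda>\<theta>. \<gamma> \<theta> + (1 + sqrt 2) * sqrt (\<alpha> \<theta>))"
  shows "h \<in> G_space (- \<sigma>) I \<gamma>\<^sub>s \<alpha> \<and>
    (\<not> long_interval I \<longrightarrow>
       plane_sum I \<gamma> f ` plane_domain I \<gamma>\<^sub>1 \<subseteq> plane_domain I \<gamma>\<^sub>s \<and>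
       (\<forall>z\<in>plane_domain I \<gamma>\<^sub>1. plane_sum I \<gamma>\<^sub>s h (plane_sum I \<gamma> f z) = z) \<and>
       plane_sum I \<gamma>\<^sub>s h ` plane_domain I \<gamma>\<^sub>2 \<subseteq> plane_domain I \<gamma> \<and>
       (\<forall>z\<in>plane_domain I \<gamma>\<^sub>2. plane_sum I \<gamma> f (plane_sum I \<gamma>\<^sub>s h z) = z) \<and>
       inj_on (plane_sum I \<gamma> f) (plane_domain I \<gamma>\<^sub>3)) \<and>
    (long_interval I \<longrightarrow>
       log_sum I \<gamma> f ` log_domain I \<gamma>\<^sub>1 \<subseteq> log_domain I \<gamma>\<^sub>s \<and>
       (\<forall>p\<in>log_domain I \<gamma>\<^sub>1. log_sum I \<gamma>\<^sub>s h (log_sum I \<gamma> f p) = p) \<and>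
       log_sum I \<gamma>\<^sub>s h ` log_domain I \<gamma>\<^sub>2 \<subseteq> log_domain I \<gamma> \<and>
       (\<forall>p\<in>log_domain I \<gamma>\<^sub>2. log_sum I \<gamma> f (log_sum I \<gamma>\<^sub>s h p) = p) \<and>
       log_injective_on I \<gamma>\<^sub>3 f)"
proof -
  note \<alpha>_nn = assms(6)
  obtain \<phi> F where f: "f = fps_const \<sigma> + \<phi>" "fps_nth \<phi> 0 = 0"
    and F: "extends_to_sector I (minor \<phi>) F"
    and F_bound: "\<And>\<theta> \<xi>. \<theta> \<in> I \<Longrightarrow> \<xi> > 0 \<Longrightarrow> cmod (F (of_real \<xi> * cis \<theta>)) \<le> \<alpha> \<theta> * exp (\<gamma> \<theta> * \<xi>)"
    using assms(8) unfolding G_space_def N_space_def by blast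
  obtain W G where W: "star_domain W" "sector I \<subseteq> W" and G: "G holomorphic_on W" "G has_fps_expansion minor \<phi>"
    "\<And>\<zeta>. \<zeta> \<in> sector I \<Longrightarrow> G \<zeta> = F \<zeta>"
    using extends_to_starlike[OF assms(1) F] by blast
  interpret star_domain W by fact
  interpret sector_function W I \<gamma> \<alpha> G
  proof
    show "cmod (G (of_real \<xi> * cis \<theta>)) \<le> \<alpha> \<theta> * exp (\<gamma> \<theta> * \<xi>)" if "\<theta> \<in> I" "\<xi> > 0" for \<theta> \<xi>
      using F_bound[OF that] G(3)[OF sectorI[OF that(2,1)]] by simp
  qed (use assms(1,2,4,5) W(2) G(1) in auto)
  let ?H = "inverse_minor G \<sigma>"

  have h: "h = id_plus_comp (lagrange_inverse \<phi>) (fps_const (- \<sigma>))"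
    unfolding assms(9) f(1) by (rule inv_id_plus_group)
  have h0: "fps_nth h 0 = - \<sigma>"
    by (simp add: h fps_nth_0_id_plus_comp fps_nth_0_lagrange_inverse f(2))
  \<comment> \<open>The formal and the analytic computation meet here: the Taylor series of
    \<open>?H\<close> at 0 is the formal Borel transform of h, so \<open>?H\<close> is its extension
    to the sector.\<close>
  have "?H has_fps_expansion - (fps_exp \<sigma> * fps_lagrange_sum (minor \<phi>))"
    unfolding inverse_minor_def
    by (intro has_fps_expansion_minus has_fps_expansion_mult has_fps_expansion_exp
        lagrange_sum_has_fps_expansion G)
  then have H_exp: "?H has_fps_expansion minor h"
    by (simp add: h minor_id_plus_comp_const minor_lagrange_inverse[OF f(2)])
  have H: "extends_to_sector I (minor h) ?H"
    unfolding extends_to_sector_def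
  proof (intro conjI)
    show "fps_conv_radius (minor h) > 0" using H_exp by (simp add: has_fps_expansion_def)
    show "?H holomorphic_on sector I"
      using inverse_minor_holomorphic W(2) by (rule holomorphic_on_subset)
    have "eventually (\<lambda>\<zeta>. eval_fps (minor h) \<zeta> = ?H \<zeta>) (nhds 0)"
      using H_exp by (simp add: has_fps_expansion_def)
    then show "\<forall>\<^sub>F \<zeta> in at 0 within sector I. ?H \<zeta> = eval_fps (minor h) \<zeta>"
      unfolding eventually_at_filter by (rule eventually_mono) auto
  qed
  have "h \<in> G_space (- \<sigma>) I \<gamma>\<^sub>s \<alpha>"
  proof -
    have "minor (h + fps_const \<sigma>) \<in> N_space I \<gamma>\<^sub>s \<alpha>"
      unfolding add.commute[of h] minor_const_add N_space_def assms(10)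
      using H inverse_minor_bound \<alpha>_nn by blast
    moreover have "h = fps_const (- \<sigma>) + (h + fps_const \<sigma>)"
      by (simp add: algebra_simps flip: fps_const_neg)
    moreover have "fps_nth (h + fps_const \<sigma>) 0 = 0" by (simp add: h0)
    ultimately show ?thesis unfolding G_space_def by blast
  qed

  have dir_f: "dir_sum I f \<theta> z = dir_map \<sigma> \<theta> z" if "\<theta> \<in> I" for \<theta> z
    using dir_sum_eq[OF assms(1,2) that, of f F G z] F G(3)
    by (simp add: f minor_const_add dir_map_def)
  have dir_h: "dir_sum I h \<theta> z = dir_inverse \<sigma> \<theta> z" if "\<theta> \<in> I" for \<theta> z
    using dir_sum_eq[OF assms(1,2) that H, of ?H z] by (simp add: h0 dir_inverse_def)
  have cons_f: "dir_sum I f \<theta>\<^sub>1 z = dir_sum I f \<theta>\<^sub>2 z"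
    if "\<theta>\<^sub>1 \<in> I" "\<theta>\<^sub>2 \<in> I" "\<bar>\<theta>\<^sub>1 - \<theta>\<^sub>2\<bar> < pi" "z \<in> half_plane \<theta>\<^sub>1 (\<gamma> \<theta>\<^sub>1)" "z \<in> half_plane \<theta>\<^sub>2 (\<gamma> \<theta>\<^sub>2)" for \<theta>\<^sub>1 \<theta>\<^sub>2 z
    using dir_map_consistent[OF that] that by (simp add: dir_f)
  have cons_h: "dir_sum I h \<theta>\<^sub>1 z = dir_sum I h \<theta>\<^sub>2 z"
    if "\<theta>\<^sub>1 \<in> I" "\<theta>\<^sub>2 \<in> I" "\<bar>\<theta>\<^sub>1 - \<theta>\<^sub>2\<bar> < pi" "z \<in> half_plane \<theta>\<^sub>1 (\<gamma>\<^sub>s \<theta>\<^sub>1)" "z \<in> half_plane \<theta>\<^sub>2 (\<gamma>\<^sub>s \<theta>\<^sub>2)" for \<theta>\<^sub>1 \<theta>\<^sub>2 z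
    using dir_inverse_consistent[OF \<alpha>_nn that(1-3)] that by (simp add: dir_h assms(10))
  have left: "dir_sum I f \<theta> z \<in> half_plane \<theta> (\<gamma>\<^sub>s \<theta>)" "dir_sum I h \<theta> (dir_sum I f \<theta> z) = z"
    if "\<theta> \<in> I" "z \<in> half_plane \<theta> (\<gamma>\<^sub>1 \<theta>)" for \<theta> z
    using dir_inverse_dir_map[OF that(1) \<alpha>_nn[OF that(1)], of z \<sigma>] that by (simp_all add: dir_f dir_h assms(10,11))
  have right: "dir_sum I h \<theta> z \<in> half_plane \<theta> (\<gamma> \<theta>)" "dir_sum I f \<theta> (dir_sum I h \<theta> z) = z"
    if "\<theta> \<in> I" "z \<in> half_plane \<theta> (\<gamma>\<^sub>2 \<theta>)" for \<theta> z
    using dir_map_dir_inverse[OF that(1) \<alpha>_nn[OF that(1)], of z \<sigma>] that by (simp_all add: dir_f dir_h assms(12))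
  have inj: "z\<^sub>1 = z\<^sub>2"
    if "\<theta>\<^sub>1 \<in> I" "\<theta>\<^sub>2 \<in> I" "\<bar>\<theta>\<^sub>1 - \<theta>\<^sub>2\<bar> < pi" "z\<^sub>1 \<in> half_plane \<theta>\<^sub>1 (\<gamma>\<^sub>3 \<theta>\<^sub>1)" "z\<^sub>2 \<in> half_plane \<theta>\<^sub>2 (\<gamma>\<^sub>3 \<theta>\<^sub>2)"
      "dir_sum I f \<theta>\<^sub>1 z\<^sub>1 = dir_sum I f \<theta>\<^sub>2 z\<^sub>2" for \<theta>\<^sub>1 \<theta>\<^sub>2 z\<^sub>1 z\<^sub>2
    using dir_map_injective[OF \<alpha>_nn that(1-3), of z\<^sub>1 z\<^sub>2 \<sigma>] that by (simp add: dir_f assms(13))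
  \<comment> \<open>These rest on 2 \<le> 1 + sqrt 2. They place the half-planes of the claims
    inside those where the sums of f and h are defined.\<close>
  have le: "\<gamma> \<theta> \<le> \<gamma>\<^sub>s \<theta>" "\<gamma> \<theta> \<le> \<gamma>\<^sub>1 \<theta>" "\<gamma>\<^sub>s \<theta> \<le> \<gamma>\<^sub>2 \<theta>" "\<gamma> \<theta> \<le> \<gamma>\<^sub>3 \<theta>" if "\<theta> \<in> I" for \<theta>
  proof -
    have "0 \<le> sqrt (\<alpha> \<theta>)" using \<alpha>_nn[OF that] by simp
    moreover from this have "2 * sqrt (\<alpha> \<theta>) \<le> (1 + sqrt 2) * sqrt (\<alpha> \<theta>)"
      by (intro mult_right_mono) auto
    ultimately show "\<gamma> \<theta> \<le> \<gamma>\<^sub>s \<theta>" "\<gamma> \<theta> \<le> \<gamma>\<^sub>1 \<theta>" "\<gamma>\<^sub>s \<theta> \<le> \<gamma>\<^sub>2 \<theta>" "\<gamma> \<theta> \<le> \<gamma>\<^sub>3 \<theta>"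
      unfolding assms(10-13) using norm_ge_zero[of \<sigma>] by linarith+
  qed

  have "plane_sum I \<gamma> f ` plane_domain I \<gamma>\<^sub>1 \<subseteq> plane_domain I \<gamma>\<^sub>s \<and>
       (\<forall>z\<in>plane_domain I \<gamma>\<^sub>1. plane_sum I \<gamma>\<^sub>s h (plane_sum I \<gamma> f z) = z) \<and>
       plane_sum I \<gamma>\<^sub>s h ` plane_domain I \<gamma>\<^sub>2 \<subseteq> plane_domain I \<gamma> \<and>
       (\<forall>z\<in>plane_domain I \<gamma>\<^sub>2. plane_sum I \<gamma> f (plane_sum I \<gamma>\<^sub>s h z) = z) \<and>
       inj_on (plane_sum I \<gamma> f) (plane_domain I \<gamma>\<^sub>3)" if short: "\<not> long_interval I"
  proof -
    have f_eq: "plane_sum I \<gamma> f z = dir_sum I f \<theta> z" if "\<theta> \<in> I" "z \<in> half_plane \<theta> (\<gamma> \<theta>)" for \<theta> z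
      by (rule plane_sum_eq[where \<gamma> = \<gamma> and f = f, OF cons_f short assms(1) that])
    have h_eq: "plane_sum I \<gamma>\<^sub>s h z = dir_sum I h \<theta> z" if "\<theta> \<in> I" "z \<in> half_plane \<theta> (\<gamma>\<^sub>s \<theta>)" for \<theta> z
      by (rule plane_sum_eq[where \<gamma> = \<gamma>\<^sub>s and f = h, OF cons_h short assms(1) that])
    have 1: "plane_sum I \<gamma> f z \<in> plane_domain I \<gamma>\<^sub>s \<and> plane_sum I \<gamma>\<^sub>s h (plane_sum I \<gamma> f z) = z"
      if z: "z \<in> plane_domain I \<gamma>\<^sub>1" for z
    proof -
      obtain \<theta> where \<theta>: "\<theta> \<in> I" "z \<in> half_plane \<theta> (\<gamma>\<^sub>1 \<theta>)" using z by (auto simp: plane_domain_def)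
      have "plane_sum I \<gamma> f z = dir_sum I f \<theta> z"
        using \<theta> le half_plane_mono by (intro f_eq) blast+
      with h_eq[OF \<theta>(1) left(1)[OF \<theta>]] left[OF \<theta>] \<theta>(1) show ?thesis by (auto simp: plane_domain_def)
    qed
    have 2: "plane_sum I \<gamma>\<^sub>s h z \<in> plane_domain I \<gamma> \<and> plane_sum I \<gamma> f (plane_sum I \<gamma>\<^sub>s h z) = z"
      if z: "z \<in> plane_domain I \<gamma>\<^sub>2" for z
    proof -
      obtain \<theta> where \<theta>: "\<theta> \<in> I" "z \<in> half_plane \<theta> (\<gamma>\<^sub>2 \<theta>)" using z by (auto simp: plane_domain_def)
      have "plane_sum I \<gamma>\<^sub>s h z = dir_sum I h \<theta> z"
        using \<theta> le half_plane_mono by (intro h_eq) blast+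
      with f_eq[OF \<theta>(1) right(1)[OF \<theta>]] right[OF \<theta>] \<theta>(1) show ?thesis by (auto simp: plane_domain_def)
    qed
    have 3: "inj_on (plane_sum I \<gamma> f) (plane_domain I \<gamma>\<^sub>3)"
    proof (rule inj_onI)
      fix z\<^sub>1 z\<^sub>2 assume z: "z\<^sub>1 \<in> plane_domain I \<gamma>\<^sub>3" "z\<^sub>2 \<in> plane_domain I \<gamma>\<^sub>3"
        and eq: "plane_sum I \<gamma> f z\<^sub>1 = plane_sum I \<gamma> f z\<^sub>2"
      obtain \<theta>\<^sub>1 \<theta>\<^sub>2 where \<theta>: "\<theta>\<^sub>1 \<in> I" "z\<^sub>1 \<in> half_plane \<theta>\<^sub>1 (\<gamma>\<^sub>3 \<theta>\<^sub>1)" "\<theta>\<^sub>2 \<in> I" "z\<^sub>2 \<in> half_plane \<theta>\<^sub>2 (\<gamma>\<^sub>3 \<theta>\<^sub>2)"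
        using z by (auto simp: plane_domain_def)
      have "plane_sum I \<gamma> f z\<^sub>1 = dir_sum I f \<theta>\<^sub>1 z\<^sub>1" "plane_sum I \<gamma> f z\<^sub>2 = dir_sum I f \<theta>\<^sub>2 z\<^sub>2"
        using \<theta> le half_plane_mono by (blast intro: f_eq)+
      with eq show "z\<^sub>1 = z\<^sub>2"
        using inj[OF \<theta>(1,3) short_interval_less_pi[OF short assms(1) \<theta>(1,3)] \<theta>(2,4)] by simp
    qed
    show ?thesis using 1 2 3 by blast
  qed
  moreover have "log_sum I \<gamma> f ` log_domain I \<gamma>\<^sub>1 \<subseteq> log_domain I \<gamma>\<^sub>s \<and>
       (\<forall>p\<in>log_domain I \<gamma>\<^sub>1. log_sum I \<gamma>\<^sub>s h (log_sum I \<gamma> f p) = p) \<and>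
       log_sum I \<gamma>\<^sub>s h ` log_domain I \<gamma>\<^sub>2 \<subseteq> log_domain I \<gamma> \<and>
       (\<forall>p\<in>log_domain I \<gamma>\<^sub>2. log_sum I \<gamma> f (log_sum I \<gamma>\<^sub>s h p) = p) \<and>
       log_injective_on I \<gamma>\<^sub>3 f" if long: "long_interval I"
  proof -
    have nn: "0 \<le> \<gamma> \<theta>" "0 \<le> \<gamma>\<^sub>s \<theta>" "0 \<le> \<gamma>\<^sub>1 \<theta>" "0 \<le> \<gamma>\<^sub>2 \<theta>" "0 \<le> \<gamma>\<^sub>3 \<theta>" if "\<theta> \<in> I" for \<theta>
      using assms(7)[OF long that] le[OF that] by linarith+
    have f_eq: "log_sum I \<gamma> f p = q" if "\<theta> \<in> I" "p \<in> log_half_plane \<theta> (\<gamma> \<theta>)" "q \<in> log_half_plane \<theta> 0"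
        "log_proj q = dir_sum I f \<theta> (log_proj p)" for \<theta> p q
      by (rule log_sum_eq[where \<gamma> = \<gamma> and f = f, OF cons_f nn(1) that])
    have h_eq: "log_sum I \<gamma>\<^sub>s h p = q" if "\<theta> \<in> I" "p \<in> log_half_plane \<theta> (\<gamma>\<^sub>s \<theta>)" "q \<in> log_half_plane \<theta> 0"
        "log_proj q = dir_sum I h \<theta> (log_proj p)" for \<theta> p q
      by (rule log_sum_eq[where \<gamma> = \<gamma>\<^sub>s and f = h, OF cons_h nn(2) that])
    have 1: "log_sum I \<gamma> f p \<in> log_domain I \<gamma>\<^sub>s \<and> log_sum I \<gamma>\<^sub>s h (log_sum I \<gamma> f p) = p"
      if p: "p \<in> log_domain I \<gamma>\<^sub>1" for p
    proof -
      obtain \<theta> where \<theta>: "\<theta> \<in> I" "p \<in> log_half_plane \<theta> (\<gamma>\<^sub>1 \<theta>)" using p by (auto simp: log_domain_def)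
      note z = log_proj_in_half_plane[OF \<theta>(2) nn(3)[OF \<theta>(1)]]
      \<comment> \<open>The value is lifted in the direction \<theta> of p, as prescribed for
        additions on the surface; q is then the point at which the sum of h is evaluated.\<close>
      obtain q where q: "q \<in> log_half_plane \<theta> (\<gamma>\<^sub>s \<theta>)" "log_proj q = dir_sum I f \<theta> (log_proj p)"
        using log_lift_exists[OF left(1)[OF \<theta>(1) z] nn(2)[OF \<theta>(1)]] by blast
      have "log_sum I \<gamma> f p = q"
        using \<theta> q nn[OF \<theta>(1)] le[OF \<theta>(1)] by (intro f_eq[of \<theta>]) (auto intro: log_half_plane_mono)
      moreover have "log_sum I \<gamma>\<^sub>s h q = p"
        using \<theta> q nn[OF \<theta>(1)] left(2)[OF \<theta>(1) z] by (intro h_eq[of \<theta>]) (auto intro: log_half_plane_mono)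
      ultimately show ?thesis using q(1) \<theta>(1) by (auto simp: log_domain_def)
    qed
    have 2: "log_sum I \<gamma>\<^sub>s h p \<in> log_domain I \<gamma> \<and> log_sum I \<gamma> f (log_sum I \<gamma>\<^sub>s h p) = p"
      if p: "p \<in> log_domain I \<gamma>\<^sub>2" for p
    proof -
      obtain \<theta> where \<theta>: "\<theta> \<in> I" "p \<in> log_half_plane \<theta> (\<gamma>\<^sub>2 \<theta>)" using p by (auto simp: log_domain_def)
      note z = log_proj_in_half_plane[OF \<theta>(2) nn(4)[OF \<theta>(1)]]
      obtain q where q: "q \<in> log_half_plane \<theta> (\<gamma> \<theta>)" "log_proj q = dir_sum I h \<theta> (log_proj p)"
        using log_lift_exists[OF right(1)[OF \<theta>(1) z] nn(1)[OF \<theta>(1)]] by blast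
      have "log_sum I \<gamma>\<^sub>s h p = q"
        using \<theta> q nn[OF \<theta>(1)] le[OF \<theta>(1)] by (intro h_eq[of \<theta>]) (auto intro: log_half_plane_mono)
      moreover have "log_sum I \<gamma> f q = p"
        using \<theta> q nn[OF \<theta>(1)] right(2)[OF \<theta>(1) z] by (intro f_eq[of \<theta>]) (auto intro: log_half_plane_mono)
      ultimately show ?thesis using q(1) \<theta>(1) by (auto simp: log_domain_def)
    qed
    have 3: "log_injective_on I \<gamma>\<^sub>3 f"
      unfolding log_injective_on_def
    proof (intro ballI impI, elim conjE)
      fix \<theta>\<^sub>1 \<theta>\<^sub>2 p\<^sub>1 p\<^sub>2 assume \<theta>: "\<theta>\<^sub>1 \<in> I" "\<theta>\<^sub>2 \<in> I" and p: "p\<^sub>1 \<in> log_half_plane \<theta>\<^sub>1 (\<gamma>\<^sub>3 \<theta>\<^sub>1)" "p\<^sub>2 \<in> log_half_plane \<theta>\<^sub>2 (\<gamma>\<^sub>3 \<theta>\<^sub>2)"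
        and lt: "\<bar>\<theta>\<^sub>1 - \<theta>\<^sub>2\<bar> < pi" and eq: "dir_sum I f \<theta>\<^sub>1 (log_proj p\<^sub>1) = dir_sum I f \<theta>\<^sub>2 (log_proj p\<^sub>2)"
      \<comment> \<open>Injectivity in the plane identifies the projections; since the directions
        are less than \<pi> apart, the points lie on the same sheet.\<close>
      have "log_proj p\<^sub>1 = log_proj p\<^sub>2"
        using \<theta> p nn(5) by (intro inj[OF \<theta> lt _ _ eq] log_proj_in_half_plane) auto
      then show "p\<^sub>1 = p\<^sub>2"
        using p nn(5) \<theta> lt by (intro log_lift_unique[of p\<^sub>1 \<theta>\<^sub>1 p\<^sub>2 \<theta>\<^sub>2]) (auto intro: log_half_plane_mono)
    qed
    show ?thesis using 1 2 3 by blast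
  qed
  ultimately show ?thesis
    using \<open>h \<in> G_space (- \<sigma>) I \<gamma>\<^sub>s \<alpha>\<close> by blast
qed

end
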